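(* Let $(X_k)_{k\in\mathbb{Z}}$ be a stationary ergodic process, $X_k=X_0\circ T^k$, with $T$ ergodic and $X_0$ real-valued, $\mathcal{F}_0$-measurable, centered and square integrable. Let $S_n(t)=\sum_{k=1}^n \mathrm{e}^{\mathrm{i}kt}X_k$ and $\mathbf{V}_n(t)=\frac{1}{\sqrt n}[\operatorname{Re}S_n(t),\operatorname{Im}S_n(t)]$. Let $t\in(0,2\pi)$ be such that $\mathrm{e}^{-2\mathrm{i}t}$ is not an eigenvalue of $T$, and assume $$\sum_{k\ge1}\frac{1}{k^{3/2}}\|\mathbb{E}_0(S_k(t))\|_2<\infty .$$ Then there is $\Omega'\subset\Omega$ with $\mathbb{P}(\Omega')=1$ such that for all $\omega\in\Omega'$ and every bounded continuous $g:\mathbb{R}^2\to\mathbb{R}$, $\mathbb{E}^\omega[g(\mathbf{V}_n(t))]\to\mathbb{E}[g(N_1(t),N_2(t))]$ as $n\to\infty$, where $N_1(t),N_2(t)$ are independent identically distributed normal random variables with mean $0$ and variance $\sigma_t^2/2$, with $\sigma_t^2$ identified by $$\lim_{n\to\infty}\frac{\mathbb{E}|S_n(t)|^2}{n}=\sigma_t^2 .$$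
   Context: $(\Omega,\mathcal{K},\mathbb{P})$ is a probability space with $\mathcal{K}$ countably generated; $T:\Omega\to\Omega$ is a bijective bi-measurable map preserving $\mathbb{P}$. $T$ is ergodic if every $A\in\mathcal{K}$ with $T(A)=A$ has probability $0$ or $1$. A complex number $\lambda$ is an eigenvalue of $T$ if there is a nonzero $h\in\mathbb{L}^2(\Omega,\mathcal{K},\mathbb{P};\mathbb{C})$ with $h\circ T=\lambda h$ a.s. $\mathcal{F}_0\subset\mathcal{K}$ is a sub-$\sigma$-algebra with $\mathcal{F}_0\subseteq T^{-1}(\mathcal{F}_0)$. $\mathbb{E}_0(Y)=\mathbb{E}(Y|\mathcal{F}_0)$; $\|\cdot\|_2$ is the norm of $\mathbb{L}^2(\mathbb{P})$. $\mathbb{P}^\omega$ denotes a regular conditional probability on $\mathcal{K}$ given $\mathcal{F}_0$, and $\mathbb{E}^\omega$ is the expectation with respect to $\mathbb{P}^\omega$. *)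

theory Defs
  imports "HOL-Probability.Probability"
begin

definition countably_generated :: "'a measure \<Rightarrow> bool" where
  "countably_generated M \<longleftrightarrow>
     (\<exists>C. countable C \<and> C \<subseteq> Pow (space M) \<and> sets M = sigma_sets (space M) C)"

definition invertible_mpt :: "'a measure \<Rightarrow> ('a \<Rightarrow> 'a) \<Rightarrow> bool" where
  "invertible_mpt M T \<longleftrightarrow>
     bij_betw T (space M) (space M) \<and> T \<in> measurable M M \<and>
     (\<forall>A\<in>sets M. T ` A \<in> sets M) \<and> distr M M T = M"

definition ergodic :: "'a measure \<Rightarrow> ('a \<Rightarrow> 'a) \<Rightarrow> bool" where
  "ergodic M T \<longleftrightarrow> (\<forall>A\<in>sets M. T ` A = A \<longrightarrow> measure M A = 0 \<or> measure M A = 1)"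

text \<open>Iterates of \<open>T\<close> with an integer exponent. Outside \<open>space M\<close> the values for negative
  exponents are irrelevant.\<close>

definition iterate :: "'a measure \<Rightarrow> ('a \<Rightarrow> 'a) \<Rightarrow> int \<Rightarrow> 'a \<Rightarrow> 'a" where
  "iterate M T k =
     (if 0 \<le> k then T ^^ nat k else the_inv_into (space M) T ^^ nat (- k))"

definition square_integrable :: "'a measure \<Rightarrow> ('a \<Rightarrow> 'b::{banach, second_countable_topology}) \<Rightarrow> bool" where
  "square_integrable M f \<longleftrightarrow> f \<in> borel_measurable M \<and> integrable M (\<lambda>x. (norm (f x))\<^sup>2)"

definition L2_norm :: "'a measure \<Rightarrow> ('a \<Rightarrow> 'b::{banach, second_countable_topology}) \<Rightarrow> real" where
  "L2_norm M f = sqrt (\<integral>x. (norm (f x))\<^sup>2 \<partial>M)"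

definition is_eigenvalue :: "'a measure \<Rightarrow> ('a \<Rightarrow> 'a) \<Rightarrow> complex \<Rightarrow> bool" where
  "is_eigenvalue M T l \<longleftrightarrow>
     (\<exists>h :: 'a \<Rightarrow> complex. square_integrable M h \<and> \<not> (AE x in M. h x = 0) \<and>
        (AE x in M. h (T x) = l * h x))"

text \<open>The library has conditional expectations of real functions only; complex ones are taken
  componentwise.\<close>

definition complex_cond_exp :: "'a measure \<Rightarrow> 'a measure \<Rightarrow> ('a \<Rightarrow> complex) \<Rightarrow> 'a \<Rightarrow> complex" where
  "complex_cond_exp M F f x =
     Complex (real_cond_exp M F (\<lambda>y. Re (f y)) x) (real_cond_exp M F (\<lambda>y. Im (f y)) x)"

definition regular_cond_prob :: "'a measure \<Rightarrow> 'a measure \<Rightarrow> ('a \<Rightarrow> 'a measure) \<Rightarrow> bool" where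
  "regular_cond_prob M F \<kappa> \<longleftrightarrow>
     (\<forall>\<omega>\<in>space M. prob_space (\<kappa> \<omega>) \<and> sets (\<kappa> \<omega>) = sets M) \<and>
     (\<forall>A\<in>sets M. (\<lambda>\<omega>. measure (\<kappa> \<omega>) A) \<in> borel_measurable F \<and>
        (AE \<omega> in M. measure (\<kappa> \<omega>) A = real_cond_exp M F (indicator A) \<omega>))"

definition fourier_sum :: "(int \<Rightarrow> 'a \<Rightarrow> real) \<Rightarrow> real \<Rightarrow> nat \<Rightarrow> 'a \<Rightarrow> complex" where
  "fourier_sum X t n \<omega> = (\<Sum>k=1..n. exp (\<i> * of_nat k * of_real t) * of_real (X (int k) \<omega>))"

definition fourier_vec :: "(int \<Rightarrow> 'a \<Rightarrow> real) \<Rightarrow> real \<Rightarrow> nat \<Rightarrow> 'a \<Rightarrow> real \<times> real" where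
  "fourier_vec X t n \<omega> =
     (1 / sqrt (real n)) *\<^sub>R (Re (fourier_sum X t n \<omega>), Im (fourier_sum X t n \<omega>))"

text \<open>The normal law with mean \<open>m\<close> and variance \<open>v \<ge> 0\<close>. As the density degenerates for \<open>v = 0\<close>,
  the point mass at \<open>m\<close> is a separate case.\<close>

definition normal_law :: "real \<Rightarrow> real \<Rightarrow> real measure" where
  "normal_law m v =
     (if v = 0 then return borel m
      else density lborel (\<lambda>x. ennreal (normal_density m (sqrt v) x)))"

definition iid_normal_pair ::
  "'b measure \<Rightarrow> ('b \<Rightarrow> real) \<Rightarrow> ('b \<Rightarrow> real) \<Rightarrow> real \<Rightarrow> real \<Rightarrow> bool" where
  "iid_normal_pair Q N\<^sub>1 N\<^sub>2 m v \<longleftrightarrow>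
     prob_space Q \<and> prob_space.indep_var Q borel N\<^sub>1 borel N\<^sub>2 \<and>
     distr Q borel N\<^sub>1 = normal_law m v \<and> distr Q borel N\<^sub>2 = normal_law m v"

lemma sets_normal_law [measurable_cong, simp]: "sets (normal_law m v) = sets borel"
  by (simp add: normal_law_def)

lemma prob_space_normal_law: "0 \<le> v \<Longrightarrow> prob_space (normal_law m v)"
  by (auto simp: normal_law_def intro!: prob_space_return prob_space_normal_density)

lemma ex_iid_normal_pair:
  assumes "0 \<le> v"
  shows "\<exists>(Q :: (real \<times> real) measure) N\<^sub>1 N\<^sub>2. iid_normal_pair Q N\<^sub>1 N\<^sub>2 m v"
proof -
  let ?L = "normal_law m v"
  let ?Q = "?L \<Otimes>\<^sub>M ?L"
  interpret L: prob_space ?L by (rule prob_space_normal_law[OF assms])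
  interpret P: pair_prob_space ?L ?L ..
  have 1: "distr ?Q borel fst = ?L"
    using L.distr_pair_fst[of ?L] by (simp cong: distr_cong)
  have 2: "distr ?Q borel snd = ?L"
    by (subst P.distr_pair_swap, subst distr_distr)
       (use 1 in \<open>auto simp: comp_def case_prod_beta cong: distr_cong\<close>)
  have "P.indep_var borel fst borel snd"
    unfolding P.indep_var_distribution_eq 1 2
    by (auto simp: distr_id2 cong: distr_cong sets_pair_measure_cong)
  with 1 2 P.prob_space_axioms show ?thesis
    unfolding iid_normal_pair_def by blast
qed

end

theory Submission
  imports Defs
begin

text \<open>
  Let \<open>e = exp (\<i> * t)\<close> and let \<open>U h = e * (h \<circ> T)\<close> be the Koopman operator of \<open>T\<close> twisted by the
  frequency \<open>t\<close>. With \<open>f = X 0\<close> the Fourier sum is \<open>S\<^sub>n f = U f + \<dots> + U\<^sup>n f\<close>, so the theorem is a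
  quenched central limit theorem for the orbit of one \<open>F\<close>-measurable function under \<open>U\<close>. Write
  \<open>Q h = E (U h | F)\<close>, a contraction of \<open>L\<^sup>2 (F)\<close>. Then \<open>E (S\<^sub>n f | F) = Q f + \<dots> + Q\<^sup>n f\<close>, and
  \<open>S\<^sub>n (g - Q g)\<close> differs from the martingale \<open>U d + \<dots> + U\<^sup>n d\<close>, where \<open>d = U g - Q g\<close>, by the
  boundary terms \<open>U g - U\<^sup>n\<^sup>+\<^sup>1 g\<close> only. The proof has three parts.

  Maximal inequality. Summing blocks of length \<open>2\<^sup>j\<close> writes \<open>S\<^sub>n f\<close> as a sum over dyadic scales of
  martingales whose increments are governed by \<open>E (S\<^sub>m f | F)\<close> for \<open>m = 2\<^sup>j\<close>
  (\<open>koop_sum_decomp\<close>, \<open>block_sum_decomp\<close>). Under the conditional law at \<open>\<omega>\<close> the second moment of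
  each martingale, divided by its length, is at most a multiple of a conditional orbit average of
  \<open>\<bar>E (S\<^sub>m f | F)\<bar>\<^sup>2\<close>, which the maximal ergodic lemma of Hopf, in
  Garsia's form, controls uniformly in \<open>n\<close> (\<open>hopf_maximal_finite\<close>). Hence the supremum over \<open>n\<close>
  of the conditional norms of \<open>S\<^sub>n f / sqrt n\<close> is integrable, with integral at most a multiple of
  \<open>\<parallel>f\<parallel> + (\<Sum>j. 2 powr (- j / 2) * \<parallel>E (S\<^sub>m f | F)\<parallel>)\<close>, again with \<open>m = 2\<^sup>j\<close>
  (\<open>nn_integral_MW_max\<close>, \<open>kernel_koop_sum_le\<close>). Since the norms of \<open>E (S\<^sub>n f | F)\<close> are subadditive in \<open>n\<close>,
  the series in the hypothesis dominates this dyadic one (\<open>dyadic_condensation_subadditive\<close>).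

  Approximation. For the norm just displayed \<open>f\<close> is a limit of functions \<open>g - Q g\<close> with \<open>g\<close> bounded
  (\<open>bounded_coboundary_approximation\<close>): \<open>f\<close> minus a Cesaro mean of the \<open>Q\<^sup>k f\<close> is of this form, and
  these means tend to \<open>0\<close>. By the maximal inequality it therefore suffices, almost surely and up to an
  error that vanishes along a sequence of approximations, to treat \<open>f = g - Q g\<close>, that is, a martingale
  with bounded stationary differences.

  Martingale part. Multiplying the characteristic function of the martingale by the exponential of half
  its conditional variance gives a product whose factors have conditional mean \<open>1 + O (n powr (- 3 / 2))\<close>
  (\<open>cexp_comp_factor\<close>). The conditional variance converges: the conditional variance of \<open>Re (c * U\<^sup>k d)\<close>
  is half of \<open>\<bar>c\<bar>\<^sup>2 * E (\<bar>d\<bar>\<^sup>2 | F)\<close> plus half of the real part of \<open>c\<^sup>2 * e\<^sup>2\<^sup>k * E (d\<^sup>2 | F)\<close>, both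
  composed with \<open>T\<^sup>k\<close>. The averages of the first part converge to a constant by ergodicity. Those of the
  second part tend to \<open>0\<close> by the mean ergodic theorem, because \<open>e\<^sup>2 * (h \<circ> T) = h\<close> has no nonzero
  solution: this is where the hypothesis on the eigenvalue enters, and why the real and imaginary parts
  are uncorrelated with equal variances in the limit. The convergence of the conditional characteristic
  functions at countably many frequencies, together with bounded conditional second moments, yields
  convergence in law (\<open>wave_weak_convergence\<close>).
\<close>

section \<open>Square integrable functions\<close>

lemma square_integrableD:
  assumes "square_integrable M f"
  shows "f \<in> borel_measurable M" "integrable M (\<lambda>x. (norm (f x))\<^sup>2)"
  using assms by (auto simp: square_integrable_def)

lemma L2_norm_nonneg [simp]: "0 \<le> L2_norm M f"
  by (simp add: L2_norm_def)

lemma L2_norm_power2: "(L2_norm M f)\<^sup>2 = (\<integral>x. (norm (f x))\<^sup>2 \<partial>M)"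
  by (simp add: L2_norm_def)

lemma square_integrable_mono:
  fixes f :: "'a \<Rightarrow> 'b::{banach, second_countable_topology}"
    and g :: "'a \<Rightarrow> 'c::{banach, second_countable_topology}"
  assumes "square_integrable M g" "f \<in> borel_measurable M" "AE x in M. norm (f x) \<le> norm (g x)"
  shows "square_integrable M f" "L2_norm M f \<le> L2_norm M g"
proof -
  have *: "AE x in M. (norm (f x))\<^sup>2 \<le> (norm (g x))\<^sup>2"
    using assms(3) by eventually_elim (simp add: power_mono)
  have [measurable]: "f \<in> borel_measurable M" by fact
  have i: "integrable M (\<lambda>x. (norm (f x))\<^sup>2)"
    by (rule Bochner_Integration.integrable_bound[OF square_integrableD(2)[OF assms(1)]]) (use * in auto)
  then show "square_integrable M f" using assms by (simp add: square_integrable_def)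
  show "L2_norm M f \<le> L2_norm M g"
    unfolding L2_norm_def using integral_mono_AE[OF i square_integrableD(2)[OF assms(1)] *] by simp
qed

lemma square_integrable_cong_AE:
  fixes f g :: "'a \<Rightarrow> 'b::{banach, second_countable_topology}"
  assumes "square_integrable M g" "f \<in> borel_measurable M" "AE x in M. f x = g x"
  shows "square_integrable M f" "L2_norm M f = L2_norm M g"
proof -
  have "AE x in M. norm (f x) \<le> norm (g x)" "AE x in M. norm (g x) \<le> norm (f x)"
    using assms(3) by auto
  then show "square_integrable M f" "L2_norm M f = L2_norm M g"
    using square_integrable_mono[OF assms(1,2)] square_integrable_mono(2)[of M f g]
      square_integrableD(1)[OF assms(1)] by (auto intro: antisym)
qed

lemma integrable_norm_mult:
  fixes f :: "'a \<Rightarrow> 'b::{banach, second_countable_topology}"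
    and g :: "'a \<Rightarrow> 'c::{banach, second_countable_topology}"
  assumes "square_integrable M f" "square_integrable M g"
  shows "integrable M (\<lambda>x. norm (f x) * norm (g x))"
proof -
  note [measurable] = square_integrableD(1)[OF assms(1)] square_integrableD(1)[OF assms(2)]
  have *: "\<bar>norm (f x) * norm (g x)\<bar> \<le> \<bar>(norm (f x))\<^sup>2 + (norm (g x))\<^sup>2\<bar>" for x
  proof -
    have "0 \<le> norm (f x) * norm (g x)" by simp
    then show ?thesis using sum_squares_bound[of "norm (f x)" "norm (g x)"] by (simp del: mult_nonneg_nonneg)
  qed
  show ?thesis
    by (rule Bochner_Integration.integrable_bound
        [OF Bochner_Integration.integrable_add[OF square_integrableD(2)[OF assms(1)] square_integrableD(2)[OF assms(2)]]])
       (use * in auto)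
qed

lemma integral_norm_mult_le:
  fixes f :: "'a \<Rightarrow> 'b::{banach, second_countable_topology}"
    and g :: "'a \<Rightarrow> 'c::{banach, second_countable_topology}"
  assumes "square_integrable M f" "square_integrable M g"
  shows "(\<integral>x. norm (f x) * norm (g x) \<partial>M) \<le> L2_norm M f * L2_norm M g"
proof -
  note [measurable] = square_integrableD(1)[OF assms(1)] square_integrableD(1)[OF assms(2)]
  note i = integrable_norm_mult[OF assms]
  have "ennreal ((\<integral>x. norm (f x) * norm (g x) \<partial>M)\<^sup>2) = (\<integral>\<^sup>+x. ennreal (norm (f x)) * ennreal (norm (g x)) \<partial>M)\<^sup>2"
    using nn_integral_eq_integral[OF i] by (simp add: ennreal_power ennreal_mult)
  also have "\<dots> \<le> (\<integral>\<^sup>+x. ennreal (norm (f x)) ^ 2 \<partial>M) * (\<integral>\<^sup>+x. ennreal (norm (g x)) ^ 2 \<partial>M)"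
    by (rule Cauchy_Schwarz_nn_integral) auto
  also have "\<dots> = ennreal ((L2_norm M f)\<^sup>2) * ennreal ((L2_norm M g)\<^sup>2)"
    using nn_integral_eq_integral[OF square_integrableD(2)[OF assms(1)]]
      nn_integral_eq_integral[OF square_integrableD(2)[OF assms(2)]]
    by (simp add: ennreal_power L2_norm_power2)
  finally have "(\<integral>x. norm (f x) * norm (g x) \<partial>M)\<^sup>2 \<le> (L2_norm M f * L2_norm M g)\<^sup>2"
    by (simp add: ennreal_mult[symmetric] power_mult_distrib)
  then show ?thesis by (rule power2_le_imp_le) simp
qed

lemma square_integrable_add:
  fixes f g :: "'a \<Rightarrow> 'b::{banach, second_countable_topology}"
  assumes "square_integrable M f" "square_integrable M g"
  shows "square_integrable M (\<lambda>x. f x + g x)" "L2_norm M (\<lambda>x. f x + g x) \<le> L2_norm M f + L2_norm M g"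
proof -
  note [measurable] = square_integrableD(1)[OF assms(1)] square_integrableD(1)[OF assms(2)]
  note i = square_integrableD(2)[OF assms(1)] square_integrableD(2)[OF assms(2)] integrable_norm_mult[OF assms]
  let ?b = "\<lambda>x. (norm (f x))\<^sup>2 + (norm (g x))\<^sup>2 + 2 * (norm (f x) * norm (g x))"
  have b: "integrable M ?b" by (intro Bochner_Integration.integrable_add i integrable_mult_right)
  have le: "(norm (f x + g x))\<^sup>2 \<le> ?b x" for x
    using power_mono[OF norm_triangle_ineq[of "f x" "g x"], of 2] by (simp add: power2_sum)
  have ii: "integrable M (\<lambda>x. (norm (f x + g x))\<^sup>2)"
    by (rule Bochner_Integration.integrable_bound[OF b]) (use le in auto)
  then show "square_integrable M (\<lambda>x. f x + g x)" by (simp add: square_integrable_def)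
  have "(L2_norm M (\<lambda>x. f x + g x))\<^sup>2 \<le> (\<integral>x. ?b x \<partial>M)"
    unfolding L2_norm_power2 by (rule integral_mono[OF ii b le])
  also have "\<dots> = (L2_norm M f)\<^sup>2 + (L2_norm M g)\<^sup>2 + 2 * (\<integral>x. norm (f x) * norm (g x) \<partial>M)"
    using i by (simp add: L2_norm_power2)
  also have "\<dots> \<le> (L2_norm M f + L2_norm M g)\<^sup>2"
    using integral_norm_mult_le[OF assms] by (simp add: power2_sum)
  finally show "L2_norm M (\<lambda>x. f x + g x) \<le> L2_norm M f + L2_norm M g"
    by (rule power2_le_imp_le) simp
qed

lemma square_integrable_cmult:
  fixes f :: "'a \<Rightarrow> complex"
  assumes "square_integrable M f"
  shows "square_integrable M (\<lambda>x. c * f x)" "L2_norm M (\<lambda>x. c * f x) = cmod c * L2_norm M f"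
  using square_integrableD[OF assms]
  by (auto simp: square_integrable_def L2_norm_def norm_mult power_mult_distrib real_sqrt_mult)

lemma square_integrable_minus:
  fixes f g :: "'a \<Rightarrow> complex"
  assumes "square_integrable M f" "square_integrable M g"
  shows "square_integrable M (\<lambda>x. f x - g x)" "L2_norm M (\<lambda>x. f x - g x) \<le> L2_norm M f + L2_norm M g"
  using square_integrable_add[OF assms(1) square_integrable_cmult(1)[OF assms(2), of "-1"]]
    square_integrable_cmult(2)[OF assms(2), of "-1"] by auto

lemma square_integrable_zero [simp]: "square_integrable M (\<lambda>x. 0)" "L2_norm M (\<lambda>x. 0) = 0"
  by (auto simp: square_integrable_def L2_norm_def)

lemma square_integrable_sum:
  fixes f :: "'i \<Rightarrow> 'a \<Rightarrow> complex"
  assumes "\<And>i. i \<in> I \<Longrightarrow> square_integrable M (f i)"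
  shows "square_integrable M (\<lambda>x. \<Sum>i\<in>I. f i x)"
    "L2_norm M (\<lambda>x. \<Sum>i\<in>I. f i x) \<le> (\<Sum>i\<in>I. L2_norm M (f i))"
proof -
  have "square_integrable M (\<lambda>x. \<Sum>i\<in>I. f i x) \<and>
    L2_norm M (\<lambda>x. \<Sum>i\<in>I. f i x) \<le> (\<Sum>i\<in>I. L2_norm M (f i))"
    using assms
  proof (induction I rule: infinite_finite_induct)
    case (insert j J)
    then show ?case
      using square_integrable_add[of M "f j" "\<lambda>x. \<Sum>i\<in>J. f i x"] by (auto simp: insert.hyps)
  qed auto
  then show "square_integrable M (\<lambda>x. \<Sum>i\<in>I. f i x)"
    "L2_norm M (\<lambda>x. \<Sum>i\<in>I. f i x) \<le> (\<Sum>i\<in>I. L2_norm M (f i))" by auto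
qed

lemma L2_norm_diff_ge:
  fixes f g :: "'a \<Rightarrow> complex"
  assumes "square_integrable M f" "square_integrable M g"
  shows "\<bar>L2_norm M f - L2_norm M g\<bar> \<le> L2_norm M (\<lambda>x. f x - g x)"
proof -
  have "L2_norm M f \<le> L2_norm M g + L2_norm M (\<lambda>x. f x - g x)"
    using square_integrable_add(2)[OF assms(2) square_integrable_minus(1)[OF assms]] by simp
  moreover have "L2_norm M g \<le> L2_norm M f + L2_norm M (\<lambda>x. f x - g x)"
    using square_integrable_minus(2)[OF assms(1) square_integrable_minus(1)[OF assms]] by simp
  ultimately show ?thesis by simp
qed

lemma (in prob_space) square_integrable_imp_integrable:
  fixes f :: "'a \<Rightarrow> 'b::{banach, second_countable_topology}"
  assumes "square_integrable M f"
  shows "integrable M f" "(\<integral>x. norm (f x) \<partial>M) \<le> L2_norm M f"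
proof -
  have 1: "square_integrable M (\<lambda>x. 1::real)" by (simp add: square_integrable_def)
  have L: "L2_norm M (\<lambda>x. 1::real) = 1" by (simp add: L2_norm_def prob_space)
  have "integrable M (\<lambda>x. norm (f x))" using integrable_norm_mult[OF assms 1] by simp
  then show "integrable M f" using square_integrableD(1)[OF assms] by (simp add: integrable_norm_iff)
  show "(\<integral>x. norm (f x) \<partial>M) \<le> L2_norm M f" using integral_norm_mult_le[OF assms 1] L by simp
qed

lemma (in prob_space) bounded_square_integrable:
  fixes f :: "'a \<Rightarrow> 'b::{banach, second_countable_topology}"
  assumes "f \<in> borel_measurable M" "AE x in M. norm (f x) \<le> B" "0 \<le> B"
  shows "square_integrable M f" "L2_norm M f \<le> B"
proof -
  have 1: "square_integrable M (\<lambda>x. B)" by (simp add: square_integrable_def)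
  have "L2_norm M (\<lambda>x. B) = B" using assms(3) by (simp add: L2_norm_def prob_space)
  then show "square_integrable M f" "L2_norm M f \<le> B"
    using square_integrable_mono[OF 1 assms(1)] assms by auto
qed

section \<open>Plane waves and weak convergence in the plane\<close>

definition wave :: "real \<Rightarrow> real \<Rightarrow> real \<times> real \<Rightarrow> complex" where
  "wave a b z = exp (\<i> * complex_of_real (a * fst z + b * snd z))"

lemma wave_measurable [measurable]: "wave a b \<in> borel_measurable borel"
  unfolding wave_def[abs_def]
  by (intro borel_measurable_continuous_onI continuous_intros)

lemma cmod_wave [simp]: "cmod (wave a b z) = 1"
  by (simp add: wave_def)

lemma wave_mult: "wave a b z * wave a' b' z = wave (a + a') (b + b') z"
  by (simp add: wave_def algebra_simps flip: exp_add)

lemma sin_fst_wave: "complex_of_real (sin (r * fst z)) = (wave r 0 z - wave (- r) 0 z) / (2 * \<i>)"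
  and sin_snd_wave: "complex_of_real (sin (r * snd z)) = (wave 0 r z - wave 0 (- r) z) / (2 * \<i>)"
  by (simp_all add: wave_def sin_of_real[symmetric] sin_exp_eq)

lemma abs_fst_le_norm: "\<bar>fst z\<bar> \<le> norm (z :: real \<times> real)" and abs_snd_le_norm: "\<bar>snd z\<bar> \<le> norm (z :: real \<times> real)"
  using norm_fst_le[of "fst z" "snd z"] norm_snd_le[of "snd z" "fst z"] by auto

lemma (in prob_space) tight_single:
  fixes V :: "'a \<Rightarrow> real \<times> real"
  assumes [measurable]: "V \<in> borel_measurable M" and eps: "0 < \<epsilon>"
  shows "\<exists>r. measure M {x \<in> space M. r < norm (V x)} < \<epsilon>"
proof -
  define A where "A n = {x \<in> space M. real n < norm (V x)}" for n :: nat
  have "decseq A" unfolding A_def decseq_def by (auto simp: order_le_less_trans)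
  moreover have "range A \<subseteq> sets M" unfolding A_def by auto
  ultimately have "(\<lambda>n. measure M (A n)) \<longlonglongrightarrow> measure M (\<Inter>n. A n)"
    by (intro finite_Lim_measure_decseq)
  moreover have "(\<Inter>n. A n) = {}"
  proof (rule ccontr)
    assume "(\<Inter>n. A n) \<noteq> {}"
    then obtain x where x: "\<And>n. real n < norm (V x)" by (auto simp: A_def)
    obtain n where "norm (V x) \<le> real n" using real_arch_simple by blast
    with x[of n] show False by simp
  qed
  ultimately have "(\<lambda>n. measure M (A n)) \<longlonglongrightarrow> 0" by simp
  then have "eventually (\<lambda>n. measure M (A n) < \<epsilon>) sequentially" using eps by (rule order_tendstoD(2))
  then show ?thesis unfolding A_def by (auto simp: eventually_sequentially)
qed

text \<open>Two bounded functions that agree up to \<open>\<delta>\<close> on a ball have nearly equal integrals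
  under laws with little mass outside the ball; the mass outside costs at most their uniform distance.\<close>

lemma (in prob_space) integral_diff_tail_le:
  fixes V :: "'a \<Rightarrow> real \<times> real" and g g' :: "real \<times> real \<Rightarrow> real"
  assumes [measurable]: "V \<in> borel_measurable M" "g \<in> borel_measurable borel" "g' \<in> borel_measurable borel"
    and gB: "\<And>z. \<bar>g z\<bar> \<le> B" and g'B: "\<And>z. \<bar>g' z\<bar> \<le> B'"
    and near: "\<And>z. norm z \<le> r \<Longrightarrow> \<bar>g z - g' z\<bar> \<le> \<delta>" and far: "\<And>z. \<bar>g z - g' z\<bar> \<le> D" and d: "0 \<le> \<delta>"
  shows "\<bar>(\<integral>x. g (V x) \<partial>M) - (\<integral>x. g' (V x) \<partial>M)\<bar> \<le> \<delta> + D * measure M {x \<in> space M. r < norm (V x)}"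
proof -
  let ?A = "{x \<in> space M. r < norm (V x)}"
  have [measurable]: "?A \<in> sets M" by measurable
  have i: "integrable M (\<lambda>x. g (V x))" by (rule integrable_const_bound[of _ B]) (use gB in auto)
  have i': "integrable M (\<lambda>x. g' (V x))" by (rule integrable_const_bound[of _ B']) (use g'B in auto)
  have D0: "0 \<le> D" using far[of undefined] by linarith
  have "\<bar>(\<integral>x. g (V x) \<partial>M) - (\<integral>x. g' (V x) \<partial>M)\<bar> = \<bar>\<integral>x. g (V x) - g' (V x) \<partial>M\<bar>" using i i' by simp
  also have "\<dots> \<le> (\<integral>x. \<bar>g (V x) - g' (V x)\<bar> \<partial>M)" by (rule integral_abs_bound)
  also have "\<dots> \<le> (\<integral>x. \<delta> + D * indicator ?A x \<partial>M)"
  proof (rule integral_mono)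
    show "integrable M (\<lambda>x. \<bar>g (V x) - g' (V x)\<bar>)" using i i' by auto
    show "integrable M (\<lambda>x. \<delta> + D * indicator ?A x)" by (simp add: emeasure_eq_measure)
    show "\<bar>g (V x) - g' (V x)\<bar> \<le> \<delta> + D * indicator ?A x" if "x \<in> space M" for x
      using near[of "V x"] far[of "V x"] that d D0 by (cases "norm (V x) \<le> r") (auto simp: indicator_def)
  qed
  also have "\<dots> = \<delta> + D * measure M ?A" by (simp add: prob_space emeasure_eq_measure)
  finally show ?thesis .
qed

text \<open>For a large radius \<open>R\<close> the map \<open>(x, y) \<mapsto> (sin (x / R), sin (y / R))\<close> is injective on a square that
  carries almost all the mass, so there a bounded continuous function is a continuous function of the two sines.
  By Stone and Weierstrass the latter is nearly a polynomial in the sines, which is a combination of plane waves.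
  The approximation is uniform on the whole plane, since the sines take values in the square \<open>[-1, 1]\<^sup>2\<close>; this is
  the reason for approximating on the range of the sines and not on the square in the plane. Rational frequencies
  suffice because \<open>R\<close> may be taken to be an integer.\<close>

lemma wave_weak_convergence:
  fixes V :: "nat \<Rightarrow> 'a \<Rightarrow> real \<times> real" and W :: "'b \<Rightarrow> real \<times> real" and g :: "real \<times> real \<Rightarrow> real"
  assumes P: "prob_space P" and Q: "prob_space Q"
    and V: "\<And>n. V n \<in> borel_measurable P" and W: "W \<in> borel_measurable Q"
    and conv: "\<And>a b. a \<in> \<rat> \<Longrightarrow> b \<in> \<rat> \<Longrightarrow> (\<lambda>n. \<integral>x. wave a b (V n x) \<partial>P) \<longlonglongrightarrow> (\<integral>q. wave a b (W q) \<partial>Q)"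
    and tight: "\<And>\<epsilon>. 0 < \<epsilon> \<Longrightarrow> \<exists>r. \<forall>n. measure P {x \<in> space P. r < norm (V n x)} < \<epsilon>"
    and g: "continuous_on UNIV g" "bounded (range g)"
  shows "(\<lambda>n. \<integral>x. g (V n x) \<partial>P) \<longlonglongrightarrow> (\<integral>q. g (W q) \<partial>Q)"
proof -
  interpret P: prob_space P by fact
  interpret Q: prob_space Q by fact
  note [measurable] = V W
  have gm [measurable]: "g \<in> borel_measurable borel" by (rule borel_measurable_continuous_onI[OF g(1)])
  obtain B where B: "0 < B" "\<And>z. \<bar>g z\<bar> \<le> B" using g(2) unfolding bounded_pos by auto
  \<comment> \<open>Convergence is required together with all rational waves, so that the class is closed under products with sines.\<close>
  define T where "T h \<longleftrightarrow> h \<in> borel_measurable borel \<and> (\<exists>b. \<forall>z. cmod (h z) \<le> b) \<and>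
    (\<forall>a\<in>\<rat>. \<forall>b\<in>\<rat>. (\<lambda>n. \<integral>x. h (V n x) * wave a b (V n x) \<partial>P) \<longlonglongrightarrow> (\<integral>q. h (W q) * wave a b (W q) \<partial>Q))"
    for h :: "real \<times> real \<Rightarrow> complex"
  have T_int: "integrable P (\<lambda>x. h (V n x) * wave a b (V n x))" "integrable Q (\<lambda>q. h (W q) * wave a b (W q))"
    if h: "T h" for h a b n
  proof -
    have [measurable]: "h \<in> borel_measurable borel" using h by (simp add: T_def)
    obtain c where c: "\<And>z. cmod (h z) \<le> c" using h by (auto simp: T_def)
    show "integrable P (\<lambda>x. h (V n x) * wave a b (V n x))"
      by (rule P.integrable_const_bound[of _ c]) (auto simp: norm_mult c)
    show "integrable Q (\<lambda>q. h (W q) * wave a b (W q))"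
      by (rule Q.integrable_const_bound[of _ c]) (auto simp: norm_mult c)
  qed
  have T_add: "T (\<lambda>z. h z + h' z)" if h: "T h" "T h'" for h h'
    unfolding T_def
  proof (intro conjI ballI)
    have [measurable]: "h \<in> borel_measurable borel" "h' \<in> borel_measurable borel" using h by (auto simp: T_def)
    show "(\<lambda>z. h z + h' z) \<in> borel_measurable borel" by measurable
    obtain c c' where "\<And>z. cmod (h z) \<le> c" "\<And>z. cmod (h' z) \<le> c'" using h by (auto simp: T_def)
    then show "\<exists>b. \<forall>z. cmod (h z + h' z) \<le> b"
      by (intro exI[of _ "c + c'"]) (meson norm_triangle_mono)
    fix a b :: real assume ab: "a \<in> \<rat>" "b \<in> \<rat>"
    have "(\<lambda>n. (\<integral>x. h (V n x) * wave a b (V n x) \<partial>P) + (\<integral>x. h' (V n x) * wave a b (V n x) \<partial>P)) \<longlonglongrightarrow>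
      (\<integral>q. h (W q) * wave a b (W q) \<partial>Q) + (\<integral>q. h' (W q) * wave a b (W q) \<partial>Q)"
      using h ab by (intro tendsto_add) (auto simp: T_def)
    then show "(\<lambda>n. \<integral>x. (h (V n x) + h' (V n x)) * wave a b (V n x) \<partial>P) \<longlonglongrightarrow>
       (\<integral>q. (h (W q) + h' (W q)) * wave a b (W q) \<partial>Q)"
      unfolding distrib_right Bochner_Integration.integral_add[OF T_int(1)[OF h(1)] T_int(1)[OF h(2)]]
        Bochner_Integration.integral_add[OF T_int(2)[OF h(1)] T_int(2)[OF h(2)]] .
  qed
  have T_cmult: "T (\<lambda>z. c * h z)" if h: "T h" for c h
    unfolding T_def
  proof (intro conjI ballI)
    have [measurable]: "h \<in> borel_measurable borel" using h by (auto simp: T_def)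
    show "(\<lambda>z. c * h z) \<in> borel_measurable borel" by measurable
    obtain k where "\<And>z. cmod (h z) \<le> k" using h by (auto simp: T_def)
    then show "\<exists>b. \<forall>z. cmod (c * h z) \<le> b"
      by (intro exI[of _ "cmod c * k"]) (simp add: norm_mult mult_left_mono)
    fix a b :: real assume ab: "a \<in> \<rat>" "b \<in> \<rat>"
    have "(\<lambda>n. c * (\<integral>x. h (V n x) * wave a b (V n x) \<partial>P)) \<longlonglongrightarrow> c * (\<integral>q. h (W q) * wave a b (W q) \<partial>Q)"
      using h ab by (intro tendsto_mult_left) (auto simp: T_def)
    then show "(\<lambda>n. \<integral>x. c * h (V n x) * wave a b (V n x) \<partial>P) \<longlonglongrightarrow> (\<integral>q. c * h (W q) * wave a b (W q) \<partial>Q)"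
      by (simp add: mult.assoc)
  qed
  have T_wave: "T (\<lambda>z. wave a' b' z * h z)" if h: "T h" and ab': "a' \<in> \<rat>" "b' \<in> \<rat>" for a' b' h
    unfolding T_def
  proof (intro conjI ballI)
    have [measurable]: "h \<in> borel_measurable borel" using h by (auto simp: T_def)
    show "(\<lambda>z. wave a' b' z * h z) \<in> borel_measurable borel" by measurable
    show "\<exists>b. \<forall>z. cmod (wave a' b' z * h z) \<le> b" using h by (simp add: T_def norm_mult)
    fix a b :: real assume ab: "a \<in> \<rat>" "b \<in> \<rat>"
    have e: "wave a' b' z * h z * wave a b z = h z * wave (a' + a) (b' + b) z" for z
      using wave_mult[of a' b' z a b] by (simp add: mult_ac)
    show "(\<lambda>n. \<integral>x. wave a' b' (V n x) * h (V n x) * wave a b (V n x) \<partial>P) \<longlonglongrightarrow>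
       (\<integral>q. wave a' b' (W q) * h (W q) * wave a b (W q) \<partial>Q)"
      unfolding e using h ab ab' by (simp add: T_def)
  qed
  have T_one: "T (\<lambda>_. 1)" using conv by (auto simp: T_def intro: exI[of _ 1])
  have T_sin: "T (\<lambda>z. complex_of_real (sin (r * fst z)) * h z)" "T (\<lambda>z. complex_of_real (sin (r * snd z)) * h z)"
    if h: "T h" and r: "r \<in> \<rat>" for h r
  proof -
    have "T (\<lambda>z. 1 / (2 * \<i>) * (wave r 0 z * h z) + - (1 / (2 * \<i>)) * (wave (- r) 0 z * h z))"
      by (intro T_add T_cmult T_wave h) (use r in auto)
    then show "T (\<lambda>z. complex_of_real (sin (r * fst z)) * h z)"
      unfolding sin_fst_wave by (rule back_subst[of T]) (simp add: fun_eq_iff field_simps)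
    have "T (\<lambda>z. 1 / (2 * \<i>) * (wave 0 r z * h z) + - (1 / (2 * \<i>)) * (wave 0 (- r) z * h z))"
      by (intro T_add T_cmult T_wave h) (use r in auto)
    then show "T (\<lambda>z. complex_of_real (sin (r * snd z)) * h z)"
      unfolding sin_snd_wave by (rule back_subst[of T]) (simp add: fun_eq_iff field_simps)
  qed
  have T_poly: "T (\<lambda>z. complex_of_real (p (sin (r * fst z), sin (r * snd z))) * h z)"
    if "real_polynomial_function p" "T h" "r \<in> \<rat>" for p r h
    using that
  proof (induction p arbitrary: h rule: real_polynomial_function.induct)
    case (linear f)
    interpret f: bounded_linear f by fact
    have fz: "f (u, v) = f (1, 0) * u + f (0, 1) * v" for u v
    proof -
      have "(u, v) = u *\<^sub>R (1, 0) + v *\<^sub>R (0, 1)" by simp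
      then have "f (u, v) = f (u *\<^sub>R (1, 0) + v *\<^sub>R (0, 1))" by (rule arg_cong)
      then show ?thesis unfolding f.add f.scaleR by simp
    qed
    have "T (\<lambda>z. complex_of_real (f (1, 0)) * (complex_of_real (sin (r * fst z)) * h z) +
         complex_of_real (f (0, 1)) * (complex_of_real (sin (r * snd z)) * h z))"
      using linear.prems by (intro T_add T_cmult T_sin)
    then show ?case unfolding fz[of "sin _"] by (rule back_subst[of T]) (simp add: fun_eq_iff algebra_simps)
  next
    case (const c)
    then show ?case by (intro T_cmult)
  next
    case (add f f')
    have "T (\<lambda>z. complex_of_real (f (sin (r * fst z), sin (r * snd z))) * h z +
        complex_of_real (f' (sin (r * fst z), sin (r * snd z))) * h z)"
      using add by (intro T_add) auto
    then show ?case by (simp add: distrib_right)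
  next
    case (mult f f')
    have "T (\<lambda>z. complex_of_real (f (sin (r * fst z), sin (r * snd z))) *
        (complex_of_real (f' (sin (r * fst z), sin (r * snd z))) * h z))"
      using mult by auto
    then show ?case by (simp add: mult.assoc)
  qed
  show ?thesis
  proof (rule LIMSEQ_I)
    fix \<epsilon> :: real assume eps: "0 < \<epsilon>"
    \<comment> \<open>A tail of mass \<open>\<eta>\<close> changes the integrals by at most \<open>\<epsilon> / 4\<close>; see \<open>bd\<close>.\<close>
    define \<eta> where "\<eta> = \<epsilon> / (16 * (B + 1))"
    have eta: "0 < \<eta>" using eps B by (simp add: \<eta>_def)
    obtain r1 where r1: "\<And>n. measure P {x \<in> space P. r1 < norm (V n x)} < \<eta>" using tight[OF eta] by blast
    obtain r2 where r2: "measure Q {x \<in> space Q. r2 < norm (W x)} < \<eta>" using Q.tight_single[OF W eta] by blast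
    obtain R0 :: nat where R0: "max r1 r2 \<le> real R0" using real_arch_simple by blast
    define R where "R = real (Suc R0)"
    have R: "0 < R" "r1 \<le> R" "r2 \<le> R" "1 / R \<in> \<rat>" using R0 by (auto simp: R_def)
    define G where "G w = g (R * arcsin (fst w), R * arcsin (snd w))" for w :: "real \<times> real"
    let ?K = "{-1..1} \<times> {-1..1} :: (real \<times> real) set"
    have "continuous_on ?K G"
      unfolding G_def
      by (rule continuous_on_compose2[OF g(1)]) (intro continuous_intros, auto)
    moreover have "compact ?K" by (intro compact_Times compact_Icc)
    moreover have "0 < \<epsilon> / 16" using eps by simp
    ultimately obtain p where p: "real_polynomial_function p" "\<And>w. w \<in> ?K \<Longrightarrow> \<bar>G w - p w\<bar> < \<epsilon> / 16"
      using Stone_Weierstrass_real_polynomial_function[of ?K G "\<epsilon> / 16"] by metis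
    define \<Phi> where "\<Phi> z = (sin (1 / R * fst z), sin (1 / R * snd z))" for z :: "real \<times> real"
    have PhiK: "\<Phi> z \<in> ?K" for z by (simp add: \<Phi>_def)
    define h where "h z = p (\<Phi> z)" for z
    have "continuous_on UNIV p"
      using p(1) by (intro continuous_on_polymonial_function) (simp add: real_polynomial_function_eq)
    then have hc: "continuous_on UNIV h"
      unfolding h_def \<Phi>_def by (rule continuous_on_compose2) (intro continuous_intros, auto)
    have hm: "h \<in> borel_measurable borel" by (rule borel_measurable_continuous_onI[OF hc])
    have GB: "\<bar>G w\<bar> \<le> B" for w by (simp add: G_def B)
    have hB: "\<bar>h z\<bar> \<le> B + \<epsilon> / 16" for z using p(2)[OF PhiK, of z] GB[of "\<Phi> z"] unfolding h_def by linarith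
    have near: "\<bar>g z - h z\<bar> \<le> \<epsilon> / 16" if z: "norm z \<le> R" for z
    proof -
      have "\<bar>1 / R * fst z\<bar> \<le> 1" "\<bar>1 / R * snd z\<bar> \<le> 1"
        using abs_fst_le_norm[of z] abs_snd_le_norm[of z] z R by (simp_all add: abs_mult field_simps)
      \<comment> \<open>On the ball of radius \<open>R\<close> the arguments of the sines stay in \<open>[-1, 1]\<close>, where \<open>arcsin\<close> inverts \<open>sin\<close>.\<close>
      then have "- (pi / 2) \<le> 1 / R * fst z \<and> 1 / R * fst z \<le> pi / 2" "- (pi / 2) \<le> 1 / R * snd z \<and> 1 / R * snd z \<le> pi / 2"
        using pi_gt3 by linarith+
      then have "arcsin (sin (1 / R * fst z)) = 1 / R * fst z" "arcsin (sin (1 / R * snd z)) = 1 / R * snd z"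
        by (auto intro: arcsin_sin)
      then have "G (\<Phi> z) = g z" using R by (simp add: G_def \<Phi>_def)
      then show ?thesis using p(2)[OF PhiK, of z] by (simp add: h_def)
    qed
    have far: "\<bar>g z - h z\<bar> \<le> 2 * B + \<epsilon> / 16" for z using B(2)[of z] hB[of z] by linarith
    have bd: "\<epsilon> / 16 + (2 * B + \<epsilon> / 16) * m \<le> \<epsilon> / 4" if m: "m < \<eta>" "0 \<le> m" "m \<le> 1" for m
    proof -
      have "(2 * B) * m \<le> 2 * (B + 1) * \<eta>" using B m by (intro mult_mono) auto
      also have "\<dots> = \<epsilon> / 8" using B by (simp add: \<eta>_def field_simps)
      finally have "2 * B * m \<le> \<epsilon> / 8" .
      moreover have "\<epsilon> / 16 * m \<le> \<epsilon> / 16 * 1" using eps m by (intro mult_left_mono) auto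
      ultimately show ?thesis by (simp add: distrib_right)
    qed
    have e0: "0 \<le> \<epsilon> / 16" using eps by simp
    have near1: "\<bar>g z - h z\<bar> \<le> \<epsilon> / 16" if "norm z \<le> r1" for z using near[of z] that R by simp
    have near2: "\<bar>g z - h z\<bar> \<le> \<epsilon> / 16" if "norm z \<le> r2" for z using near[of z] that R by simp
    have c1: "\<bar>(\<integral>x. g (V n x) \<partial>P) - (\<integral>x. h (V n x) \<partial>P)\<bar> \<le> \<epsilon> / 4" for n
    proof -
      have "\<bar>(\<integral>x. g (V n x) \<partial>P) - (\<integral>x. h (V n x) \<partial>P)\<bar> \<le> \<epsilon> / 16 + (2 * B + \<epsilon> / 16) * measure P {x \<in> space P. r1 < norm (V n x)}"
        by (rule P.integral_diff_tail_le[OF V gm hm B(2) hB _ far e0]) (erule near1)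
      also have "\<dots> \<le> \<epsilon> / 4" by (rule bd[OF r1[of n] measure_nonneg P.prob_le_1])
      finally show ?thesis .
    qed
    have c2: "\<bar>(\<integral>x. g (W x) \<partial>Q) - (\<integral>x. h (W x) \<partial>Q)\<bar> \<le> \<epsilon> / 4"
    proof -
      have "\<bar>(\<integral>x. g (W x) \<partial>Q) - (\<integral>x. h (W x) \<partial>Q)\<bar> \<le> \<epsilon> / 16 + (2 * B + \<epsilon> / 16) * measure Q {x \<in> space Q. r2 < norm (W x)}"
        by (rule Q.integral_diff_tail_le[OF W gm hm B(2) hB _ far e0]) (erule near2)
      also have "\<dots> \<le> \<epsilon> / 4" by (rule bd[OF r2 measure_nonneg Q.prob_le_1])
      finally show ?thesis .
    qed
    have "T (\<lambda>z. complex_of_real (p (sin (1 / R * fst z), sin (1 / R * snd z))) * 1)"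
      by (rule T_poly[OF p(1) T_one R(4)])
    then have "(\<lambda>n. \<integral>x. complex_of_real (h (V n x)) * wave 0 0 (V n x) \<partial>P) \<longlonglongrightarrow> (\<integral>q. complex_of_real (h (W q)) * wave 0 0 (W q) \<partial>Q)"
      unfolding T_def h_def \<Phi>_def by simp
    then have "(\<lambda>n. complex_of_real (\<integral>x. h (V n x) \<partial>P)) \<longlonglongrightarrow> complex_of_real (\<integral>q. h (W q) \<partial>Q)"
      by (simp add: wave_def)
    then have "(\<lambda>n. \<integral>x. h (V n x) \<partial>P) \<longlonglongrightarrow> (\<integral>q. h (W q) \<partial>Q)" by (simp only: tendsto_of_real_iff)
    then obtain N where N: "\<And>n. N \<le> n \<Longrightarrow> norm ((\<integral>x. h (V n x) \<partial>P) - (\<integral>q. h (W q) \<partial>Q)) < \<epsilon> / 4"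
      using LIMSEQ_D[of _ _ "\<epsilon> / 4"] eps by (metis zero_less_divide_iff zero_less_numeral)
    have "norm ((\<integral>x. g (V n x) \<partial>P) - (\<integral>q. g (W q) \<partial>Q)) < \<epsilon>" if "N \<le> n" for n
      using N[OF that] c1[of n] c2 eps unfolding real_norm_def by linarith
    then show "\<exists>no. \<forall>n\<ge>no. norm ((\<integral>x. g (V n x) \<partial>P) - (\<integral>q. g (W q) \<partial>Q)) < \<epsilon>" by blast
  qed
qed

lemma char_normal_law:
  assumes v: "0 \<le> v"
  shows "char (normal_law 0 v) t = complex_of_real (exp (- v * t\<^sup>2 / 2))"
proof (cases "v = 0")
  case True
  have "char (normal_law 0 v) t = (\<integral>x. exp (\<i> * complex_of_real (t * x)) \<partial>return borel 0)"
    using True by (simp add: char_def normal_law_def)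
  also have "\<dots> = exp (\<i> * complex_of_real (t * 0))" by (rule integral_return) auto
  finally show ?thesis using True by simp
next
  case False
  let ?s = "sqrt v"
  have s: "0 < ?s" using v False by simp
  interpret S: prob_space std_normal_distribution by (rule prob_space_normal_density) simp
  have "distributed std_normal_distribution lborel (\<lambda>x. x) (normal_density 0 1)"
    unfolding distributed_def by (auto simp: distr_id2 normal_density_nonneg)
  from S.normal_density_affine[OF this, of ?s 0]
  have "distributed std_normal_distribution lborel (\<lambda>x. ?s * x) (normal_density 0 ?s)" using s by simp
  then have "distr std_normal_distribution lborel (\<lambda>x. ?s * x) = normal_law 0 v"
    using False by (simp add: distributed_def normal_law_def)
  then have d: "normal_law 0 v = distr std_normal_distribution borel (\<lambda>x. ?s * x)"
    by (metis distr_cong sets_lborel)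
  have "char (normal_law 0 v) t = (\<integral>x. exp (\<i> * complex_of_real (t * (?s * x))) \<partial>std_normal_distribution)"
    unfolding d char_def by (subst integral_distr) auto
  also have "\<dots> = char std_normal_distribution (t * ?s)" by (simp add: char_def mult.assoc)
  also have "\<dots> = complex_of_real (exp (- v * t\<^sup>2 / 2))"
    using v by (simp add: char_std_normal_distribution power_mult_distrib mult.commute)
  finally show ?thesis .
qed

lemma iid_normal_pair_wave:
  assumes N: "iid_normal_pair Q N\<^sub>1 N\<^sub>2 0 v" and v: "0 \<le> v"
  shows "(\<integral>q. wave a b (N\<^sub>1 q, N\<^sub>2 q) \<partial>Q) = complex_of_real (exp (- v * (a\<^sup>2 + b\<^sup>2) / 2))"
proof -
  interpret Q: prob_space Q using N by (simp add: iid_normal_pair_def)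
  have ind: "Q.indep_var borel N\<^sub>1 borel N\<^sub>2" and d1: "distr Q borel N\<^sub>1 = normal_law 0 v" and d2: "distr Q borel N\<^sub>2 = normal_law 0 v"
    using N by (auto simp: iid_normal_pair_def)
  have [measurable]: "N\<^sub>1 \<in> borel_measurable Q" "N\<^sub>2 \<in> borel_measurable Q"
    using Q.indep_var_rv1[OF ind] Q.indep_var_rv2[OF ind] by auto
  have ind': "Q.indep_var borel (\<lambda>q. a * N\<^sub>1 q) borel (\<lambda>q. b * N\<^sub>2 q)"
    using Q.indep_var_compose[OF ind, of "\<lambda>x. a * x" borel "\<lambda>x. b * x" borel] by (simp add: comp_def)
  have c: "char (distr Q borel (\<lambda>q. k * N q)) 1 = char (distr Q borel N) k" if [measurable]: "N \<in> borel_measurable Q" for N k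
    by (simp add: char_def integral_distr)
  have "(\<integral>q. wave a b (N\<^sub>1 q, N\<^sub>2 q) \<partial>Q) = char (distr Q borel (\<lambda>q. a * N\<^sub>1 q + b * N\<^sub>2 q)) 1"
    by (simp add: char_def integral_distr wave_def)
  also have "\<dots> = char (normal_law 0 v) a * char (normal_law 0 v) b"
    by (simp add: Q.char_distr_add[OF ind'] c d1 d2)
  also have "\<dots> = complex_of_real (exp (- v * a\<^sup>2 / 2) * exp (- v * b\<^sup>2 / 2))" by (simp add: char_normal_law[OF v])
  also have "exp (- v * a\<^sup>2 / 2) * exp (- v * b\<^sup>2 / 2) = exp (- v * (a\<^sup>2 + b\<^sup>2) / 2)"
    by (simp add: algebra_simps add_divide_distrib flip: exp_add)
  finally show ?thesis .
qed

section \<open>Regular conditional laws and conditional expectations\<close>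

text \<open>The assumption \<open>F_increasing\<close> turns the preimages of \<open>F\<close> under the iterates of \<open>T\<close> into an increasing
  filtration, and \<open>\<kappa>\<close> gives the laws conditional on its initial \<open>\<sigma>\<close>-algebra.\<close>

locale kernel_system = prob_space M for M :: "'a measure" +
  fixes F :: "'a measure" and T :: "'a \<Rightarrow> 'a" and \<kappa> :: "'a \<Rightarrow> 'a measure"
  assumes subalg: "subalgebra M F"
    and T_measurable [measurable]: "T \<in> measurable M M"
    and T_preserves: "distr M M T = M"
    and F_increasing: "sets F \<subseteq> (\<lambda>B. T -` B \<inter> space M) ` sets F"
    and rcp: "regular_cond_prob M F \<kappa>"
begin

lemma sigma_finite_F: "sigma_finite_subalgebra M F"
  by (rule finite_measure_subalgebra_is_sigma_finite)
     (simp add: finite_measure_subalgebra_def finite_measure_subalgebra_axioms_def subalg finite_measure_axioms)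

lemma space_F [simp]: "space F = space M"
  using subalg by (simp add: subalgebra_def)

lemma sets_F: "A \<in> sets F \<Longrightarrow> A \<in> sets M"
  using subalg by (auto simp: subalgebra_def)

lemma F_measurable: "f \<in> measurable F N \<Longrightarrow> f \<in> measurable M N"
  by (rule measurable_from_subalg[OF subalg])

lemma kernel_prob: "\<omega> \<in> space M \<Longrightarrow> prob_space (\<kappa> \<omega>)"
  and kernel_sets: "\<omega> \<in> space M \<Longrightarrow> sets (\<kappa> \<omega>) = sets M"
  using rcp by (auto simp: regular_cond_prob_def)

lemma kernel_space: "\<omega> \<in> space M \<Longrightarrow> space (\<kappa> \<omega>) = space M"
  using kernel_sets by (rule sets_eq_imp_space_eq)

lemma kernel_meas: "\<omega> \<in> space M \<Longrightarrow> f \<in> measurable M N \<Longrightarrow> f \<in> measurable (\<kappa> \<omega>) N"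
  using measurable_cong_sets[OF kernel_sets refl] by blast

lemma kernel_measurable: "\<kappa> \<in> F \<rightarrow>\<^sub>M subprob_algebra M"
proof (rule measurable_subprob_algebra)
  fix \<omega> assume w: "\<omega> \<in> space F"
  then show "subprob_space (\<kappa> \<omega>)" by (auto intro: prob_space_imp_subprob_space kernel_prob)
  show "sets (\<kappa> \<omega>) = sets M" using w by (simp add: kernel_sets)
next
  fix A assume A: "A \<in> sets M"
  have "(\<lambda>\<omega>. ennreal (measure (\<kappa> \<omega>) A)) \<in> borel_measurable F"
    using rcp A by (auto simp: regular_cond_prob_def)
  then show "(\<lambda>\<omega>. emeasure (\<kappa> \<omega>) A) \<in> borel_measurable F"
    by (rule measurable_cong[THEN iffD1, rotated])
       (metis kernel_prob space_F finite_measure.emeasure_eq_measure prob_space.finite_measure)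
qed

lemma nn_kernel_measurable:
  "f \<in> borel_measurable M \<Longrightarrow> (\<lambda>\<omega>. \<integral>\<^sup>+x. f x \<partial>\<kappa> \<omega>) \<in> borel_measurable F"
  by (rule measurable_compose[OF kernel_measurable nn_integral_measurable_subprob_algebra])

lemma nn_kernel_measurable_M:
  "f \<in> borel_measurable M \<Longrightarrow> (\<lambda>\<omega>. \<integral>\<^sup>+x. f x \<partial>\<kappa> \<omega>) \<in> borel_measurable M"
  by (rule F_measurable[OF nn_kernel_measurable])

text \<open>For indicator functions this is the defining property of a regular conditional probability.\<close>

lemma nn_kernel_set:
  assumes "A \<in> sets F" and f: "f \<in> borel_measurable M"
  shows "(\<integral>\<^sup>+\<omega>. indicator A \<omega> * (\<integral>\<^sup>+x. f x \<partial>\<kappa> \<omega>) \<partial>M) = (\<integral>\<^sup>+\<omega>. indicator A \<omega> * f \<omega> \<partial>M)"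
  using f
proof (induction f rule: borel_measurable_induct)
  have [measurable]: "A \<in> sets M" using assms(1) by (rule sets_F)
  interpret S: sigma_finite_subalgebra M F by (rule sigma_finite_F)
  case (cong f g)
  have "(\<integral>\<^sup>+x. f x \<partial>\<kappa> \<omega>) = (\<integral>\<^sup>+x. g x \<partial>\<kappa> \<omega>)" if "\<omega> \<in> space M" for \<omega>
    using cong(3) kernel_space[OF that] by (intro nn_integral_cong) auto
  then have "(\<integral>\<^sup>+\<omega>. indicator A \<omega> * (\<integral>\<^sup>+x. g x \<partial>\<kappa> \<omega>) \<partial>M) = (\<integral>\<^sup>+\<omega>. indicator A \<omega> * (\<integral>\<^sup>+x. f x \<partial>\<kappa> \<omega>) \<partial>M)"
    by (intro nn_integral_cong) auto
  moreover have "(\<integral>\<^sup>+\<omega>. indicator A \<omega> * f \<omega> \<partial>M) = (\<integral>\<^sup>+\<omega>. indicator A \<omega> * g \<omega> \<partial>M)"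
    using cong(3) by (intro nn_integral_cong) auto
  ultimately show ?case using cong.IH by simp
next
  have [measurable]: "A \<in> sets M" using assms(1) by (rule sets_F)
  interpret S: sigma_finite_subalgebra M F by (rule sigma_finite_F)
  case (set B)
  note [measurable] = set
  have m: "(\<lambda>\<omega>. measure (\<kappa> \<omega>) B) \<in> borel_measurable M"
    and ae: "AE \<omega> in M. measure (\<kappa> \<omega>) B = real_cond_exp M F (indicator B) \<omega>"
    using rcp set by (auto simp: regular_cond_prob_def intro: F_measurable)
  note [measurable] = m
  have le1: "measure (\<kappa> \<omega>) B \<le> 1" if "\<omega> \<in> space M" for \<omega>
    using kernel_prob[OF that] by (rule prob_space.prob_le_1)
  have int: "integrable M (\<lambda>\<omega>. indicator A \<omega> * measure (\<kappa> \<omega>) B)"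
    by (rule integrable_const_bound[of _ 1]) (use le1 in \<open>auto simp: indicator_def\<close>)
  have "(\<integral>\<^sup>+\<omega>. indicator A \<omega> * (\<integral>\<^sup>+x. indicator B x \<partial>\<kappa> \<omega>) \<partial>M) =
      (\<integral>\<^sup>+\<omega>. ennreal (indicator A \<omega> * measure (\<kappa> \<omega>) B) \<partial>M)"
  proof (rule nn_integral_cong)
    fix \<omega> assume w: "\<omega> \<in> space M"
    interpret K: prob_space "\<kappa> \<omega>" by (rule kernel_prob[OF w])
    show "indicator A \<omega> * (\<integral>\<^sup>+x. indicator B x \<partial>\<kappa> \<omega>) = ennreal (indicator A \<omega> * measure (\<kappa> \<omega>) B)"
      using set kernel_sets[OF w] nn_integral_indicator[of B "\<kappa> \<omega>"]
      by (cases "\<omega> \<in> A") (auto simp: K.emeasure_eq_measure)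
  qed
  also have "\<dots> = ennreal (\<integral>\<omega>. indicator A \<omega> * measure (\<kappa> \<omega>) B \<partial>M)"
    by (rule nn_integral_eq_integral[OF int]) auto
  also have "(\<integral>\<omega>. indicator A \<omega> * measure (\<kappa> \<omega>) B \<partial>M) = (\<integral>\<omega>\<in>A. real_cond_exp M F (indicator B) \<omega> \<partial>M)"
    unfolding set_lebesgue_integral_def
    by (rule integral_cong_AE) (use ae in auto)
  also have "\<dots> = (\<integral>\<omega>\<in>A. indicator B \<omega> \<partial>M)"
    by (rule S.real_cond_exp_intA[symmetric]) (use assms in \<open>auto simp: emeasure_eq_measure\<close>)
  also have "\<dots> = measure M (A \<inter> B)"
    by (simp add: set_lebesgue_integral_def indicator_inter_arith[symmetric])
  also have "ennreal (measure M (A \<inter> B)) = (\<integral>\<^sup>+\<omega>. indicator A \<omega> * indicator B \<omega> \<partial>M)"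
    by (simp add: indicator_inter_arith[symmetric] emeasure_eq_measure)
  finally show ?case .
next
  have [measurable]: "A \<in> sets M" using assms(1) by (rule sets_F)
  case (mult u c)
  note [measurable] = mult.hyps nn_kernel_measurable[OF mult.hyps(2), THEN F_measurable]
  have "(\<integral>\<^sup>+\<omega>. indicator A \<omega> * (\<integral>\<^sup>+x. c * u x \<partial>\<kappa> \<omega>) \<partial>M) =
      (\<integral>\<^sup>+\<omega>. c * (indicator A \<omega> * (\<integral>\<^sup>+x. u x \<partial>\<kappa> \<omega>)) \<partial>M)"
    using kernel_meas[OF _ mult.hyps(2)]
    by (intro nn_integral_cong) (auto simp: nn_integral_cmult mult_ac)
  also have "\<dots> = c * (\<integral>\<^sup>+\<omega>. indicator A \<omega> * (\<integral>\<^sup>+x. u x \<partial>\<kappa> \<omega>) \<partial>M)" by (simp add: nn_integral_cmult)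
  also have "\<dots> = (\<integral>\<^sup>+\<omega>. c * (indicator A \<omega> * u \<omega>) \<partial>M)" by (simp add: mult nn_integral_cmult)
  finally show ?case by (simp add: mult_ac)
next
  have [measurable]: "A \<in> sets M" using assms(1) by (rule sets_F)
  case (add u v)
  note [measurable] = add.hyps nn_kernel_measurable[OF add.hyps(1), THEN F_measurable]
    nn_kernel_measurable[OF add.hyps(3), THEN F_measurable]
  have "(\<integral>\<^sup>+\<omega>. indicator A \<omega> * (\<integral>\<^sup>+x. v x + u x \<partial>\<kappa> \<omega>) \<partial>M) =
      (\<integral>\<^sup>+\<omega>. indicator A \<omega> * (\<integral>\<^sup>+x. v x \<partial>\<kappa> \<omega>) + indicator A \<omega> * (\<integral>\<^sup>+x. u x \<partial>\<kappa> \<omega>) \<partial>M)"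
    using kernel_meas[OF _ add.hyps(1)] kernel_meas[OF _ add.hyps(3)]
    by (intro nn_integral_cong) (auto simp: nn_integral_add distrib_left)
  then show ?case by (simp add: nn_integral_add add distrib_left)
next
  have [measurable]: "A \<in> sets M" using assms(1) by (rule sets_F)
  case (seq U)
  note [measurable] = seq.hyps(1) nn_kernel_measurable[OF seq.hyps(1), THEN F_measurable]
  have 1: "(\<integral>\<^sup>+x. (SUP i. U i) x \<partial>\<kappa> \<omega>) = (SUP i. \<integral>\<^sup>+x. U i x \<partial>\<kappa> \<omega>)" if "\<omega> \<in> space M" for \<omega>
    using nn_integral_monotone_convergence_SUP[OF seq.hyps(3), of "\<kappa> \<omega>"] kernel_meas[OF that seq.hyps(1)]
    by (simp add: image_comp)
  have inc: "incseq (\<lambda>i \<omega>. indicator A \<omega> * (\<integral>\<^sup>+x. U i x \<partial>\<kappa> \<omega>))"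
    using seq.hyps(3) by (auto simp: incseq_def le_fun_def intro!: mult_left_mono nn_integral_mono)
  have inc2: "incseq (\<lambda>i \<omega>. indicator A \<omega> * U i \<omega>)"
    using seq.hyps(3) by (auto simp: incseq_def le_fun_def intro!: mult_left_mono)
  have "(\<integral>\<^sup>+\<omega>. indicator A \<omega> * (\<integral>\<^sup>+x. (SUP i. U i) x \<partial>\<kappa> \<omega>) \<partial>M) =
     (\<integral>\<^sup>+\<omega>. (SUP i. indicator A \<omega> * (\<integral>\<^sup>+x. U i x \<partial>\<kappa> \<omega>)) \<partial>M)"
    using 1 by (intro nn_integral_cong) (auto simp: SUP_mult_left_ennreal)
  also have "\<dots> = (SUP i. (\<integral>\<^sup>+\<omega>. indicator A \<omega> * (\<integral>\<^sup>+x. U i x \<partial>\<kappa> \<omega>) \<partial>M))"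
    by (rule nn_integral_monotone_convergence_SUP[OF inc]) measurable
  also have "\<dots> = (SUP i. (\<integral>\<^sup>+\<omega>. indicator A \<omega> * U i \<omega> \<partial>M))" by (simp add: seq.IH)
  also have "\<dots> = (\<integral>\<^sup>+\<omega>. (SUP i. indicator A \<omega> * U i \<omega>) \<partial>M)"
    by (rule nn_integral_monotone_convergence_SUP[OF inc2, symmetric]) measurable
  finally show ?case by (simp add: SUP_mult_left_ennreal image_comp)
qed

lemma nn_kernel_eq:
  assumes "f \<in> borel_measurable M"
  shows "AE \<omega> in M. (\<integral>\<^sup>+x. f x \<partial>\<kappa> \<omega>) = nn_cond_exp M F f \<omega>"
proof -
  interpret S: sigma_finite_subalgebra M F by (rule sigma_finite_F)
  show ?thesis
    by (rule S.nn_cond_exp_charact)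
       (use nn_kernel_set[OF _ assms] assms nn_kernel_measurable[OF assms] in \<open>auto simp: mult.commute\<close>)
qed

lemma nn_integral_kernel:
  assumes "f \<in> borel_measurable M"
  shows "(\<integral>\<^sup>+\<omega>. (\<integral>\<^sup>+x. f x \<partial>\<kappa> \<omega>) \<partial>M) = (\<integral>\<^sup>+\<omega>. f \<omega> \<partial>M)"
proof -
  have "(\<integral>\<^sup>+\<omega>. f \<omega> \<partial>M) = (\<integral>\<^sup>+\<omega>. indicator (space F) \<omega> * f \<omega> \<partial>M)"
    by (intro nn_integral_cong) auto
  also have "\<dots> = (\<integral>\<^sup>+\<omega>. indicator (space F) \<omega> * (\<integral>\<^sup>+x. f x \<partial>\<kappa> \<omega>) \<partial>M)"
    using nn_kernel_set[OF sets.top assms] by simp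
  also have "\<dots> = (\<integral>\<^sup>+\<omega>. (\<integral>\<^sup>+x. f x \<partial>\<kappa> \<omega>) \<partial>M)"
    by (intro nn_integral_cong) auto
  finally show ?thesis by simp
qed

lemma kernel_integrable:
  fixes f :: "'a \<Rightarrow> 'b::{banach, second_countable_topology}"
  assumes "integrable M f"
  shows "AE \<omega> in M. integrable (\<kappa> \<omega>) f"
proof -
  have [measurable]: "f \<in> borel_measurable M" using assms by auto
  have "(\<integral>\<^sup>+\<omega>. (\<integral>\<^sup>+x. norm (f x) \<partial>\<kappa> \<omega>) \<partial>M) < \<infinity>"
    using assms by (subst nn_integral_kernel) (auto simp: integrable_iff_bounded)
  then have "AE \<omega> in M. (\<integral>\<^sup>+x. norm (f x) \<partial>\<kappa> \<omega>) \<noteq> \<infinity>"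
    by (intro nn_integral_PInf_AE) (auto intro!: nn_kernel_measurable_M)
  then show ?thesis
    by (rule AE_mp) (auto intro!: AE_I2 integrableI_bounded kernel_meas simp: less_top)
qed

text \<open>The version of the conditional expectation given by the kernel. It is an integral for every single
  \<open>\<omega>\<close>, so norms and limit theorems under the conditional law apply to it.\<close>

definition cexp :: "('a \<Rightarrow> 'b::{banach, second_countable_topology}) \<Rightarrow> 'a \<Rightarrow> 'b" where
  "cexp f \<omega> = (\<integral>x. f x \<partial>\<kappa> \<omega>)"

lemma cexp_measurable_F [measurable]: "f \<in> borel_measurable M \<Longrightarrow> cexp f \<in> borel_measurable F"
  using measurable_compose[OF kernel_measurable integral_measurable_subprob_algebra]
  by (simp add: cexp_def[abs_def])

lemma cexp_measurable [measurable]: "f \<in> borel_measurable M \<Longrightarrow> cexp f \<in> borel_measurable M"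
  by (rule F_measurable[OF cexp_measurable_F])

lemma cexp_eq_real_cond_exp:
  fixes f :: "'a \<Rightarrow> real"
  assumes "integrable M f"
  shows "AE \<omega> in M. cexp f \<omega> = real_cond_exp M F f \<omega>"
proof -
  have [measurable]: "f \<in> borel_measurable M" using assms by auto
  have "AE \<omega> in M. (\<integral>\<^sup>+x. ennreal (f x) \<partial>\<kappa> \<omega>) = nn_cond_exp M F (\<lambda>x. ennreal (f x)) \<omega>"
       "AE \<omega> in M. (\<integral>\<^sup>+x. ennreal (- f x) \<partial>\<kappa> \<omega>) = nn_cond_exp M F (\<lambda>x. ennreal (- f x)) \<omega>"
    by (rule nn_kernel_eq; measurable)+
  then show ?thesis using kernel_integrable[OF assms]
    by eventually_elim (simp add: cexp_def real_lebesgue_integral_def real_cond_exp_def)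
qed

lemma cexp_integral:
  fixes f :: "'a \<Rightarrow> real"
  assumes "integrable M f"
  shows "integrable M (cexp f)" "(\<integral>\<omega>. cexp f \<omega> \<partial>M) = (\<integral>\<omega>. f \<omega> \<partial>M)"
proof -
  interpret S: sigma_finite_subalgebra M F by (rule sigma_finite_F)
  have [measurable]: "f \<in> borel_measurable M" using assms by auto
  note 1 = cexp_eq_real_cond_exp[OF assms]
  show "integrable M (cexp f)"
    by (rule integrable_cong_AE_imp[OF S.real_cond_exp_int(1)[OF assms]]) (use 1 in auto)
  show "(\<integral>\<omega>. cexp f \<omega> \<partial>M) = (\<integral>\<omega>. f \<omega> \<partial>M)"
    using S.real_cond_exp_int(2)[OF assms] integral_cong_AE[of "cexp f" M "real_cond_exp M F f"] 1
    by (auto intro: measurable_from_subalg[OF subalg])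
qed

lemma cexp_cong_AE:
  fixes f g :: "'a \<Rightarrow> 'b::{banach, second_countable_topology}"
  assumes [measurable]: "f \<in> borel_measurable M" "g \<in> borel_measurable M" and "AE x in M. f x = g x"
  shows "AE \<omega> in M. cexp f \<omega> = cexp g \<omega>"
proof -
  have "(\<integral>\<^sup>+\<omega>. (\<integral>\<^sup>+x. norm (f x - g x) \<partial>\<kappa> \<omega>) \<partial>M) = (\<integral>\<^sup>+x. norm (f x - g x) \<partial>M)"
    by (rule nn_integral_kernel) measurable
  also have "\<dots> = 0" by (subst nn_integral_0_iff_AE) (use assms(3) in auto)
  finally have "AE \<omega> in M. (\<integral>\<^sup>+x. norm (f x - g x) \<partial>\<kappa> \<omega>) = 0"
    by (subst (asm) nn_integral_0_iff_AE) (auto intro!: nn_kernel_measurable_M)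
  then show ?thesis
  proof (rule AE_mp, intro AE_I2 impI)
    fix \<omega> assume w: "\<omega> \<in> space M" and *: "(\<integral>\<^sup>+x. norm (f x - g x) \<partial>\<kappa> \<omega>) = 0"
    have [measurable]: "f \<in> borel_measurable (\<kappa> \<omega>)" "g \<in> borel_measurable (\<kappa> \<omega>)"
      by (auto intro: kernel_meas[OF w])
    have "AE x in \<kappa> \<omega>. f x = g x" using * by (subst (asm) nn_integral_0_iff_AE) auto
    then show "cexp f \<omega> = cexp g \<omega>" unfolding cexp_def by (intro integral_cong_AE) auto
  qed
qed

lemma cexp_Re:
  fixes f :: "'a \<Rightarrow> complex"
  assumes "integrable M f"
  shows "AE \<omega> in M. Re (cexp f \<omega>) = cexp (\<lambda>x. Re (f x)) \<omega>"
    "AE \<omega> in M. Im (cexp f \<omega>) = cexp (\<lambda>x. Im (f x)) \<omega>"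
  using kernel_integrable[OF assms] by (eventually_elim, simp add: cexp_def)+

lemma cexp_eq_complex_cond_exp:
  assumes "integrable M f"
  shows "AE \<omega> in M. cexp f \<omega> = complex_cond_exp M F f \<omega>"
  using cexp_Re[OF assms] cexp_eq_real_cond_exp[OF integrable_Re[OF assms]]
    cexp_eq_real_cond_exp[OF integrable_Im[OF assms]]
  by eventually_elim (simp add: complex_cond_exp_def complex_eq_iff)

lemma cexp_add:
  fixes f g :: "'a \<Rightarrow> 'b::{banach, second_countable_topology}"
  assumes "integrable M f" "integrable M g"
  shows "AE \<omega> in M. cexp (\<lambda>x. f x + g x) \<omega> = cexp f \<omega> + cexp g \<omega>"
  using kernel_integrable[OF assms(1)] kernel_integrable[OF assms(2)]
  by eventually_elim (simp add: cexp_def)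

lemma cexp_diff:
  fixes f g :: "'a \<Rightarrow> 'b::{banach, second_countable_topology}"
  assumes "integrable M f" "integrable M g"
  shows "AE \<omega> in M. cexp (\<lambda>x. f x - g x) \<omega> = cexp f \<omega> - cexp g \<omega>"
  using kernel_integrable[OF assms(1)] kernel_integrable[OF assms(2)]
  by eventually_elim (simp add: cexp_def)

lemma cexp_mono_AE:
  fixes f g :: "'a \<Rightarrow> real"
  assumes f: "integrable M f" and g: "integrable M g" and le: "AE x in M. f x \<le> g x"
  shows "AE \<omega> in M. cexp f \<omega> \<le> cexp g \<omega>"
proof -
  have m [measurable]: "f \<in> borel_measurable M" "g \<in> borel_measurable M" using f g by auto
  have "AE x in M. max (f x) (g x) = g x" using le by eventually_elim (rule max_absorb2)
  then have "AE \<omega> in M. cexp (\<lambda>x. max (f x) (g x)) \<omega> = cexp g \<omega>"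
    by (intro cexp_cong_AE) auto
  then show ?thesis using kernel_integrable[OF f] kernel_integrable[OF integrable_max[OF f g]]
  proof eventually_elim
    case (elim \<omega>)
    have "cexp f \<omega> \<le> cexp (\<lambda>x. max (f x) (g x)) \<omega>"
      unfolding cexp_def using elim by (intro integral_mono) auto
    with elim show ?case by simp
  qed
qed

lemma cexp_sum:
  fixes f :: "'i \<Rightarrow> 'a \<Rightarrow> 'b::{banach, second_countable_topology}"
  assumes "finite I" "\<And>i. i \<in> I \<Longrightarrow> integrable M (f i)"
  shows "AE \<omega> in M. cexp (\<lambda>x. \<Sum>i\<in>I. f i x) \<omega> = (\<Sum>i\<in>I. cexp (f i) \<omega>)"
proof -
  have "AE \<omega> in M. \<forall>i\<in>I. integrable (\<kappa> \<omega>) (f i)"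
    using assms by (intro AE_finite_allI kernel_integrable)
  then show ?thesis by eventually_elim (simp add: cexp_def)
qed

lemma cexp_cmult [simp]:
  fixes f :: "'a \<Rightarrow> 'b::{banach, second_countable_topology, real_normed_field}"
  shows "cexp (\<lambda>x. c * f x) \<omega> = c * cexp f \<omega>"
  by (simp add: cexp_def)

lemma cexp_zero [simp]: "cexp (\<lambda>x. 0) \<omega> = 0"
  by (simp add: cexp_def)

lemma cexp_F_measurable_real:
  fixes f :: "'a \<Rightarrow> real"
  assumes "integrable M f" "f \<in> borel_measurable F"
  shows "AE \<omega> in M. cexp f \<omega> = f \<omega>"
proof -
  interpret S: sigma_finite_subalgebra M F by (rule sigma_finite_F)
  show ?thesis using cexp_eq_real_cond_exp[OF assms(1)] S.real_cond_exp_F_meas[OF assms] by eventually_elim simp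
qed

lemma cexp_F_measurable:
  fixes f :: "'a \<Rightarrow> complex"
  assumes "integrable M f" and [measurable]: "f \<in> borel_measurable F"
  shows "AE \<omega> in M. cexp f \<omega> = f \<omega>"
  using cexp_F_measurable_real[OF integrable_Re[OF assms(1)]] cexp_F_measurable_real[OF integrable_Im[OF assms(1)]]
    cexp_Re[OF assms(1)]
  by (auto simp: complex_eq_iff)

text \<open>The inequality between first and second moments, under each conditional law.\<close>

lemma cexp_norm_power2_le:
  fixes f :: "'a \<Rightarrow> complex"
  assumes "square_integrable M f"
  shows "AE \<omega> in M. (cmod (cexp f \<omega>))\<^sup>2 \<le> cexp (\<lambda>x. (cmod (f x))\<^sup>2) \<omega>"
  using kernel_integrable[OF square_integrableD(2)[OF assms]]
proof (rule AE_mp, intro AE_I2 impI)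
  fix \<omega> assume w: "\<omega> \<in> space M" and i: "integrable (\<kappa> \<omega>) (\<lambda>x. (cmod (f x))\<^sup>2)"
  interpret K: prob_space "\<kappa> \<omega>" by (rule kernel_prob[OF w])
  have sq: "square_integrable (\<kappa> \<omega>) f"
    using i kernel_meas[OF w square_integrableD(1)[OF assms]] by (simp add: square_integrable_def)
  have "cmod (cexp f \<omega>) \<le> (\<integral>x. cmod (f x) \<partial>\<kappa> \<omega>)" unfolding cexp_def by (rule integral_norm_bound)
  also have "\<dots> \<le> L2_norm (\<kappa> \<omega>) f" using K.square_integrable_imp_integrable(2)[OF sq] .
  finally have "(cmod (cexp f \<omega>))\<^sup>2 \<le> (L2_norm (\<kappa> \<omega>) f)\<^sup>2" by (simp add: power_mono)
  then show "(cmod (cexp f \<omega>))\<^sup>2 \<le> cexp (\<lambda>x. (cmod (f x))\<^sup>2) \<omega>" by (simp add: L2_norm_power2 cexp_def)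
qed

lemma cexp_square_integrable:
  fixes f :: "'a \<Rightarrow> complex"
  assumes "square_integrable M f"
  shows "square_integrable M (cexp f)" "L2_norm M (cexp f) \<le> L2_norm M f"
proof -
  note [measurable] = square_integrableD(1)[OF assms]
  note i = cexp_integral[OF square_integrableD(2)[OF assms]]
  have j: "integrable M (\<lambda>\<omega>. (cmod (cexp f \<omega>))\<^sup>2)"
    by (rule Bochner_Integration.integrable_bound[OF i(1)]) (use cexp_norm_power2_le[OF assms] in auto)
  then show "square_integrable M (cexp f)" by (simp add: square_integrable_def)
  show "L2_norm M (cexp f) \<le> L2_norm M f"
    using integral_mono_AE[OF j i(1) cexp_norm_power2_le[OF assms]] i(2) by (simp add: L2_norm_def)
qed

lemma kernel_square_integrable:
  fixes f :: "'a \<Rightarrow> complex"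
  assumes "square_integrable M f"
  shows "AE \<omega> in M. square_integrable (\<kappa> \<omega>) f"
  using kernel_integrable[OF square_integrableD(2)[OF assms]]
  by (rule AE_mp) (auto intro!: AE_I2 kernel_meas square_integrableD(1)[OF assms] simp: square_integrable_def)

end

section \<open>The measure preserving map and its filtration\<close>

context kernel_system begin

lemma T_pow_measurable [measurable]: "T ^^ k \<in> measurable M M"
proof (induction k)
  case (Suc k)
  have "T ^^ Suc k = (\<lambda>x. T ((T ^^ k) x))" by (simp add: fun_eq_iff)
  with Suc show ?case by simp
qed (simp add: id_def)

lemma T_pow_space: "x \<in> space M \<Longrightarrow> (T ^^ k) x \<in> space M"
  using measurable_space[OF T_pow_measurable] .

lemma T_pow_distr: "distr M M (T ^^ k) = M"
proof (induction k)
  case 0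
  then show ?case by (simp add: id_def)
next
  case (Suc k)
  have "distr M M (T ^^ Suc k) = distr M M (T \<circ> T ^^ k)" by (simp only: funpow.simps(2))
  also have "\<dots> = distr (distr M M (T ^^ k)) M T"
    by (rule distr_distr[symmetric]) measurable
  also have "\<dots> = M" by (simp only: Suc T_preserves)
  finally show ?case .
qed

lemma T_pow_measurable_comp:
  "f \<in> borel_measurable M \<Longrightarrow> (\<lambda>x. f ((T ^^ k) x)) \<in> borel_measurable M"
  by (rule measurable_compose[OF T_pow_measurable])

lemma integral_T_pow:
  fixes f :: "'a \<Rightarrow> 'b::{banach, second_countable_topology}"
  assumes "f \<in> borel_measurable M"
  shows "(\<integral>x. f ((T ^^ k) x) \<partial>M) = (\<integral>x. f x \<partial>M)"
  using integral_distr[OF T_pow_measurable[of k] assms] by (simp add: T_pow_distr)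

lemma integrable_T_pow:
  fixes f :: "'a \<Rightarrow> 'b::{banach, second_countable_topology}"
  assumes "integrable M f"
  shows "integrable M (\<lambda>x. f ((T ^^ k) x))"
  using integrable_distr[OF T_pow_measurable[of k], of f] assms by (simp add: T_pow_distr)

lemma AE_T_pow:
  assumes "AE x in M. P x"
  shows "AE x in M. P ((T ^^ k) x)"
  by (rule AE_distrD[OF T_pow_measurable]) (unfold T_pow_distr, rule assms)

lemma F_increasing_pow:
  assumes "A \<in> sets F"
  shows "\<exists>B\<in>sets F. A = (T ^^ k) -` B \<inter> space M"
proof (induction k)
  case 0
  have "A \<subseteq> space M" using sets.sets_into_space[OF assms] by simp
  then show ?case using assms by (auto intro!: bexI[of _ A])
next
  case (Suc k)
  then obtain B where B: "B \<in> sets F" "A = (T ^^ k) -` B \<inter> space M" by auto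
  obtain C where C: "C \<in> sets F" "B = T -` C \<inter> space M" using F_increasing B(1) by blast
  have "A = (T ^^ Suc k) -` C \<inter> space M"
    unfolding B(2) C(2) using T_pow_space by auto
  with C(1) show ?case by auto
qed

text \<open>The \<open>k\<close>-th \<open>\<sigma>\<close>-algebra of the filtration, the preimage of \<open>F\<close> under \<open>T\<^sup>k\<close>.\<close>

definition F_at :: "nat \<Rightarrow> 'a measure" where
  "F_at k = vimage_algebra (space M) (T ^^ k) F"

lemma space_F_at [simp]: "space (F_at k) = space M"
  by (simp add: F_at_def)

lemma T_pow_PiE: "T ^^ k \<in> space M \<rightarrow> space F"
  using T_pow_space by auto

lemma sets_F_at: "sets (F_at k) = {(T ^^ k) -` B \<inter> space M | B. B \<in> sets F}"
  unfolding F_at_def by (rule sets_vimage_algebra2[OF T_pow_PiE])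

lemma subalgebra_F_at: "subalgebra M (F_at k)"
  unfolding subalgebra_def sets_F_at
proof (intro conjI subsetI)
  fix A assume "A \<in> {(T ^^ k) -` B \<inter> space M | B. B \<in> sets F}"
  then obtain B where "B \<in> sets F" "A = (T ^^ k) -` B \<inter> space M" by blast
  then show "A \<in> sets M" using measurable_sets[OF T_pow_measurable sets_F, of B k] by simp
qed simp

lemma subalgebra_F_at_F: "subalgebra (F_at k) F"
  unfolding subalgebra_def sets_F_at
proof (intro conjI subsetI)
  fix A assume "A \<in> sets F"
  from F_increasing_pow[OF this, of k] show "A \<in> {(T ^^ k) -` B \<inter> space M | B. B \<in> sets F}"
    by blast
qed simp

lemma F_at_measurable:
  assumes "h \<in> borel_measurable F" "j \<le> k"
  shows "(\<lambda>x. h ((T ^^ j) x)) \<in> borel_measurable (F_at k)"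
proof (rule measurableI)
  fix A :: "'b set" assume A: "A \<in> sets borel"
  have "h -` A \<inter> space M \<in> sets F" using measurable_sets[OF assms(1) A] by simp
  then obtain B where B: "B \<in> sets F" "h -` A \<inter> space M = (T ^^ (k - j)) -` B \<inter> space M"
    using F_increasing_pow by metis
  have k: "(T ^^ (k - j)) ((T ^^ j) x) = (T ^^ k) x" for x
    using assms(2) funpow_add[of "k - j" j T] by simp
  have "(\<lambda>x. h ((T ^^ j) x)) -` A \<inter> space M = (T ^^ j) -` (h -` A \<inter> space M) \<inter> space M"
    using T_pow_space by auto
  also have "\<dots> = (T ^^ k) -` B \<inter> space M" unfolding B(2) using T_pow_space k by auto
  finally show "(\<lambda>x. h ((T ^^ j) x)) -` A \<inter> space (F_at k) \<in> sets (F_at k)"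
    using B(1) by (auto simp: sets_F_at)
qed simp

text \<open>Conditional expectations are transported by a measure preserving map, since events of the
  \<open>\<sigma>\<close>-algebra \<open>F_at k\<close> are preimages of events of \<open>F\<close>.\<close>

lemma cond_exp_F_at:
  fixes Y :: "'a \<Rightarrow> real"
  assumes "integrable M Y"
  shows "AE x in M. real_cond_exp M (F_at k) (\<lambda>x. Y ((T ^^ k) x)) x = cexp Y ((T ^^ k) x)"
proof -
  interpret S: sigma_finite_subalgebra M F by (rule sigma_finite_F)
  interpret Sk: sigma_finite_subalgebra M "F_at k"
    by (rule finite_measure_subalgebra_is_sigma_finite)
       (simp add: finite_measure_subalgebra_def finite_measure_subalgebra_axioms_def subalgebra_F_at finite_measure_axioms)
  have [measurable]: "Y \<in> borel_measurable M" using assms by auto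
  show ?thesis
  proof (rule Sk.real_cond_exp_charact)
    fix A assume "A \<in> sets (F_at k)"
    then obtain B where B: "B \<in> sets F" "A = (T ^^ k) -` B \<inter> space M" by (auto simp: sets_F_at)
    have [measurable]: "B \<in> sets M" using B(1) by (rule sets_F)
    have *: "(\<integral>x\<in>A. f ((T ^^ k) x) \<partial>M) = (\<integral>x\<in>B. f x \<partial>M)" if [measurable]: "f \<in> borel_measurable M" for f :: "'a \<Rightarrow> real"
    proof -
      have "(\<integral>x\<in>A. f ((T ^^ k) x) \<partial>M) = (\<integral>x. indicator B ((T ^^ k) x) * f ((T ^^ k) x) \<partial>M)"
        unfolding set_lebesgue_integral_def B(2)
        by (intro Bochner_Integration.integral_cong) (auto simp: indicator_def)
      also have "\<dots> = (\<integral>x\<in>B. f x \<partial>M)" 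
        unfolding set_lebesgue_integral_def by (subst integral_T_pow) auto
      finally show ?thesis .
    qed
    have "(\<integral>x\<in>B. Y x \<partial>M) = (\<integral>x\<in>B. real_cond_exp M F Y x \<partial>M)"
      by (rule S.real_cond_exp_intA[OF assms B(1)])
    also have "\<dots> = (\<integral>x\<in>B. cexp Y x \<partial>M)"
      unfolding set_lebesgue_integral_def
      by (rule integral_cong_AE) (use cexp_eq_real_cond_exp[OF assms] in auto)
    finally show "(\<integral>x\<in>A. Y ((T ^^ k) x) \<partial>M) = (\<integral>x\<in>A. cexp Y ((T ^^ k) x) \<partial>M)"
      by (simp add: *)
  next
    show "integrable M (\<lambda>x. Y ((T ^^ k) x))" by (rule integrable_T_pow[OF assms])
    show "integrable M (\<lambda>x. cexp Y ((T ^^ k) x))" by (rule integrable_T_pow[OF cexp_integral(1)[OF assms]])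
    show "(\<lambda>x. cexp Y ((T ^^ k) x)) \<in> borel_measurable (F_at k)"
      by (rule F_at_measurable) auto
  qed
qed

text \<open>Conditioning first on the larger \<open>\<sigma>\<close>-algebra \<open>F_at k\<close> allows \<open>z\<close> to be taken out, and
  stationarity turns the conditional expectation at time \<open>k\<close> into the one at time \<open>0\<close>.\<close>

lemma cexp_pull_real:
  fixes Y z :: "'a \<Rightarrow> real"
  assumes Y: "integrable M Y" and z [measurable]: "z \<in> borel_measurable (F_at k)"
    and zY: "integrable M (\<lambda>x. z x * Y ((T ^^ k) x))"
  shows "integrable M (\<lambda>x. z x * cexp Y ((T ^^ k) x))"
    "AE \<omega> in M. cexp (\<lambda>x. z x * Y ((T ^^ k) x)) \<omega> = cexp (\<lambda>x. z x * cexp Y ((T ^^ k) x)) \<omega>"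
proof -
  interpret S: sigma_finite_subalgebra M F by (rule sigma_finite_F)
  interpret Sk: sigma_finite_subalgebra M "F_at k"
    by (rule finite_measure_subalgebra_is_sigma_finite)
       (simp add: finite_measure_subalgebra_def finite_measure_subalgebra_axioms_def subalgebra_F_at finite_measure_axioms)
  have [measurable]: "Y \<in> borel_measurable M" using Y by auto
  have [measurable]: "z \<in> borel_measurable M" by (rule measurable_from_subalg[OF subalgebra_F_at z])
  have 1: "AE x in M. real_cond_exp M (F_at k) (\<lambda>x. z x * Y ((T ^^ k) x)) x = z x * cexp Y ((T ^^ k) x)"
    using Sk.real_cond_exp_mult[OF z borel_measurable_integrable[OF integrable_T_pow[OF Y]] zY]
      cond_exp_F_at[OF Y, of k] by eventually_elim simp
  show i: "integrable M (\<lambda>x. z x * cexp Y ((T ^^ k) x))"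
    by (rule integrable_cong_AE_imp[OF Sk.real_cond_exp_int(1)[OF zY] _ 1]) measurable
  have "AE x in M. real_cond_exp M F (real_cond_exp M (F_at k) (\<lambda>x. z x * Y ((T ^^ k) x))) x
      = real_cond_exp M F (\<lambda>x. z x * cexp Y ((T ^^ k) x)) x"
    by (rule S.real_cond_exp_cong[OF 1 measurable_from_subalg[OF subalgebra_F_at borel_measurable_cond_exp]])
       measurable
  moreover have "AE x in M. real_cond_exp M F (real_cond_exp M (F_at k) (\<lambda>x. z x * Y ((T ^^ k) x))) x
      = real_cond_exp M F (\<lambda>x. z x * Y ((T ^^ k) x)) x"
    by (rule S.real_cond_exp_nested_subalg[OF subalgebra_F_at subalgebra_F_at_F zY])
  ultimately show "AE \<omega> in M. cexp (\<lambda>x. z x * Y ((T ^^ k) x)) \<omega> = cexp (\<lambda>x. z x * cexp Y ((T ^^ k) x)) \<omega>"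
    using cexp_eq_real_cond_exp[OF zY] cexp_eq_real_cond_exp[OF i] by eventually_elim simp
qed

lemma cexp_pull:
  fixes Y z :: "'a \<Rightarrow> complex"
  assumes Y: "integrable M Y" and z [measurable]: "z \<in> borel_measurable (F_at k)"
    and zY: "integrable M (\<lambda>x. z x * Y ((T ^^ k) x))"
  shows "integrable M (\<lambda>x. z x * cexp Y ((T ^^ k) x))"
    "AE \<omega> in M. cexp (\<lambda>x. z x * Y ((T ^^ k) x)) \<omega> = cexp (\<lambda>x. z x * cexp Y ((T ^^ k) x)) \<omega>"
proof -
  have [measurable]: "Y \<in> borel_measurable M" using Y by auto
  have zM [measurable]: "z \<in> borel_measurable M" by (rule measurable_from_subalg[OF subalgebra_F_at z])
  have zF: "(\<lambda>x. Re (z x)) \<in> borel_measurable (F_at k)" "(\<lambda>x. Im (z x)) \<in> borel_measurable (F_at k)"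
    by measurable
  have b: "integrable M (\<lambda>x. a (z x) * b (Y ((T ^^ k) x)))"
    if ab: "a = Re \<or> a = Im" "b = Re \<or> b = Im" for a b
  proof (rule Bochner_Integration.integrable_bound[OF zY])
    show "(\<lambda>x. a (z x) * b (Y ((T ^^ k) x))) \<in> borel_measurable M"
      using ab by (elim disjE) simp_all
    have "\<bar>a u\<bar> \<le> cmod u" "\<bar>b u\<bar> \<le> cmod u" for u
      using ab abs_Re_le_cmod abs_Im_le_cmod by auto
    then show "AE x in M. norm (a (z x) * b (Y ((T ^^ k) x))) \<le> norm (z x * Y ((T ^^ k) x))"
      by (auto simp: norm_mult abs_mult intro!: mult_mono)
  qed
  note Yr = integrable_Re[OF Y] and Yi = integrable_Im[OF Y]
  note rr = cexp_pull_real[OF Yr zF(1) b[of Re Re, simplified]]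
  note ri = cexp_pull_real[OF Yi zF(1) b[of Re Im, simplified]]
  note ir = cexp_pull_real[OF Yr zF(2) b[of Im Re, simplified]]
  note ii = cexp_pull_real[OF Yi zF(2) b[of Im Im, simplified]]
  have YT: "AE x in M. Re (cexp Y ((T ^^ k) x)) = cexp (\<lambda>x. Re (Y x)) ((T ^^ k) x)"
     "AE x in M. Im (cexp Y ((T ^^ k) x)) = cexp (\<lambda>x. Im (Y x)) ((T ^^ k) x)"
    by (intro AE_T_pow cexp_Re Y)+
  define R where "R x = z x * Complex (cexp (\<lambda>x. Re (Y x)) ((T ^^ k) x)) (cexp (\<lambda>x. Im (Y x)) ((T ^^ k) x))" for x
  have R: "AE x in M. R x = z x * cexp Y ((T ^^ k) x)"
    using YT by eventually_elim (simp add: complex_eq_iff R_def)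
  define L where "L x = Complex (Re (z x) * cexp (\<lambda>x. Re (Y x)) ((T ^^ k) x) - Im (z x) * cexp (\<lambda>x. Im (Y x)) ((T ^^ k) x))
     (Re (z x) * cexp (\<lambda>x. Im (Y x)) ((T ^^ k) x) + Im (z x) * cexp (\<lambda>x. Re (Y x)) ((T ^^ k) x))" for x
  have RL: "R = L" by (rule ext) (simp add: R_def L_def complex_eq_iff)
  have L2: "L = (\<lambda>x. complex_of_real (Re (z x) * cexp (\<lambda>x. Re (Y x)) ((T ^^ k) x) - Im (z x) * cexp (\<lambda>x. Im (Y x)) ((T ^^ k) x))
     + \<i> * complex_of_real (Re (z x) * cexp (\<lambda>x. Im (Y x)) ((T ^^ k) x) + Im (z x) * cexp (\<lambda>x. Re (Y x)) ((T ^^ k) x)))"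
    by (rule ext) (simp add: L_def complex_eq_iff)
  have iL: "integrable M L" unfolding L2
    by (intro Bochner_Integration.integrable_add Bochner_Integration.integrable_diff
      integrable_mult_right integrable_of_real rr ri ir ii)
  show iR: "integrable M (\<lambda>x. z x * cexp Y ((T ^^ k) x))"
    by (rule integrable_cong_AE_imp[OF iL]) (use R RL in auto)
  have c1: "AE \<omega> in M. cexp L \<omega> = cexp (\<lambda>x. z x * cexp Y ((T ^^ k) x)) \<omega>"
    by (rule cexp_cong_AE) (use iL R RL in auto)
  have ReL: "Re (L x) = Re (z x) * cexp (\<lambda>x. Re (Y x)) ((T ^^ k) x) - Im (z x) * cexp (\<lambda>x. Im (Y x)) ((T ^^ k) x)"
    and ImL: "Im (L x) = Re (z x) * cexp (\<lambda>x. Im (Y x)) ((T ^^ k) x) + Im (z x) * cexp (\<lambda>x. Re (Y x)) ((T ^^ k) x)" for x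
    by (auto simp: L_def)
  have "AE \<omega> in M. cexp (\<lambda>x. z x * Y ((T ^^ k) x)) \<omega> = cexp L \<omega>"
    using cexp_Re[OF zY] cexp_Re[OF iL] rr(2) ri(2) ir(2) ii(2)
      cexp_diff[OF b[of Re Re, simplified] b[of Im Im, simplified]]
      cexp_add[OF b[of Re Im, simplified] b[of Im Re, simplified]]
      cexp_diff[OF rr(1) ii(1)] cexp_add[OF ri(1) ir(1)]
    by eventually_elim (simp add: complex_eq_iff ReL ImL)
  then show "AE \<omega> in M. cexp (\<lambda>x. z x * Y ((T ^^ k) x)) \<omega> = cexp (\<lambda>x. z x * cexp Y ((T ^^ k) x)) \<omega>"
    using c1 by eventually_elim simp
qed

lemma cexp_tower:
  fixes Y :: "'a \<Rightarrow> complex"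
  assumes "integrable M Y"
  shows "AE \<omega> in M. cexp (\<lambda>x. cexp Y ((T ^^ k) x)) \<omega> = cexp (\<lambda>x. Y ((T ^^ k) x)) \<omega>"
  using cexp_pull(2)[OF assms, of "\<lambda>_. 1" k] integrable_T_pow[OF assms] by auto

lemma cexp_tower_real:
  fixes Y :: "'a \<Rightarrow> real"
  assumes "integrable M Y"
  shows "AE \<omega> in M. cexp (\<lambda>x. cexp Y ((T ^^ k) x)) \<omega> = cexp (\<lambda>x. Y ((T ^^ k) x)) \<omega>"
  using cexp_pull_real(2)[OF assms, of "\<lambda>_. 1" k] integrable_T_pow[OF assms] by auto

end

section \<open>A maximal inequality for orbit averages\<close>

text \<open>A weak type bound of order two gives integrability: split the values of \<open>Y\<close> at the levels
  \<open>2\<^sup>n * a\<close> and sum the tails, which form a geometric series.\<close>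

lemma (in prob_space) nn_integral_le_of_weak_type:
  fixes Y :: "'a \<Rightarrow> ennreal"
  assumes [measurable]: "Y \<in> borel_measurable M" and a: "0 < a"
    and weak: "\<And>u. 0 < u \<Longrightarrow> emeasure M {x \<in> space M. ennreal u < Y x} \<le> ennreal (a\<^sup>2 / u\<^sup>2)"
  shows "(\<integral>\<^sup>+x. Y x \<partial>M) \<le> ennreal (3 * a)"
proof -
  \<comment> \<open>The levels; \<open>A n\<close> below is the set where \<open>Y\<close> exceeds the \<open>n\<close>-th level.\<close>
  define b where "b n = 2 ^ n * a" for n :: nat
  have b0: "0 < b n" for n using a by (simp add: b_def)
  define A where "A n = {x \<in> space M. ennreal (b n) < Y x}" for n
  have [measurable]: "A n \<in> sets M" for n unfolding A_def by measurable
  have step: "min (Y x) (ennreal (b (Suc n))) \<le> min (Y x) (ennreal (b n)) + ennreal (b n) * indicator (A n) x"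
    if x: "x \<in> space M" for x n
  proof (cases "x \<in> A n")
    case True
    have "ennreal (b (Suc n)) = ennreal (b n) + ennreal (b n)"
      using b0[of n] by (simp add: b_def ennreal_plus[symmetric] mult_ac del: ennreal_plus)
    moreover have "min (Y x) (ennreal (b n)) = ennreal (b n)"
      using True by (intro min_absorb2) (simp add: A_def less_imp_le)
    ultimately show ?thesis using True by simp
  next
    case False
    then have "Y x \<le> ennreal (b n)" using x by (simp add: A_def not_less)
    then show ?thesis by (simp add: min.coboundedI1)
  qed
  have fin: "(\<integral>\<^sup>+x. min (Y x) (ennreal (b n)) \<partial>M) \<le> ennreal (a + (\<Sum>i<n. a / 2 ^ i))" for n
  proof (induction n)
    case 0
    have "(\<integral>\<^sup>+x. min (Y x) (ennreal (b 0)) \<partial>M) \<le> (\<integral>\<^sup>+x. ennreal a \<partial>M)"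
      by (intro nn_integral_mono) (simp add: b_def)
    then show ?case by (simp add: emeasure_space_1)
  next
    case (Suc n)
    have "(\<integral>\<^sup>+x. min (Y x) (ennreal (b (Suc n))) \<partial>M) \<le>
        (\<integral>\<^sup>+x. min (Y x) (ennreal (b n)) + ennreal (b n) * indicator (A n) x \<partial>M)"
      by (intro nn_integral_mono step)
    also have "\<dots> = (\<integral>\<^sup>+x. min (Y x) (ennreal (b n)) \<partial>M) + ennreal (b n) * emeasure M (A n)"
      by (simp add: nn_integral_add nn_integral_cmult_indicator)
    also have "\<dots> \<le> ennreal (a + (\<Sum>i<n. a / 2 ^ i)) + ennreal (b n) * ennreal (a\<^sup>2 / (b n)\<^sup>2)"
      unfolding A_def by (intro add_mono Suc mult_left_mono weak b0) auto
    also have "\<dots> = ennreal (a + (\<Sum>i<n. a / 2 ^ i) + b n * (a\<^sup>2 / (b n)\<^sup>2))"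
      using a b0[of n] by (simp add: ennreal_mult[symmetric] ennreal_plus[symmetric] sum_nonneg del: ennreal_plus)
    also have "b n * (a\<^sup>2 / (b n)\<^sup>2) = a / 2 ^ n"
      using a by (simp add: b_def power2_eq_square field_simps)
    finally show ?case by (simp add: add.assoc)
  qed
  have "(\<Sum>i<n. a / 2 ^ i) \<le> 2 * a" for n
  proof -
    have "(\<Sum>i<n. a / 2 ^ i) = 2 * a - a * 2 / 2 ^ n" by (induction n) (auto simp: field_simps)
    then show ?thesis using a by simp
  qed
  then have fin': "(\<integral>\<^sup>+x. min (Y x) (ennreal (b n)) \<partial>M) \<le> ennreal (3 * a)" for n
    by (intro order_trans[OF fin] ennreal_leI) (simp add: algebra_simps)
  have mono: "b m \<le> b n" if "m \<le> n" for m n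
    using that a by (simp add: b_def power_increasing)
  have inc: "incseq (\<lambda>n x. min (Y x) (ennreal (b n)))"
    unfolding incseq_def le_fun_def by (intro allI impI min.mono order_refl ennreal_leI mono)
  have "(SUP n. min (Y x) (ennreal (b n))) = Y x" for x
  proof -
    have tp: "(SUP n. ennreal (b n)) = top"
    proof (rule SUP_eq_top_iff[THEN iffD2], intro allI impI)
      fix y :: ennreal assume "y < top"
      then obtain r where r: "y = ennreal r" "0 \<le> r" by (cases y) auto
      obtain n :: nat where "r / a < 2 ^ n" using real_arch_pow[of 2 "r / a"] by auto
      then have "r < b n" using a by (simp add: b_def field_simps)
      then show "\<exists>n\<in>UNIV. y < ennreal (b n)" using r by (auto intro!: exI[of _ n] simp: ennreal_lessI)
    qed
    have "(SUP n. min (Y x) (ennreal (b n))) = min (Y x) (SUP n. ennreal (b n))"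
      using inf_SUP[of "Y x" "\<lambda>n. ennreal (b n)" UNIV] by (simp only: inf_min)
    also have "\<dots> = Y x" unfolding tp by (rule min_absorb1) simp
    finally show ?thesis .
  qed
  then have "(\<integral>\<^sup>+x. Y x \<partial>M) = (\<integral>\<^sup>+x. (SUP n. min (Y x) (ennreal (b n))) \<partial>M)" by simp
  also have "\<dots> = (SUP n. \<integral>\<^sup>+x. min (Y x) (ennreal (b n)) \<partial>M)"
    by (rule nn_integral_monotone_convergence_SUP[OF inc]) measurable
  also have "\<dots> \<le> ennreal (3 * a)" by (intro SUP_least fin')
  finally show ?thesis .
qed

context kernel_system begin

definition orbit_cexp :: "('a \<Rightarrow> real) \<Rightarrow> nat \<Rightarrow> nat \<Rightarrow> 'a \<Rightarrow> real" where
  "orbit_cexp h q m \<omega> = (\<Sum>l<m. cexp (\<lambda>x. h ((T ^^ (l * q)) x)) \<omega>)"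

lemma orbit_cexp_measurable [measurable]:
  "h \<in> borel_measurable M \<Longrightarrow> orbit_cexp h q m \<in> borel_measurable M"
  unfolding orbit_cexp_def by (intro borel_measurable_sum cexp_measurable T_pow_measurable_comp)

lemma orbit_cexp_integrable:
  assumes "integrable M h"
  shows "integrable M (orbit_cexp h q m)"
  unfolding orbit_cexp_def by (intro Bochner_Integration.integrable_sum cexp_integral integrable_T_pow assms)

text \<open>The tower property makes these sums the iterates of an operator \<open>h + E (\<cdot> \<circ> T\<^sup>q | F)\<close>, which is
  what Garsia's argument needs.\<close>

lemma orbit_cexp_Suc:
  assumes h: "integrable M h" and hF: "h \<in> borel_measurable F"
  shows "AE \<omega> in M. orbit_cexp h q (Suc m) \<omega> = h \<omega> + cexp (\<lambda>x. orbit_cexp h q m ((T ^^ q) x)) \<omega>"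
proof -
  have i: "integrable M (\<lambda>x. cexp (\<lambda>x. h ((T ^^ (l * q)) x)) ((T ^^ q) x))" for l
    by (intro integrable_T_pow cexp_integral h)
  have "AE \<omega> in M. \<forall>l\<in>{..<m}. cexp (\<lambda>x. cexp (\<lambda>x. h ((T ^^ (l * q)) x)) ((T ^^ q) x)) \<omega>
       = cexp (\<lambda>x. h ((T ^^ (Suc l * q)) x)) \<omega>"
  proof (rule AE_finite_allI)
    fix l
    have e: "(T ^^ (l * q)) ((T ^^ q) x) = (T ^^ (Suc l * q)) x" for x
      using funpow_add[of "l * q" q T] by (simp add: add.commute)
    show "AE \<omega> in M. cexp (\<lambda>x. cexp (\<lambda>x. h ((T ^^ (l * q)) x)) ((T ^^ q) x)) \<omega>
       = cexp (\<lambda>x. h ((T ^^ (Suc l * q)) x)) \<omega>"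
      using cexp_tower_real[OF integrable_T_pow[OF h, of "l * q"], of q] unfolding e .
  qed simp
  moreover have "AE \<omega> in M. cexp (\<lambda>x. orbit_cexp h q m ((T ^^ q) x)) \<omega> =
      (\<Sum>l<m. cexp (\<lambda>x. cexp (\<lambda>x. h ((T ^^ (l * q)) x)) ((T ^^ q) x)) \<omega>)"
    unfolding orbit_cexp_def by (rule cexp_sum) (auto intro: i)
  moreover have "AE \<omega> in M. cexp h \<omega> = h \<omega>" by (rule cexp_F_measurable_real[OF h hF])
  ultimately show ?thesis
    by eventually_elim (simp add: orbit_cexp_def sum.lessThan_Suc_shift del: sum.lessThan_Suc)
qed

text \<open>The maximal ergodic lemma for the positive contraction \<open>E (\<cdot> \<circ> T\<^sup>q | F)\<close> of \<open>L\<^sup>1 (F)\<close>, by Garsia's argument.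
  Let \<open>H\<close> be the maximum of the sums for \<open>h - c\<close>, the empty sum included. Where \<open>H\<close> is positive, the maximum is
  attained at a nonempty sum, so the recursion gives \<open>H \<le> h - c + E (H \<circ> T\<^sup>q | F)\<close>. Integrating, and using that
  \<open>H\<close> and \<open>E (H \<circ> T\<^sup>q | F)\<close> have the same integral, shows that \<open>h - c\<close> has nonnegative integral over the set
  where \<open>H\<close> is positive.\<close>

lemma hopf_maximal_finite:
  assumes h: "integrable M h" and hF: "h \<in> borel_measurable F" and h0: "\<And>x. 0 \<le> h x" and c: "0 < c"
  shows "c * measure M {\<omega> \<in> space M. \<exists>m\<le>N. real m * c < orbit_cexp h q m \<omega>} \<le> (\<integral>x. h x \<partial>M)"
proof -
  have [measurable]: "h \<in> borel_measurable M" using h by auto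
  define a where "a k \<omega> = orbit_cexp h q k \<omega> - real k * c" for k \<omega>
  have ai: "integrable M (a k)" for k
    unfolding a_def by (intro Bochner_Integration.integrable_diff orbit_cexp_integrable h) simp
  have [measurable]: "a k \<in> borel_measurable M" for k using ai by auto
  define H where "H \<omega> = Max ((\<lambda>k. a k \<omega>) ` {..N})" for \<omega>
  have Hm [measurable]: "H \<in> borel_measurable M"
    unfolding H_def by (rule borel_measurable_Max) auto
  have a0: "a 0 \<omega> = 0" for \<omega> by (simp add: a_def orbit_cexp_def)
  have H0: "0 \<le> H \<omega>" for \<omega>
    unfolding H_def using Max_ge[of "(\<lambda>k. a k \<omega>) ` {..N}" "a 0 \<omega>"] a0[of \<omega>] by auto
  have Hge: "a k \<omega> \<le> H \<omega>" if "k \<le> N" for k \<omega>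
    unfolding H_def using that by (intro Max_ge) auto
  have Hex: "\<exists>k\<le>N. H \<omega> = a k \<omega>" for \<omega>
  proof -
    have "H \<omega> \<in> (\<lambda>k. a k \<omega>) ` {..N}" unfolding H_def by (rule Max_in) auto
    then show ?thesis by blast
  qed
  have Hi: "integrable M H"
  proof (rule Bochner_Integration.integrable_bound)
    show "integrable M (\<lambda>\<omega>. \<Sum>k\<le>N. \<bar>a k \<omega>\<bar>)" using ai by auto
    have "\<bar>H \<omega>\<bar> \<le> (\<Sum>k\<le>N. \<bar>a k \<omega>\<bar>)" for \<omega>
    proof -
      obtain k where "k \<le> N" "H \<omega> = a k \<omega>" using Hex by blast
      then show ?thesis using member_le_sum[of k "{..N}" "\<lambda>k. \<bar>a k \<omega>\<bar>"] by auto
    qed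
    then show "AE \<omega> in M. norm (H \<omega>) \<le> norm (\<Sum>k\<le>N. \<bar>a k \<omega>\<bar>)"
      by (simp add: abs_of_nonneg sum_nonneg)
  qed measurable
  let ?I = "\<lambda>\<omega>. indicator {\<omega> \<in> space M. 0 < H \<omega>} \<omega> :: real"
  have rec: "AE \<omega> in M. \<forall>k. a (Suc k) \<omega> = h \<omega> - c + cexp (\<lambda>x. a k ((T ^^ q) x)) \<omega>"
  proof (rule AE_all_countable[THEN iffD2], rule allI)
    fix k
    define d where "d = real k * c"
    have a_d: "a k = (\<lambda>x. orbit_cexp h q k x - d)" by (simp add: a_def d_def fun_eq_iff)
    have "AE \<omega> in M. cexp (\<lambda>x. a k ((T ^^ q) x)) \<omega> = cexp (\<lambda>x. orbit_cexp h q k ((T ^^ q) x)) \<omega> - cexp (\<lambda>x. d) \<omega>"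
      unfolding a_d by (rule cexp_diff) (auto intro!: integrable_T_pow orbit_cexp_integrable h)
    moreover have "AE \<omega> in M. cexp (\<lambda>x. d) \<omega> = d"
      by (rule cexp_F_measurable_real) auto
    ultimately show "AE \<omega> in M. a (Suc k) \<omega> = h \<omega> - c + cexp (\<lambda>x. a k ((T ^^ q) x)) \<omega>"
      using orbit_cexp_Suc[OF h hF, of q k]
      by eventually_elim (simp add: a_def[of "Suc k"], simp add: d_def algebra_simps)
  qed
  have ki: "AE \<omega> in M. \<forall>k. integrable (\<kappa> \<omega>) (\<lambda>x. a k ((T ^^ q) x))"
    by (rule AE_all_countable[THEN iffD2]) (intro allI kernel_integrable integrable_T_pow ai)
  have kH: "AE \<omega> in M. integrable (\<kappa> \<omega>) (\<lambda>x. H ((T ^^ q) x))"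
    by (intro kernel_integrable integrable_T_pow Hi)
  have "AE \<omega> in M. H \<omega> \<le> ?I \<omega> * (h \<omega> - c) + cexp (\<lambda>x. H ((T ^^ q) x)) \<omega>"
    using rec ki kH AE_space
  proof eventually_elim
    case (elim \<omega>)
    have nn: "0 \<le> cexp (\<lambda>x. H ((T ^^ q) x)) \<omega>"
      unfolding cexp_def by (intro Bochner_Integration.integral_nonneg H0)
    show ?case
    proof (cases "0 < H \<omega>")
      case True
      obtain k where k: "k \<le> N" "H \<omega> = a k \<omega>" using Hex by blast
      with True a0 have "k \<noteq> 0" by (intro notI) simp
      then obtain k' where k': "k = Suc k'" by (cases k) auto
      have "cexp (\<lambda>x. a k' ((T ^^ q) x)) \<omega> \<le> cexp (\<lambda>x. H ((T ^^ q) x)) \<omega>"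
        unfolding cexp_def using elim k k' by (intro integral_mono Hge) auto
      then show ?thesis using elim k k' True by (simp add: a0)
    next
      case False
      then show ?thesis using nn H0[of \<omega>] by simp
    qed
  qed
  moreover have Ii: "integrable M (\<lambda>\<omega>. ?I \<omega> * (h \<omega> - c))"
    using integrable_mult_indicator[of "{\<omega> \<in> space M. 0 < H \<omega>}" M "\<lambda>\<omega>. h \<omega> - c"] h by simp
  moreover have Ti: "integrable M (cexp (\<lambda>x. H ((T ^^ q) x)))"
    by (rule cexp_integral(1)[OF integrable_T_pow[OF Hi]])
  ultimately have "(\<integral>\<omega>. H \<omega> \<partial>M) \<le> (\<integral>\<omega>. ?I \<omega> * (h \<omega> - c) + cexp (\<lambda>x. H ((T ^^ q) x)) \<omega> \<partial>M)"
    by (intro integral_mono_AE Hi Bochner_Integration.integrable_add)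
  also have "\<dots> = (\<integral>\<omega>. ?I \<omega> * (h \<omega> - c) \<partial>M) + (\<integral>\<omega>. cexp (\<lambda>x. H ((T ^^ q) x)) \<omega> \<partial>M)"
    by (rule Bochner_Integration.integral_add[OF Ii Ti])
  also have "(\<integral>\<omega>. cexp (\<lambda>x. H ((T ^^ q) x)) \<omega> \<partial>M) = (\<integral>\<omega>. H \<omega> \<partial>M)"
    using cexp_integral(2)[OF integrable_T_pow[OF Hi]] integral_T_pow[OF Hm] by simp
  finally have "0 \<le> (\<integral>\<omega>. ?I \<omega> * (h \<omega> - c) \<partial>M)" by simp
  also have "\<dots> \<le> (\<integral>\<omega>. h \<omega> - c * ?I \<omega> \<partial>M)"
  proof (rule integral_mono)
    show "integrable M (\<lambda>\<omega>. ?I \<omega> * (h \<omega> - c))" by (rule Ii)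
    show "integrable M (\<lambda>\<omega>. h \<omega> - c * ?I \<omega>)"
      by (intro Bochner_Integration.integrable_diff h integrable_mult_right) (auto simp: emeasure_eq_measure)
    show "?I \<omega> * (h \<omega> - c) \<le> h \<omega> - c * ?I \<omega>" for \<omega>
      using h0[of \<omega>] by (auto simp: indicator_def)
  qed
  also have "\<dots> = (\<integral>\<omega>. h \<omega> \<partial>M) - c * measure M {\<omega> \<in> space M. 0 < H \<omega>}"
    using h by (simp add: emeasure_eq_measure)
  finally have 1: "c * measure M {\<omega> \<in> space M. 0 < H \<omega>} \<le> (\<integral>\<omega>. h \<omega> \<partial>M)" by simp
  have "measure M {\<omega> \<in> space M. \<exists>m\<le>N. real m * c < orbit_cexp h q m \<omega>} \<le> measure M {\<omega> \<in> space M. 0 < H \<omega>}"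
  proof (rule finite_measure_mono)
    show "{\<omega> \<in> space M. \<exists>m\<le>N. real m * c < orbit_cexp h q m \<omega>} \<subseteq> {\<omega> \<in> space M. 0 < H \<omega>}"
    proof clarify
      fix \<omega> m assume "m \<le> N" "real m * c < orbit_cexp h q m \<omega>"
      then show "0 < H \<omega>" using Hge[of m \<omega>] by (simp add: a_def)
    qed
  qed measurable
  then show ?thesis using 1 c mult_left_mono order_trans less_imp_le by meson
qed

text \<open>The square root is taken because the maximal function is applied to squares of functions in \<open>L\<^sup>2\<close>;
  unlike the maximal function itself, its square root is integrable.\<close>

definition orbit_max :: "('a \<Rightarrow> real) \<Rightarrow> nat \<Rightarrow> 'a \<Rightarrow> ennreal" where
  "orbit_max h q \<omega> = (SUP m. ennreal (sqrt (orbit_cexp h q m \<omega> / real m)))"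

lemma orbit_max_measurable [measurable]:
  "h \<in> borel_measurable M \<Longrightarrow> orbit_max h q \<in> borel_measurable M"
  unfolding orbit_max_def[abs_def]
  by (intro borel_measurable_SUP measurable_compose[OF _ measurable_ennreal] borel_measurable_sqrt
      borel_measurable_divide orbit_cexp_measurable) auto

lemma orbit_max_ge: "ennreal (sqrt (orbit_cexp h q m \<omega>)) \<le> ennreal (sqrt (real m)) * orbit_max h q \<omega>"
proof (cases "m = 0")
  case False
  have "ennreal (sqrt (orbit_cexp h q m \<omega>)) \<le> ennreal (sqrt (real m)) * ennreal (sqrt (orbit_cexp h q m \<omega> / real m))"
    using False by (cases "0 \<le> orbit_cexp h q m \<omega>")
      (auto simp: ennreal_mult'[symmetric] real_sqrt_divide ennreal_neg)
  also have "\<dots> \<le> ennreal (sqrt (real m)) * orbit_max h q \<omega>"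
    unfolding orbit_max_def by (intro mult_left_mono SUP_upper) auto
  finally show ?thesis .
qed (simp add: orbit_cexp_def)

lemma nn_integral_orbit_max_le:
  assumes h: "integrable M h" and hF: "h \<in> borel_measurable F" and h0: "\<And>x. 0 \<le> h x"
  shows "(\<integral>\<^sup>+\<omega>. orbit_max h q \<omega> \<partial>M) \<le> ennreal (3 * sqrt (\<integral>x. h x \<partial>M))"
proof -
  have [measurable]: "h \<in> borel_measurable M" using h by auto
  let ?I = "\<integral>x. h x \<partial>M"
  have I0: "0 \<le> ?I" by (intro Bochner_Integration.integral_nonneg h0)
  have weak: "emeasure M {\<omega> \<in> space M. ennreal u < orbit_max h q \<omega>} \<le> ennreal (?I / u\<^sup>2)" if u: "0 < u" for u
  proof -
    define A where "A N = {\<omega> \<in> space M. \<exists>m\<le>N. real m * u\<^sup>2 < orbit_cexp h q m \<omega>}" for N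
    have [measurable]: "A N \<in> sets M" for N unfolding A_def by measurable
    have sub: "{\<omega> \<in> space M. ennreal u < orbit_max h q \<omega>} \<subseteq> (\<Union>N. A N)"
    proof clarify
      fix \<omega> assume w: "\<omega> \<in> space M" "ennreal u < orbit_max h q \<omega>"
      then obtain m where m: "ennreal u < ennreal (sqrt (orbit_cexp h q m \<omega> / real m))"
        by (auto simp: orbit_max_def less_SUP_iff)
      then have "u < sqrt (orbit_cexp h q m \<omega> / real m)" using u by (simp add: ennreal_less_iff)
      moreover from this u have "m \<noteq> 0" by (intro notI) simp
      ultimately have "u\<^sup>2 < orbit_cexp h q m \<omega> / real m"
        using u real_sqrt_less_iff[of "u\<^sup>2" "orbit_cexp h q m \<omega> / real m"] by simp
      then have "real m * u\<^sup>2 < orbit_cexp h q m \<omega>" using \<open>m \<noteq> 0\<close> by (simp add: field_simps)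
      then show "\<omega> \<in> (\<Union>N. A N)" using w by (auto simp: A_def)
    qed
    have inc: "incseq A" unfolding A_def incseq_def by (auto intro: order_trans)
    have "emeasure M {\<omega> \<in> space M. ennreal u < orbit_max h q \<omega>} \<le> emeasure M (\<Union>N. A N)"
      by (rule emeasure_mono[OF sub]) measurable
    also have "\<dots> = (SUP N. emeasure M (A N))"
      using inc by (intro SUP_emeasure_incseq[symmetric]) auto
    also have "\<dots> \<le> ennreal (?I / u\<^sup>2)"
    proof (rule SUP_least)
      fix N
      have "u\<^sup>2 * measure M (A N) \<le> ?I" unfolding A_def
        using hopf_maximal_finite[OF h hF h0, of "u\<^sup>2" N q] u by simp
      then show "emeasure M (A N) \<le> ennreal (?I / u\<^sup>2)"
        using u by (simp add: emeasure_eq_measure field_simps ennreal_leI)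
    qed
    finally show ?thesis .
  qed
  show ?thesis
  proof (rule ennreal_le_epsilon)
    fix e :: real assume e: "0 < e"
    define a where "a = sqrt ?I + e / 3"
    have a: "0 < a" using e I0 by (simp add: a_def add_nonneg_pos)
    have "?I = (sqrt ?I)\<^sup>2" using I0 by simp
    also have "\<dots> \<le> a\<^sup>2" using e I0 by (intro power_mono) (auto simp: a_def)
    finally have le: "?I \<le> a\<^sup>2" .
    have "(\<integral>\<^sup>+\<omega>. orbit_max h q \<omega> \<partial>M) \<le> ennreal (3 * a)"
    proof (rule nn_integral_le_of_weak_type[OF _ a])
      fix u :: real assume "0 < u"
      then show "emeasure M {x \<in> space M. ennreal u < orbit_max h q x} \<le> ennreal (a\<^sup>2 / u\<^sup>2)"
        by (intro order_trans[OF weak] ennreal_leI divide_right_mono le) auto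
    qed measurable
    also have "\<dots> = ennreal (3 * sqrt ?I) + ennreal e"
      using e I0 by (simp add: a_def ennreal_plus[symmetric] del: ennreal_plus)
    finally show "(\<integral>\<^sup>+\<omega>. orbit_max h q \<omega> \<partial>M) \<le> ennreal (3 * sqrt ?I) + ennreal e" .
  qed
qed

end

section \<open>Dyadic martingale decomposition of twisted sums\<close>

lemma borel_measurable_cnj [measurable (raw)]:
  assumes "f \<in> borel_measurable M"
  shows "(\<lambda>x. cnj (f x)) \<in> borel_measurable M"
  by (rule measurable_compose[OF assms borel_measurable_continuous_onI]) (intro continuous_intros)

lemma integrable_mult_cnj:
  fixes a b :: "'a \<Rightarrow> complex"
  assumes "square_integrable M a" "square_integrable M b"
  shows "integrable M (\<lambda>x. a x * cnj (b x))"
proof (rule Bochner_Integration.integrable_bound[OF integrable_norm_mult[OF assms]])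
  note [measurable] = square_integrableD(1)[OF assms(1)] square_integrableD(1)[OF assms(2)]
  show "(\<lambda>x. a x * cnj (b x)) \<in> borel_measurable M" by measurable
qed (auto simp: norm_mult)

lemma cmod_add_power2: "(cmod (a + b))\<^sup>2 = (cmod a)\<^sup>2 + (cmod b)\<^sup>2 + 2 * Re (a * cnj b)"
  unfolding cmod_power2 by (simp add: power2_eq_square algebra_simps)

lemma sum_pair_up:
  fixes a :: "nat \<Rightarrow> 'b::comm_monoid_add"
  shows "(\<Sum>l<m. a l) = (\<Sum>l<m div 2. a (2 * l) + a (2 * l + 1)) + (if odd m then a (m - 1) else 0)"
proof -
  have ev: "(\<Sum>l<2 * k. a l) = (\<Sum>l<k. a (2 * l) + a (2 * l + 1))" for k
    by (induction k) (auto simp: add.assoc)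
  show ?thesis
  proof (cases "even m")
    case True
    then show ?thesis using ev[of "m div 2"] by simp
  next
    case False
    then obtain k where "m = Suc (2 * k)" by (auto elim: oddE)
    then show ?thesis using ev[of k] by simp
  qed
qed

text \<open>Halving \<open>m\<close> costs a factor \<open>1 / sqrt 2\<close> in the square root, which is where the geometric weights come from.\<close>

lemma dyadic_recursion:
  fixes r :: "nat \<Rightarrow> nat \<Rightarrow> real" and G :: "nat \<Rightarrow> real"
  assumes rec: "\<And>j m. 0 < m \<Longrightarrow> r j m \<le> 2 * sqrt (real m) * G j + r (Suc j) (m div 2)"
    and zero: "\<And>j. r j 0 = 0" and G: "\<And>j. 0 \<le> G j"
    and sm: "summable (\<lambda>j. (1 / sqrt 2) ^ j * G j)"
  shows "r 0 n \<le> 2 * sqrt (real n) * (\<Sum>j. (1 / sqrt 2) ^ j * G j)"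
proof -
  let ?q = "1 / sqrt 2 :: real"
  have *: "r j m \<le> 2 * sqrt (real m) * (\<Sum>i<k. ?q ^ i * G (i + j))" if "m < 2 ^ k" for j m k
    using that
  proof (induction k arbitrary: j m)
    case 0
    then show ?case by (simp add: zero)
  next
    case (Suc k)
    show ?case
    proof (cases "m = 0")
      case False
      let ?s = "\<Sum>i<k. ?q ^ i * G (i + Suc j)"
      have s0: "0 \<le> ?s" by (intro sum_nonneg mult_nonneg_nonneg G) auto
      have "real (m div 2) \<le> real m / 2" by simp
      then have "sqrt (real (m div 2)) \<le> sqrt (real m) * ?q"
        using real_sqrt_le_mono[of "real (m div 2)" "real m / 2"] by (simp add: real_sqrt_divide)
      then have "2 * sqrt (real (m div 2)) * ?s \<le> 2 * (sqrt (real m) * ?q) * ?s"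
        using s0 by (intro mult_right_mono) auto
      moreover have "r (Suc j) (m div 2) \<le> 2 * sqrt (real (m div 2)) * ?s"
        using Suc.prems by (intro Suc.IH) auto
      moreover have "r j m \<le> 2 * sqrt (real m) * G j + r (Suc j) (m div 2)"
        using False by (intro rec) auto
      moreover have "(\<Sum>i<Suc k. ?q ^ i * G (i + j)) = G j + ?q * ?s"
        by (simp add: sum.lessThan_Suc_shift sum_distrib_left mult.assoc del: sum.lessThan_Suc)
      ultimately show ?thesis by (simp add: algebra_simps)
    qed (simp add: zero)
  qed
  have "n < 2 ^ n" by (rule less_exp)
  from *[OF this, of 0] have "r 0 n \<le> 2 * sqrt (real n) * (\<Sum>i<n. ?q ^ i * G i)" by simp
  also have "\<dots> \<le> 2 * sqrt (real n) * (\<Sum>j. ?q ^ j * G j)"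
    by (intro mult_left_mono sum_le_suminf sm mult_nonneg_nonneg G) auto
  finally show ?thesis .
qed

context kernel_system begin

lemma cexp_norm_add:
  fixes a b :: "'a \<Rightarrow> complex"
  assumes "square_integrable M a" "square_integrable M b"
  shows "AE \<omega> in M. cexp (\<lambda>x. (cmod (a x + b x))\<^sup>2) \<omega> =
     cexp (\<lambda>x. (cmod (a x))\<^sup>2) \<omega> + cexp (\<lambda>x. (cmod (b x))\<^sup>2) \<omega> + 2 * Re (cexp (\<lambda>x. a x * cnj (b x)) \<omega>)"
  using kernel_integrable[OF square_integrableD(2)[OF assms(1)]]
    kernel_integrable[OF square_integrableD(2)[OF assms(2)]]
    kernel_integrable[OF integrable_mult_cnj[OF assms]]
proof eventually_elim
  case (elim \<omega>)
  have i: "integrable (\<kappa> \<omega>) (\<lambda>x. Re (a x * cnj (b x)))" by (rule integrable_Re[OF elim(3)])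
  have "cexp (\<lambda>x. (cmod (a x + b x))\<^sup>2) \<omega> =
     (\<integral>x. (cmod (a x))\<^sup>2 + (cmod (b x))\<^sup>2 + 2 * Re (a x * cnj (b x)) \<partial>\<kappa> \<omega>)"
    unfolding cexp_def cmod_add_power2 ..
  also have "\<dots> = (\<integral>x. (cmod (a x))\<^sup>2 \<partial>\<kappa> \<omega>) + (\<integral>x. (cmod (b x))\<^sup>2 \<partial>\<kappa> \<omega>) + 2 * (\<integral>x. Re (a x * cnj (b x)) \<partial>\<kappa> \<omega>)"
    using elim(1,2) i by (simp del: times_complex.sel)
  also have "(\<integral>x. Re (a x * cnj (b x)) \<partial>\<kappa> \<omega>) = Re (\<integral>x. a x * cnj (b x) \<partial>\<kappa> \<omega>)"
    by (rule integral_Re[OF elim(3)])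
  finally show ?case by (simp add: cexp_def)
qed

text \<open>Centering at the conditional mean decreases the conditional second moment: the cross term equals minus the
  square of the conditional mean.\<close>

lemma cexp_norm_centered_le:
  assumes Y: "square_integrable M Y"
  shows "AE \<omega> in M. cexp (\<lambda>x. (cmod (Y x - cexp Y x))\<^sup>2) \<omega> \<le> cexp (\<lambda>x. (cmod (Y x))\<^sup>2) \<omega>"
proof -
  note [measurable] = square_integrableD(1)[OF Y]
  let ?E = "cexp Y"
  note E = cexp_square_integrable(1)[OF Y]
  have mE: "square_integrable M (\<lambda>x. - ?E x)" using square_integrable_cmult(1)[OF E, of "-1"] by simp
  have i2: "integrable M (\<lambda>x. cnj (?E x) * Y ((T ^^ 0) x))"
    using integrable_mult_cnj[OF Y E] by (simp add: mult.commute)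
  have zm: "(\<lambda>x. cnj (?E x)) \<in> borel_measurable (F_at 0)"
    using F_at_measurable[of "\<lambda>x. cnj (?E x)" 0 0] by simp
  note pull = cexp_pull(2)[OF square_integrable_imp_integrable(1)[OF Y] zm i2]
  have 1: "AE \<omega> in M. cexp (\<lambda>x. (cmod (Y x - ?E x))\<^sup>2) \<omega> = cexp (\<lambda>x. (cmod (Y x))\<^sup>2) \<omega> + cexp (\<lambda>x. (cmod (- ?E x))\<^sup>2) \<omega>
        + 2 * Re (cexp (\<lambda>x. Y x * cnj (- ?E x)) \<omega>)"
    using cexp_norm_add[OF Y mE] by simp
  have 2: "cexp (\<lambda>x. Y x * cnj (- ?E x)) \<omega> = - cexp (\<lambda>x. cnj (?E x) * Y ((T ^^ 0) x)) \<omega>" for \<omega>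
    by (simp add: cexp_def mult.commute)
  have 3: "cexp (\<lambda>x. cnj (?E x) * ?E ((T ^^ 0) x)) \<omega> = complex_of_real (cexp (\<lambda>x. (cmod (?E x))\<^sup>2) \<omega>)" for \<omega>
  proof -
    have *: "cnj z * z = complex_of_real ((cmod z)\<^sup>2)" for z
      by (simp only: complex_norm_square mult.commute)
    have "cexp (\<lambda>x. cnj (?E x) * ?E ((T ^^ 0) x)) \<omega> = (\<integral>x. complex_of_real ((cmod (?E x))\<^sup>2) \<partial>\<kappa> \<omega>)"
      unfolding cexp_def[of "\<lambda>x. cnj (?E x) * ?E ((T ^^ 0) x)"] by (simp only: * funpow_0)
    also have "\<dots> = complex_of_real (cexp (\<lambda>x. (cmod (?E x))\<^sup>2) \<omega>)"
      unfolding cexp_def[of "\<lambda>x. (cmod (?E x))\<^sup>2"] by (rule integral_complex_of_real)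
    finally show ?thesis .
  qed
  have 4: "0 \<le> cexp (\<lambda>x. (cmod (?E x))\<^sup>2) \<omega>" for \<omega>
    unfolding cexp_def[of "\<lambda>x. (cmod (?E x))\<^sup>2"] by (rule Bochner_Integration.integral_nonneg) simp
  show ?thesis using pull 1
  proof eventually_elim
    case (elim \<omega>)
    show ?case unfolding elim(2) 2 elim(1) 3 using 4[of \<omega>] by simp
  qed
qed

end

locale twisted_system = kernel_system +
  fixes e :: complex
  assumes norm_e [simp]: "cmod e = 1"
begin

definition koop :: "nat \<Rightarrow> ('a \<Rightarrow> complex) \<Rightarrow> 'a \<Rightarrow> complex" where
  "koop k h x = e ^ k * h ((T ^^ k) x)"

lemma koop_koop: "koop j (koop k h) = koop (j + k) h"
  using funpow_add[of k j T] by (auto simp: koop_def fun_eq_iff power_add add.commute)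

lemma koop_0 [simp]: "koop 0 h = h"
  by (simp add: koop_def fun_eq_iff)

lemma koop_add: "koop k (\<lambda>x. f x + g x) x = koop k f x + koop k g x"
  by (simp add: koop_def algebra_simps)

lemma koop_diff: "koop k (\<lambda>x. f x - g x) x = koop k f x - koop k g x"
  by (simp add: koop_def algebra_simps)

lemma cmod_koop [simp]: "cmod (koop k h x) = cmod (h ((T ^^ k) x))"
  by (simp add: koop_def norm_mult norm_power)

lemma koop_measurable: "h \<in> borel_measurable M \<Longrightarrow> koop k h \<in> borel_measurable M"
  unfolding koop_def[abs_def] by (rule borel_measurable_times[OF borel_measurable_const T_pow_measurable_comp])

lemma koop_square_integrable:
  assumes "square_integrable M h"
  shows "square_integrable M (koop k h)" "L2_norm M (koop k h) = L2_norm M h"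
  using square_integrableD[OF assms] integrable_T_pow[OF square_integrableD(2)[OF assms], of k]
     integral_T_pow[of "\<lambda>x. (cmod (h x))\<^sup>2" k]
  by (auto simp: square_integrable_def L2_norm_def koop_measurable)

lemma koop_F_at:
  assumes "h \<in> borel_measurable F" "j \<le> k"
  shows "koop j h \<in> borel_measurable (F_at k)"
  unfolding koop_def[abs_def] by (rule borel_measurable_times[OF borel_measurable_const F_at_measurable[OF assms]])

text \<open>At time \<open>b\<close> the first factor is known, and the second has conditional mean zero.\<close>

lemma cexp_orthogonal:
  assumes h: "square_integrable M h" "h \<in> borel_measurable F"
    and Y: "square_integrable M Y" "AE x in M. cexp Y x = 0" and ab: "a \<le> b"
  shows "AE \<omega> in M. cexp (\<lambda>x. koop a h x * cnj (koop b Y x)) \<omega> = 0"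
proof -
  note [measurable] = square_integrableD(1)[OF h(1)] square_integrableD(1)[OF Y(1)]
  have [measurable]: "koop a h \<in> borel_measurable M" by (rule koop_measurable) measurable
  define z where "z x = koop a h x * cnj (e ^ b)" for x
  have zm: "z \<in> borel_measurable (F_at b)"
    unfolding z_def[abs_def] by (rule borel_measurable_times[OF koop_F_at[OF h(2) ab] borel_measurable_const])
  have eq: "koop a h x * cnj (koop b Y x) = z x * cnj (Y ((T ^^ b) x))" for x
    by (simp add: z_def koop_def[of b])
  have i: "integrable M (\<lambda>x. z x * cnj (Y ((T ^^ b) x)))"
    using integrable_mult_cnj[OF koop_square_integrable(1)[OF h(1), of a] koop_square_integrable(1)[OF Y(1), of b]]
    by (simp add: eq)
  have cY: "cexp (\<lambda>x. cnj (Y x)) \<omega> = cnj (cexp Y \<omega>)" for \<omega>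
    unfolding cexp_def by (rule Bochner_Integration.integral_cnj)
  have iY: "integrable M (\<lambda>x. cnj (Y x))"
    using square_integrable_imp_integrable(1)[OF Y(1)] by simp
  have [measurable]: "z \<in> borel_measurable M" by (rule measurable_from_subalg[OF subalgebra_F_at zm])
  have c0: "AE \<omega> in M. cexp (\<lambda>x. z x * cexp (\<lambda>x. cnj (Y x)) ((T ^^ b) x)) \<omega> = cexp (\<lambda>x. 0) \<omega>"
    by (rule cexp_cong_AE) (use AE_T_pow[OF Y(2), of b] in \<open>auto simp: cY\<close>)
  show ?thesis using cexp_pull(2)[OF iY zm i] c0 by (auto simp: eq)
qed

text \<open>For \<open>h\<close> measurable with respect to \<open>F\<close> this is known at time \<open>q\<close> and has conditional mean zero.\<close>

definition mart_diff :: "nat \<Rightarrow> ('a \<Rightarrow> complex) \<Rightarrow> 'a \<Rightarrow> complex" where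
  "mart_diff q h x = koop q h x - cexp (koop q h) x"

lemma mart_diff_square_integrable:
  assumes "square_integrable M h"
  shows "square_integrable M (mart_diff q h)"
  unfolding mart_diff_def[abs_def]
  by (intro square_integrable_minus cexp_square_integrable koop_square_integrable assms)

lemma cexp_mart_diff:
  assumes "square_integrable M h"
  shows "AE \<omega> in M. cexp (mart_diff q h) \<omega> = 0"
proof -
  note k = koop_square_integrable(1)[OF assms, of q]
  note i = square_integrable_imp_integrable(1)[OF k]
    square_integrable_imp_integrable(1)[OF cexp_square_integrable(1)[OF k]]
  have "AE \<omega> in M. cexp (cexp (koop q h)) \<omega> = cexp (koop q h) \<omega>"
    by (rule cexp_F_measurable[OF i(2)]) (use square_integrableD(1)[OF k] in measurable)
  then show ?thesis using cexp_diff[OF i] by eventually_elim (simp add: mart_diff_def[abs_def])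
qed

lemma cexp_mart_diff_le:
  assumes "square_integrable M h"
  shows "AE \<omega> in M. cexp (\<lambda>x. (cmod (koop s (mart_diff q h) x))\<^sup>2) \<omega> \<le> cexp (\<lambda>x. (cmod (h ((T ^^ (s + q)) x)))\<^sup>2) \<omega>"
proof -
  note k = koop_square_integrable(1)[OF assms, of q]
  note i1 = square_integrableD(2)[OF mart_diff_square_integrable[OF assms, of q]]
  note i2 = square_integrableD(2)[OF k]
  have 1: "AE \<omega> in M. cexp (\<lambda>x. (cmod (mart_diff q h x))\<^sup>2) ((T ^^ s) \<omega>) \<le> cexp (\<lambda>x. (cmod (koop q h x))\<^sup>2) ((T ^^ s) \<omega>)"
    using AE_T_pow[OF cexp_norm_centered_le[OF k]] by (simp only: mart_diff_def)
  note j1 = integrable_T_pow[OF cexp_integral(1)[OF i1], of s]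
  note j2 = integrable_T_pow[OF cexp_integral(1)[OF i2], of s]
  have 2: "AE \<omega> in M. cexp (\<lambda>x. cexp (\<lambda>x. (cmod (mart_diff q h x))\<^sup>2) ((T ^^ s) x)) \<omega>
     \<le> cexp (\<lambda>x. cexp (\<lambda>x. (cmod (koop q h x))\<^sup>2) ((T ^^ s) x)) \<omega>"
    by (rule cexp_mono_AE[OF j1 j2 1])
  have e: "(T ^^ (s + q)) x = (T ^^ q) ((T ^^ s) x)" for x
    using funpow_add[of q s T] by (simp add: add.commute)
  show ?thesis using 2 cexp_tower_real[OF i1, of s] cexp_tower_real[OF i2, of s]
    by eventually_elim (simp add: e)
qed

text \<open>The increments are martingale differences as soon as \<open>q \<le> s\<close>, since the \<open>l\<close>-th one is known at
  time \<open>l * s + q\<close>.\<close>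

definition mart_sum :: "nat \<Rightarrow> nat \<Rightarrow> ('a \<Rightarrow> complex) \<Rightarrow> nat \<Rightarrow> 'a \<Rightarrow> complex" where
  "mart_sum s q h m x = (\<Sum>l<m. koop (l * s) (mart_diff q h) x)"

lemma mart_sum_square_integrable:
  assumes "square_integrable M h"
  shows "square_integrable M (mart_sum s q h m)"
  unfolding mart_sum_def[abs_def] by (intro square_integrable_sum koop_square_integrable mart_diff_square_integrable assms)

lemma cexp_mart_sum_orthogonal:
  assumes h: "square_integrable M h" "h \<in> borel_measurable F" and qs: "q \<le> s"
  shows "AE \<omega> in M. cexp (\<lambda>x. mart_sum s q h m x * cnj (koop (m * s) (mart_diff q h) x)) \<omega> = 0"
proof -
  let ?D = "mart_diff q h"
  note D = mart_diff_square_integrable[OF h(1), of q]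
  note k = koop_square_integrable(1)[OF h(1), of q]
  have hM: "h \<in> borel_measurable M" using h(2) by (rule F_measurable)
    have l: "AE \<omega> in M. \<forall>l\<in>{..<m}. cexp (\<lambda>x. koop (l * s) ?D x * cnj (koop (m * s) ?D x)) \<omega> = 0"
    proof (rule AE_finite_allI)
      fix l assume "l \<in> {..<m}"
      then have lm: "l * s + q \<le> m * s"
        using qs mult_le_mono1[of "Suc l" m s] by auto
      have o1: "AE \<omega> in M. cexp (\<lambda>x. koop (l * s + q) h x * cnj (koop (m * s) ?D x)) \<omega> = 0"
        by (rule cexp_orthogonal[OF h D cexp_mart_diff[OF h(1)] lm])
      have o2: "AE \<omega> in M. cexp (\<lambda>x. koop (l * s) (cexp (koop q h)) x * cnj (koop (m * s) ?D x)) \<omega> = 0"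
        by (rule cexp_orthogonal[OF cexp_square_integrable(1)[OF k] cexp_measurable_F[OF koop_measurable[OF hM]]
              D cexp_mart_diff[OF h(1)] order_trans[OF le_add1 lm]])
      have e: "koop (l * s) ?D x * cnj (koop (m * s) ?D x) =
         koop (l * s + q) h x * cnj (koop (m * s) ?D x) - koop (l * s) (cexp (koop q h)) x * cnj (koop (m * s) ?D x)" for x
        by (subst mart_diff_def[abs_def]) (simp add: koop_diff koop_koop algebra_simps)
      have "AE \<omega> in M. cexp (\<lambda>x. koop (l * s + q) h x * cnj (koop (m * s) ?D x) - koop (l * s) (cexp (koop q h)) x * cnj (koop (m * s) ?D x)) \<omega>
        = cexp (\<lambda>x. koop (l * s + q) h x * cnj (koop (m * s) ?D x)) \<omega> - cexp (\<lambda>x. koop (l * s) (cexp (koop q h)) x * cnj (koop (m * s) ?D x)) \<omega>"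
        by (intro cexp_diff integrable_mult_cnj koop_square_integrable cexp_square_integrable h D)
      then show "AE \<omega> in M. cexp (\<lambda>x. koop (l * s) ?D x * cnj (koop (m * s) ?D x)) \<omega> = 0"
        unfolding e using o1 o2 by eventually_elim simp
    qed simp
    have "AE \<omega> in M. cexp (\<lambda>x. \<Sum>l<m. koop (l * s) ?D x * cnj (koop (m * s) ?D x)) \<omega>
       = (\<Sum>l<m. cexp (\<lambda>x. koop (l * s) ?D x * cnj (koop (m * s) ?D x)) \<omega>)"
      by (rule cexp_sum) (auto intro!: integrable_mult_cnj koop_square_integrable D)
    then show ?thesis using l by eventually_elim (simp add: mart_sum_def sum_distrib_right)
qed

lemma cexp_mart_sum_le:
  assumes h: "square_integrable M h" "h \<in> borel_measurable F" and qs: "q \<le> s"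
  shows "AE \<omega> in M. \<forall>m. cexp (\<lambda>x. (cmod (mart_sum s q h m x))\<^sup>2) \<omega> \<le>
     (\<Sum>l<m. cexp (\<lambda>x. (cmod (h ((T ^^ (l * s + q)) x)))\<^sup>2) \<omega>)"
proof (rule AE_all_countable[THEN iffD2], rule allI)
  fix m
  let ?D = "mart_diff q h"
  note D = mart_diff_square_integrable[OF h(1), of q]
  note cross = cexp_mart_sum_orthogonal[OF h qs]
  show "AE \<omega> in M. cexp (\<lambda>x. (cmod (mart_sum s q h m x))\<^sup>2) \<omega> \<le>
     (\<Sum>l<m. cexp (\<lambda>x. (cmod (h ((T ^^ (l * s + q)) x)))\<^sup>2) \<omega>)"
  proof (induction m)
    case 0
    then show ?case by (simp add: mart_sum_def)
  next
    case (Suc m)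
    have e: "mart_sum s q h (Suc m) x = mart_sum s q h m x + koop (m * s) ?D x" for x
      by (simp add: mart_sum_def)
    show ?case
      using cexp_norm_add[OF mart_sum_square_integrable[OF h(1), of s q m] koop_square_integrable(1)[OF D, of "m * s"]]
        cross[of m] Suc cexp_mart_diff_le[OF h(1), of "m * s" q]
      unfolding e by eventually_elim simp
  qed
qed

text \<open>Up to null sets \<open>block_cexp f j\<close> is the conditional expectation of the first \<open>2\<^sup>j\<close> terms of the twisted
  sum of \<open>f\<close> (\<open>block_cexp_eq_cexp_koop_sum\<close>). The recursive form makes the decomposition below an identity at every point.\<close>

primrec block_cexp :: "('a \<Rightarrow> complex) \<Rightarrow> nat \<Rightarrow> 'a \<Rightarrow> complex" where
  "block_cexp f 0 = cexp (koop 1 f)"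
| "block_cexp f (Suc j) = (\<lambda>x. block_cexp f j x + cexp (koop (2 ^ j) (block_cexp f j)) x)"

lemma block_cexp_square_integrable:
  assumes "square_integrable M f"
  shows "square_integrable M (block_cexp f j)"
  by (induction j) (auto intro!: square_integrable_add cexp_square_integrable koop_square_integrable assms)

lemma block_cexp_measurable_F:
  assumes "f \<in> borel_measurable F"
  shows "block_cexp f j \<in> borel_measurable F"
proof (induction j)
  case 0
  show ?case using cexp_measurable_F[OF koop_measurable[OF F_measurable[OF assms]]] by simp
next
  case (Suc j)
  show ?case using borel_measurable_add[OF Suc cexp_measurable_F[OF koop_measurable[OF F_measurable[OF Suc]]]] by simp
qed

definition koop_sum :: "('a \<Rightarrow> complex) \<Rightarrow> nat \<Rightarrow> 'a \<Rightarrow> complex" where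
  "koop_sum f n x = (\<Sum>k=1..n. koop k f x)"

lemma koop_sum_square_integrable:
  assumes "square_integrable M f"
  shows "square_integrable M (koop_sum f n)"
  unfolding koop_sum_def[abs_def] by (intro square_integrable_sum koop_square_integrable assms)

definition block_sum :: "('a \<Rightarrow> complex) \<Rightarrow> nat \<Rightarrow> nat \<Rightarrow> 'a \<Rightarrow> complex" where
  "block_sum f j m x = (\<Sum>l<m. koop (l * 2 ^ j) (block_cexp f j) x)"

text \<open>The first step separates the innovation of each term from its prediction one time unit earlier.\<close>

lemma koop_sum_decomp: "koop_sum f n x = mart_sum 1 1 f n x + block_sum f 0 n x"
proof -
  have "koop_sum f n x = (\<Sum>l<n. koop (Suc l) f x)"
    unfolding koop_sum_def by (rule sum.reindex_bij_witness[of _ Suc "\<lambda>k. k - 1"]) auto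
  also have "\<dots> = (\<Sum>l<n. koop l (mart_diff 1 f) x + koop l (cexp (koop 1 f)) x)"
    by (rule sum.cong) (auto simp: mart_diff_def[abs_def] koop_diff koop_koop)
  finally show ?thesis by (simp add: mart_sum_def block_sum_def sum.distrib)
qed

text \<open>Consecutive blocks are paired. The prediction of the second block of a pair at the beginning of the pair
  makes up the block of the next scale, the innovation goes to the martingale; an unpaired last block remains.\<close>

lemma block_sum_decomp: "block_sum f j m x = mart_sum (2 ^ Suc j) (2 ^ j) (block_cexp f j) (m div 2) x
   + (if odd m then koop ((m - 1) * 2 ^ j) (block_cexp f j) x else 0) + block_sum f (Suc j) (m div 2) x"
proof -
  let ?h = "block_cexp f j" and ?q = "2 ^ j :: nat"
  have "block_sum f j m x = (\<Sum>l<m div 2. koop (2 * l * ?q) ?h x + koop ((2 * l + 1) * ?q) ?h x)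
      + (if odd m then koop ((m - 1) * ?q) ?h x else 0)"
    unfolding block_sum_def by (rule sum_pair_up)
  also have "(\<Sum>l<m div 2. koop (2 * l * ?q) ?h x + koop ((2 * l + 1) * ?q) ?h x) =
     (\<Sum>l<m div 2. koop (l * 2 ^ Suc j) (mart_diff ?q ?h) x + koop (l * 2 ^ Suc j) (block_cexp f (Suc j)) x)"
  proof (rule sum.cong[OF refl])
    fix l
    have i: "l * 2 ^ Suc j + ?q = (2 * l + 1) * ?q" "l * 2 ^ Suc j = 2 * l * ?q" by auto
    have "koop (l * 2 ^ Suc j) (mart_diff ?q ?h) x = koop ((2 * l + 1) * ?q) ?h x - koop (l * 2 ^ Suc j) (cexp (koop ?q ?h)) x"
      unfolding mart_diff_def[abs_def] koop_diff koop_koop i(1) ..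
    moreover have "koop (l * 2 ^ Suc j) (block_cexp f (Suc j)) x = koop (2 * l * ?q) ?h x + koop (l * 2 ^ Suc j) (cexp (koop ?q ?h)) x"
      unfolding block_cexp.simps(2) koop_add i(2) ..
    ultimately show "koop (2 * l * ?q) ?h x + koop ((2 * l + 1) * ?q) ?h x =
       koop (l * 2 ^ Suc j) (mart_diff ?q ?h) x + koop (l * 2 ^ Suc j) (block_cexp f (Suc j)) x" by simp
  qed
  finally show ?thesis by (simp add: mart_sum_def block_sum_def sum.distrib)
qed

text \<open>The Minkowski summation over the scales. The law \<open>N\<close> is arbitrary because the estimate is used both for \<open>M\<close>
  and for the conditional laws; \<open>G j\<close> bounds the orbit averages at scale \<open>j\<close>.\<close>

lemma koop_sum_norm_le:
  fixes G :: "nat \<Rightarrow> real"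
  assumes sq: "square_integrable N (mart_sum 1 1 f n)" "\<And>j m. square_integrable N (mart_sum (2 ^ Suc j) (2 ^ j) (block_cexp f j) m)"
     "\<And>j k. square_integrable N (koop k (block_cexp f j))"
    and G: "\<And>j. 0 \<le> G j" and sm: "summable (\<lambda>j. (1 / sqrt 2) ^ j * G j)"
    and b0: "L2_norm N (mart_sum 1 1 f n) \<le> 2 * sqrt (real n) * A"
    and b1: "\<And>j m. L2_norm N (mart_sum (2 ^ Suc j) (2 ^ j) (block_cexp f j) (m div 2)) \<le> sqrt (real m) * G j"
    and b2: "\<And>j m. 0 < m \<Longrightarrow> L2_norm N (koop ((m - 1) * 2 ^ j) (block_cexp f j)) \<le> sqrt (real m) * G j"
  shows "L2_norm N (koop_sum f n) \<le> 2 * sqrt (real n) * (A + (\<Sum>j. (1 / sqrt 2) ^ j * G j))"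
proof -
  have r: "square_integrable N (block_sum f j m)" for j m
    unfolding block_sum_def[abs_def] by (intro square_integrable_sum sq)
  have "L2_norm N (block_sum f 0 n) \<le> 2 * sqrt (real n) * (\<Sum>j. (1 / sqrt 2) ^ j * G j)"
  proof (rule dyadic_recursion[OF _ _ G sm])
    show "L2_norm N (block_sum f j 0) = 0" for j by (simp add: block_sum_def[abs_def])
    show "L2_norm N (block_sum f j m) \<le> 2 * sqrt (real m) * G j + L2_norm N (block_sum f (Suc j) (m div 2))" if "0 < m" for j m
    proof -
      define B where "B x = (if odd m then koop ((m - 1) * 2 ^ j) (block_cexp f j) x else 0)" for x
      have B: "square_integrable N B" "L2_norm N B \<le> sqrt (real m) * G j"
        using sq(3)[of "(m - 1) * 2 ^ j" j] b2[OF that, of j] G[of j]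
        unfolding B_def[abs_def] by (cases "odd m"; simp)+
      have e: "block_sum f j m = (\<lambda>x. (mart_sum (2 ^ Suc j) (2 ^ j) (block_cexp f j) (m div 2) x + B x) + block_sum f (Suc j) (m div 2) x)"
        unfolding B_def by (rule ext) (rule block_sum_decomp)
      note s1 = square_integrable_add[OF sq(2)[of j "m div 2"] B(1)]
      show ?thesis
        unfolding e using square_integrable_add(2)[OF s1(1) r[of "Suc j" "m div 2"]] s1(2) b1[of j m] B(2) by simp
    qed
  qed
  moreover have "koop_sum f n = (\<lambda>x. mart_sum 1 1 f n x + block_sum f 0 n x)" by (rule ext) (rule koop_sum_decomp)
  ultimately show ?thesis
    using square_integrable_add(2)[OF sq(1) r[of 0 n]] b0 by (simp add: distrib_left)
qed

section \<open>The Maxwell-Woodroofe norm and its maximal inequality\<close>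

text \<open>The dyadic form of the Maxwell-Woodroofe condition, the norm that belongs to it, and the maximal function
  that dominates the twisted sums under the conditional laws.\<close>

definition MW_summable :: "('a \<Rightarrow> complex) \<Rightarrow> bool" where
  "MW_summable f \<longleftrightarrow> summable (\<lambda>j. (1 / sqrt 2) ^ j * L2_norm M (block_cexp f j))"

definition MW_norm :: "('a \<Rightarrow> complex) \<Rightarrow> real" where
  "MW_norm f = L2_norm M f + (\<Sum>j. (1 / sqrt 2) ^ j * L2_norm M (block_cexp f j))"

definition MW_max :: "('a \<Rightarrow> complex) \<Rightarrow> 'a \<Rightarrow> ennreal" where
  "MW_max f \<omega> = 2 * (orbit_max (\<lambda>x. (cmod (f x))\<^sup>2) 1 \<omega> +
     (\<Sum>j. ennreal ((1 / sqrt 2) ^ j) * orbit_max (\<lambda>x. (cmod (block_cexp f j x))\<^sup>2) (2 ^ j) \<omega>))"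

lemma cmod_power2_measurable:
  "h \<in> borel_measurable N \<Longrightarrow> (\<lambda>x. (cmod (h x))\<^sup>2) \<in> borel_measurable N"
  by measurable

lemma MW_max_measurable:
  assumes "f \<in> borel_measurable F"
  shows "MW_max f \<in> borel_measurable M"
proof -
  have [measurable]: "orbit_max (\<lambda>x. (cmod (f x))\<^sup>2) 1 \<in> borel_measurable M"
    "\<And>j. orbit_max (\<lambda>x. (cmod (block_cexp f j x))\<^sup>2) (2 ^ j) \<in> borel_measurable M"
    by (intro orbit_max_measurable cmod_power2_measurable F_measurable block_cexp_measurable_F assms)+
  show ?thesis unfolding MW_max_def[abs_def] by measurable
qed

lemma nn_integral_orbit_max_L2:
  assumes "square_integrable M h" "h \<in> borel_measurable F"
  shows "(\<integral>\<^sup>+\<omega>. orbit_max (\<lambda>x. (cmod (h x))\<^sup>2) q \<omega> \<partial>M) \<le> ennreal (3 * L2_norm M h)"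
  unfolding L2_norm_def
  by (rule nn_integral_orbit_max_le[OF square_integrableD(2)[OF assms(1)] cmod_power2_measurable[OF assms(2)]]) simp

lemma nn_integral_MW_max:
  assumes f: "square_integrable M f" "f \<in> borel_measurable F" and mw: "MW_summable f"
  shows "(\<integral>\<^sup>+\<omega>. MW_max f \<omega> \<partial>M) \<le> ennreal (6 * MW_norm f)"
proof -
  note h = block_cexp_square_integrable[OF f(1)] block_cexp_measurable_F[OF f(2)]
  have [measurable]: "orbit_max (\<lambda>x. (cmod (f x))\<^sup>2) 1 \<in> borel_measurable M"
    "\<And>j. orbit_max (\<lambda>x. (cmod (block_cexp f j x))\<^sup>2) (2 ^ j) \<in> borel_measurable M"
    by (intro orbit_max_measurable cmod_power2_measurable F_measurable block_cexp_measurable_F f)+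
  let ?s = "\<lambda>j. (1 / sqrt 2) ^ j * L2_norm M (block_cexp f j)"
  have "(\<integral>\<^sup>+\<omega>. MW_max f \<omega> \<partial>M) = 2 * ((\<integral>\<^sup>+\<omega>. orbit_max (\<lambda>x. (cmod (f x))\<^sup>2) 1 \<omega> \<partial>M) +
     (\<Sum>j. ennreal ((1 / sqrt 2) ^ j) * (\<integral>\<^sup>+\<omega>. orbit_max (\<lambda>x. (cmod (block_cexp f j x))\<^sup>2) (2 ^ j) \<omega> \<partial>M)))"
    unfolding MW_max_def by (simp add: nn_integral_cmult nn_integral_add nn_integral_suminf del: distrib_left_numeral One_nat_def)
  also have "\<dots> \<le> 2 * (ennreal (3 * L2_norm M f) + (\<Sum>j. ennreal ((1 / sqrt 2) ^ j) * ennreal (3 * L2_norm M (block_cexp f j))))"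
    by (intro mult_left_mono add_mono suminf_le nn_integral_orbit_max_L2 f h) auto
  also have "(\<Sum>j. ennreal ((1 / sqrt 2) ^ j) * ennreal (3 * L2_norm M (block_cexp f j))) = (\<Sum>j. ennreal (3 * ?s j))"
    by (intro suminf_cong) (simp add: ennreal_mult[symmetric] mult_ac)
  also have "\<dots> = ennreal (\<Sum>j. 3 * ?s j)"
    using mw by (intro suminf_ennreal2) (auto simp: MW_summable_def intro!: summable_mult)
  also have "(\<Sum>j. 3 * ?s j) = 3 * (\<Sum>j. ?s j)"
    using mw by (intro suminf_mult) (simp add: MW_summable_def)
  also have "2 * (ennreal (3 * L2_norm M f) + ennreal (3 * (\<Sum>j. ?s j))) = ennreal (6 * MW_norm f)"
  proof -
    have "0 \<le> (\<Sum>j. ?s j)" using mw by (intro suminf_nonneg) (auto simp: MW_summable_def)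
    then have "ennreal (3 * L2_norm M f) + ennreal (3 * (\<Sum>j. ?s j)) = ennreal (3 * MW_norm f)"
      by (simp add: MW_norm_def ennreal_plus[symmetric] distrib_left del: ennreal_plus)
    moreover have "2 * ennreal (3 * MW_norm f) = ennreal (2 * (3 * MW_norm f))"
      by (subst ennreal_mult'') (auto simp: MW_norm_def \<open>0 \<le> (\<Sum>j. ?s j)\<close>)
    ultimately show ?thesis by simp
  qed
  finally show ?thesis .
qed

end

lemma summable_of_suminf_ennreal:
  fixes a :: "nat \<Rightarrow> real" and u :: "nat \<Rightarrow> ennreal"
  assumes a: "\<And>j. 0 < a j" and fin: "(\<Sum>j. ennreal (a j) * u j) \<noteq> top"
  shows "\<And>j. u j \<noteq> top" "summable (\<lambda>j. a j * enn2real (u j))"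
    "(\<Sum>j. ennreal (a j) * u j) = ennreal (\<Sum>j. a j * enn2real (u j))"
proof -
  show 1: "u j \<noteq> top" for j
  proof
    assume "u j = top"
    then have "ennreal (a j) * u j = top" using a[of j] by (simp add: ennreal_mult_top)
    moreover have "ennreal (a j) * u j \<le> (\<Sum>j. ennreal (a j) * u j)"
      using sum_le_suminf[of "\<lambda>j. ennreal (a j) * u j" "{j}"] by auto
    ultimately show False using fin by (simp add: top_unique)
  qed
  have e: "ennreal (a j) * u j = ennreal (a j * enn2real (u j))" for j
    using 1[of j] a[of j] by (simp add: ennreal_mult less_top)
  have nn: "0 \<le> a j * enn2real (u j)" for j using a[of j] by simp
  show 2: "summable (\<lambda>j. a j * enn2real (u j))"
    using fin unfolding e by (intro summable_suminf_not_top nn) auto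
  show "(\<Sum>j. ennreal (a j) * u j) = ennreal (\<Sum>j. a j * enn2real (u j))"
    unfolding e by (rule suminf_ennreal2[OF nn 2])
qed

context kernel_system begin

text \<open>Each martingale of the decomposition uses every second term of an orbit only; the others are nonnegative.\<close>

lemma orbit_cexp_even:
  assumes h0: "\<And>x. 0 \<le> h x"
  shows "(\<Sum>l<m. cexp (\<lambda>x. h ((T ^^ (l * (2 * q) + q)) x)) \<omega>) \<le> orbit_cexp h q (2 * m) \<omega>"
proof -
  have nn: "0 \<le> cexp (\<lambda>x. h ((T ^^ k) x)) \<omega>" for k
    unfolding cexp_def by (intro Bochner_Integration.integral_nonneg h0)
  have "orbit_cexp h q (2 * m) \<omega> = (\<Sum>l<m. cexp (\<lambda>x. h ((T ^^ (2 * l * q)) x)) \<omega> + cexp (\<lambda>x. h ((T ^^ ((2 * l + 1) * q)) x)) \<omega>)"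
    unfolding orbit_cexp_def using sum_pair_up[of "\<lambda>l. cexp (\<lambda>x. h ((T ^^ (l * q)) x)) \<omega>" "2 * m"] by simp
  also have "\<dots> \<ge> (\<Sum>l<m. cexp (\<lambda>x. h ((T ^^ (l * (2 * q) + q)) x)) \<omega>)"
  proof (rule sum_mono)
    fix l
    have i: "l * (2 * q) + q = (2 * l + 1) * q" by simp
    show "cexp (\<lambda>x. h ((T ^^ (l * (2 * q) + q)) x)) \<omega> \<le>
      cexp (\<lambda>x. h ((T ^^ (2 * l * q)) x)) \<omega> + cexp (\<lambda>x. h ((T ^^ ((2 * l + 1) * q)) x)) \<omega>"
      unfolding i using nn[of "2 * l * q"] by simp
  qed
  finally show ?thesis .
qed

lemma orbit_cexp_shift:
  assumes h0: "\<And>x. 0 \<le> h x"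
  shows "(\<Sum>l<m. cexp (\<lambda>x. h ((T ^^ (l * 1 + 1)) x)) \<omega>) \<le> orbit_cexp h 1 (Suc m) \<omega>"
proof -
  have nn: "0 \<le> cexp (\<lambda>x. h ((T ^^ k) x)) \<omega>" for k
    unfolding cexp_def by (intro Bochner_Integration.integral_nonneg h0)
  show ?thesis
    unfolding orbit_cexp_def using nn[of 0] by (subst sum.lessThan_Suc_shift) simp
qed

lemma orbit_cexp_single:
  assumes h0: "\<And>x. 0 \<le> h x" and "0 < m"
  shows "cexp (\<lambda>x. h ((T ^^ ((m - 1) * q)) x)) \<omega> \<le> orbit_cexp h q m \<omega>"
proof -
  have nn: "0 \<le> cexp (\<lambda>x. h ((T ^^ k) x)) \<omega>" for k
    unfolding cexp_def by (intro Bochner_Integration.integral_nonneg h0)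
  show ?thesis unfolding orbit_cexp_def
    using assms(2) nn by (intro member_le_sum[of "m - 1" "{..<m}" "\<lambda>l. cexp (\<lambda>x. h ((T ^^ (l * q)) x)) \<omega>"]) auto
qed

lemma sqrt_orbit_cexp_le:
  assumes "orbit_max h q \<omega> \<noteq> top"
  shows "sqrt (orbit_cexp h q m \<omega>) \<le> sqrt (real m) * enn2real (orbit_max h q \<omega>)"
proof -
  have "ennreal (sqrt (orbit_cexp h q m \<omega>)) \<le> ennreal (sqrt (real m) * enn2real (orbit_max h q \<omega>))"
    using orbit_max_ge[of h q m \<omega>] assms by (simp add: ennreal_mult less_top)
  then show ?thesis by (subst (asm) ennreal_le_iff) auto
qed

end

context twisted_system begin

text \<open>The quenched maximal inequality: at almost every \<open>\<omega>\<close> all the norms are controlled by one number.\<close>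

lemma kernel_koop_sum_le:
  assumes f: "square_integrable M f" "f \<in> borel_measurable F"
  shows "AE \<omega> in M. MW_max f \<omega> \<noteq> top \<longrightarrow>
     (\<forall>n. L2_norm (\<kappa> \<omega>) (koop_sum f n) \<le> sqrt (real n) * enn2real (MW_max f \<omega>))"
proof -
  note h = block_cexp_square_integrable[OF f(1)] block_cexp_measurable_F[OF f(2)]
  have a1: "AE \<omega> in M. \<forall>m. cexp (\<lambda>x. (cmod (mart_sum 1 1 f m x))\<^sup>2) \<omega> \<le>
     (\<Sum>l<m. cexp (\<lambda>x. (cmod (f ((T ^^ (l * 1 + 1)) x)))\<^sup>2) \<omega>)"
    by (rule cexp_mart_sum_le[OF f]) simp
  have a2: "AE \<omega> in M. \<forall>j m. cexp (\<lambda>x. (cmod (mart_sum (2 * 2 ^ j) (2 ^ j) (block_cexp f j) m x))\<^sup>2) \<omega> \<le>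
     (\<Sum>l<m. cexp (\<lambda>x. (cmod (block_cexp f j ((T ^^ (l * (2 * 2 ^ j) + 2 ^ j)) x)))\<^sup>2) \<omega>)"
    by (rule AE_all_countable[THEN iffD2], rule allI, rule cexp_mart_sum_le[OF h]) simp
  have a3: "AE \<omega> in M. \<forall>m. square_integrable (\<kappa> \<omega>) (mart_sum 1 1 f m)"
    by (rule AE_all_countable[THEN iffD2], rule allI, rule kernel_square_integrable, rule mart_sum_square_integrable[OF f(1)])
  have a4: "AE \<omega> in M. \<forall>j m. square_integrable (\<kappa> \<omega>) (mart_sum (2 ^ Suc j) (2 ^ j) (block_cexp f j) m)"
    by (rule AE_all_countable[THEN iffD2], rule allI, rule AE_all_countable[THEN iffD2], rule allI,
       rule kernel_square_integrable, rule mart_sum_square_integrable[OF h(1)])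
  have a5: "AE \<omega> in M. \<forall>j k. square_integrable (\<kappa> \<omega>) (koop k (block_cexp f j))"
    by (rule AE_all_countable[THEN iffD2], rule allI, rule AE_all_countable[THEN iffD2], rule allI,
       rule kernel_square_integrable, rule koop_square_integrable[OF h(1)])
  show ?thesis using a1 a2 a3 a4 a5
  proof (eventually_elim, intro impI allI)
    fix \<omega> n
    assume b1: "\<forall>m. cexp (\<lambda>x. (cmod (mart_sum 1 1 f m x))\<^sup>2) \<omega> \<le>
       (\<Sum>l<m. cexp (\<lambda>x. (cmod (f ((T ^^ (l * 1 + 1)) x)))\<^sup>2) \<omega>)"
      and b2: "\<forall>j m. cexp (\<lambda>x. (cmod (mart_sum (2 * 2 ^ j) (2 ^ j) (block_cexp f j) m x))\<^sup>2) \<omega> \<le>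
       (\<Sum>l<m. cexp (\<lambda>x. (cmod (block_cexp f j ((T ^^ (l * (2 * 2 ^ j) + 2 ^ j)) x)))\<^sup>2) \<omega>)"
      and b3: "\<forall>m. square_integrable (\<kappa> \<omega>) (mart_sum 1 1 f m)"
      and b4: "\<forall>j m. square_integrable (\<kappa> \<omega>) (mart_sum (2 ^ Suc j) (2 ^ j) (block_cexp f j) m)"
      and b5: "\<forall>j k. square_integrable (\<kappa> \<omega>) (koop k (block_cexp f j))"
      and fin: "MW_max f \<omega> \<noteq> top"
    let ?fm = "orbit_max (\<lambda>x. (cmod (f x))\<^sup>2) 1 \<omega>"
    let ?hm = "\<lambda>j. orbit_max (\<lambda>x. (cmod (block_cexp f j x))\<^sup>2) (2 ^ j) \<omega>"
    have fin1: "?fm \<noteq> top" and fin2: "(\<Sum>j. ennreal ((1 / sqrt 2) ^ j) * ?hm j) \<noteq> top"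
      using fin by (auto simp: MW_max_def ennreal_mult_eq_top_iff)
    note S = summable_of_suminf_ennreal[of "\<lambda>j. (1 / sqrt 2) ^ j" ?hm, OF _ fin2]
    define G where "G j = enn2real (?hm j)" for j
    have hm: "?hm j \<noteq> top" for j using S(1) by simp
    have sm: "summable (\<lambda>j. (1 / sqrt 2) ^ j * G j)" using S(2) by (simp add: G_def)
    have L: "L2_norm (\<kappa> \<omega>) u = sqrt (cexp (\<lambda>x. (cmod (u x))\<^sup>2) \<omega>)" for u :: "'a \<Rightarrow> complex"
      by (simp add: L2_norm_def cexp_def)
    have "L2_norm (\<kappa> \<omega>) (koop_sum f n) \<le> 2 * sqrt (real n) * (enn2real ?fm + (\<Sum>j. (1 / sqrt 2) ^ j * G j))"
    proof (rule koop_sum_norm_le)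
      show "square_integrable (\<kappa> \<omega>) (mart_sum 1 1 f n)" using b3 by blast
      show "square_integrable (\<kappa> \<omega>) (mart_sum (2 ^ Suc j) (2 ^ j) (block_cexp f j) m)" for j m using b4 by blast
      show "square_integrable (\<kappa> \<omega>) (koop k (block_cexp f j))" for j k using b5 by blast
      show "0 \<le> G j" for j by (simp add: G_def)
      show "summable (\<lambda>j. (1 / sqrt 2) ^ j * G j)" by (rule sm)
      show "L2_norm (\<kappa> \<omega>) (mart_sum 1 1 f n) \<le> 2 * sqrt (real n) * enn2real ?fm"
      proof (cases "n = 0")
        case True
        then show ?thesis by (simp add: mart_sum_def[abs_def])
      next
        case False
        have "L2_norm (\<kappa> \<omega>) (mart_sum 1 1 f n) \<le> sqrt (orbit_cexp (\<lambda>x. (cmod (f x))\<^sup>2) 1 (Suc n) \<omega>)"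
          unfolding L by (intro real_sqrt_le_mono order_trans[OF b1[rule_format] orbit_cexp_shift]) simp
        also have "\<dots> \<le> sqrt (real (Suc n)) * enn2real ?fm" by (rule sqrt_orbit_cexp_le[OF fin1])
        also have "sqrt (real (Suc n)) \<le> sqrt (4 * real n)" using False by (intro real_sqrt_le_mono) simp
        then have "sqrt (real (Suc n)) * enn2real ?fm \<le> 2 * sqrt (real n) * enn2real ?fm"
          by (intro mult_right_mono) (simp_all add: real_sqrt_mult)
        finally show ?thesis .
      qed
      show "L2_norm (\<kappa> \<omega>) (mart_sum (2 ^ Suc j) (2 ^ j) (block_cexp f j) (m div 2)) \<le> sqrt (real m) * G j" for j m
      proof -
        have "L2_norm (\<kappa> \<omega>) (mart_sum (2 * 2 ^ j) (2 ^ j) (block_cexp f j) (m div 2)) \<le>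
           sqrt (orbit_cexp (\<lambda>x. (cmod (block_cexp f j x))\<^sup>2) (2 ^ j) (2 * (m div 2)) \<omega>)"
          unfolding L by (intro real_sqrt_le_mono order_trans[OF b2[rule_format] orbit_cexp_even]) simp
        also have "\<dots> \<le> sqrt (real (2 * (m div 2))) * G j" unfolding G_def by (rule sqrt_orbit_cexp_le[OF hm])
        also have "\<dots> \<le> sqrt (real m) * G j"
        proof (rule mult_right_mono)
          have "2 * (m div 2) \<le> m" by simp
          then show "sqrt (real (2 * (m div 2))) \<le> sqrt (real m)" by (intro real_sqrt_le_mono) (simp only: of_nat_le_iff)
        qed (simp add: G_def)
        finally show ?thesis by simp
      qed
      show "L2_norm (\<kappa> \<omega>) (koop ((m - 1) * 2 ^ j) (block_cexp f j)) \<le> sqrt (real m) * G j" if "0 < m" for j m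
      proof -
        have "L2_norm (\<kappa> \<omega>) (koop ((m - 1) * 2 ^ j) (block_cexp f j)) \<le>
           sqrt (orbit_cexp (\<lambda>x. (cmod (block_cexp f j x))\<^sup>2) (2 ^ j) m \<omega>)"
          unfolding L cmod_koop by (intro real_sqrt_le_mono orbit_cexp_single that) simp
        also have "\<dots> \<le> sqrt (real m) * G j" unfolding G_def by (rule sqrt_orbit_cexp_le[OF hm])
        finally show ?thesis .
      qed
    qed
    also have "2 * sqrt (real n) * (enn2real ?fm + (\<Sum>j. (1 / sqrt 2) ^ j * G j)) = sqrt (real n) * enn2real (MW_max f \<omega>)"
    proof -
      have s0: "0 \<le> (\<Sum>j. (1 / sqrt 2) ^ j * G j)" by (rule suminf_nonneg[OF sm]) (simp add: G_def)
      have "?fm = ennreal (enn2real ?fm)" using fin1 by (simp add: less_top)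
      moreover have "(\<Sum>j. ennreal ((1 / sqrt 2) ^ j) * ?hm j) = ennreal (\<Sum>j. (1 / sqrt 2) ^ j * G j)"
        using S(3) by (simp add: G_def)
      ultimately have "MW_max f \<omega> = 2 * (ennreal (enn2real ?fm) + ennreal (\<Sum>j. (1 / sqrt 2) ^ j * G j))"
        unfolding MW_max_def by simp
      also have "\<dots> = ennreal (2 * (enn2real ?fm + (\<Sum>j. (1 / sqrt 2) ^ j * G j)))"
        using s0 by (subst ennreal_mult) (auto simp: ennreal_plus)
      finally have e: "MW_max f \<omega> = ennreal (2 * (enn2real ?fm + (\<Sum>j. (1 / sqrt 2) ^ j * G j)))" .
      have "enn2real (MW_max f \<omega>) = 2 * (enn2real ?fm + (\<Sum>j. (1 / sqrt 2) ^ j * G j))"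
        unfolding e by (rule enn2real_ennreal) (use s0 in auto)
      then show ?thesis by simp
    qed
    finally show "L2_norm (\<kappa> \<omega>) (koop_sum f n) \<le> sqrt (real n) * enn2real (MW_max f \<omega>)" .
  qed
qed

lemma L2_norm_mart_sum_le:
  assumes h: "square_integrable M h" "h \<in> borel_measurable F" and qs: "q \<le> s"
  shows "L2_norm M (mart_sum s q h m) \<le> sqrt (real m) * L2_norm M h"
proof -
  note ms = square_integrableD(2)[OF mart_sum_square_integrable[OF h(1), of s q m]]
  note hi = square_integrableD(2)[OF h(1)]
  have hm: "(\<lambda>x. (cmod (h x))\<^sup>2) \<in> borel_measurable M" using hi by auto
  have i: "integrable M (cexp (\<lambda>x. (cmod (h ((T ^^ k) x)))\<^sup>2))"
    and ie: "(\<integral>\<omega>. cexp (\<lambda>x. (cmod (h ((T ^^ k) x)))\<^sup>2) \<omega> \<partial>M) = (L2_norm M h)\<^sup>2" for k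
    using cexp_integral[OF integrable_T_pow[OF hi, of k]] integral_T_pow[OF hm, of k] by (auto simp: L2_norm_power2)
  have "(L2_norm M (mart_sum s q h m))\<^sup>2 = (\<integral>\<omega>. cexp (\<lambda>x. (cmod (mart_sum s q h m x))\<^sup>2) \<omega> \<partial>M)"
    unfolding L2_norm_power2 by (rule cexp_integral(2)[OF ms, symmetric])
  also have "\<dots> \<le> (\<integral>\<omega>. (\<Sum>l<m. cexp (\<lambda>x. (cmod (h ((T ^^ (l * s + q)) x)))\<^sup>2) \<omega>) \<partial>M)"
    using cexp_mart_sum_le[OF h qs] by (intro integral_mono_AE cexp_integral(1)[OF ms] Bochner_Integration.integrable_sum i) auto
  also have "\<dots> = (\<Sum>l<m. (\<integral>\<omega>. cexp (\<lambda>x. (cmod (h ((T ^^ (l * s + q)) x)))\<^sup>2) \<omega> \<partial>M))"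
    by (rule Bochner_Integration.integral_sum) (rule i)
  also have "\<dots> = real m * (L2_norm M h)\<^sup>2" by (simp add: ie)
  also have "\<dots> = (sqrt (real m) * L2_norm M h)\<^sup>2" by (simp add: power_mult_distrib)
  finally show ?thesis by (rule power2_le_imp_le) simp
qed

lemma L2_norm_mart_sum_eq:
  assumes h: "square_integrable M h" "h \<in> borel_measurable F" and qs: "q \<le> s"
  shows "(L2_norm M (mart_sum s q h m))\<^sup>2 = real m * (L2_norm M (mart_diff q h))\<^sup>2"
proof (induction m)
  case 0
  then show ?case by (simp add: mart_sum_def[abs_def])
next
  case (Suc m)
  let ?k = "koop (m * s) (mart_diff q h)"
  note ms = mart_sum_square_integrable[OF h(1), of s q m]
  note k = koop_square_integrable[OF mart_diff_square_integrable[OF h(1), of q], of "m * s"]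
  have e: "mart_sum s q h (Suc m) = (\<lambda>x. mart_sum s q h m x + ?k x)" by (simp add: mart_sum_def[abs_def])
  note i = square_integrableD(2)[OF ms] square_integrableD(2)[OF k(1)]
  note ii = square_integrableD(2)[OF square_integrable_add(1)[OF ms k(1)]]
  have ae: "AE \<omega> in M. cexp (\<lambda>x. (cmod (mart_sum s q h m x + ?k x))\<^sup>2) \<omega> =
     cexp (\<lambda>x. (cmod (mart_sum s q h m x))\<^sup>2) \<omega> + cexp (\<lambda>x. (cmod (?k x))\<^sup>2) \<omega>"
    using cexp_norm_add[OF ms k(1)] cexp_mart_sum_orthogonal[OF h qs, of m] by eventually_elim simp
  have "(L2_norm M (mart_sum s q h (Suc m)))\<^sup>2 = (\<integral>\<omega>. cexp (\<lambda>x. (cmod (mart_sum s q h m x + ?k x))\<^sup>2) \<omega> \<partial>M)"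
    unfolding L2_norm_power2 e by (rule cexp_integral(2)[OF ii, symmetric])
  also have "\<dots> = (\<integral>\<omega>. cexp (\<lambda>x. (cmod (mart_sum s q h m x))\<^sup>2) \<omega> + cexp (\<lambda>x. (cmod (?k x))\<^sup>2) \<omega> \<partial>M)"
    using borel_measurable_integrable[OF cexp_integral(1)[OF ii]] borel_measurable_integrable[OF cexp_integral(1)[OF i(1)]]
      borel_measurable_integrable[OF cexp_integral(1)[OF i(2)]] by (intro integral_cong_AE ae borel_measurable_add)
  also have "\<dots> = (L2_norm M (mart_sum s q h m))\<^sup>2 + (L2_norm M ?k)\<^sup>2"
    using cexp_integral[OF i(1)] cexp_integral[OF i(2)] unfolding L2_norm_power2 by simp
  finally show ?case using Suc by (simp add: k(2) distrib_right)
qed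

lemma L2_norm_koop_sum_le:
  assumes f: "square_integrable M f" "f \<in> borel_measurable F" and mw: "MW_summable f"
  shows "L2_norm M (koop_sum f n) \<le> 2 * sqrt (real n) * MW_norm f"
  unfolding MW_norm_def
proof (rule koop_sum_norm_le)
  note h = block_cexp_square_integrable[OF f(1)] block_cexp_measurable_F[OF f(2)]
  show "square_integrable M (mart_sum 1 1 f n)" by (rule mart_sum_square_integrable[OF f(1)])
  show "square_integrable M (mart_sum (2 ^ Suc j) (2 ^ j) (block_cexp f j) m)" for j m by (rule mart_sum_square_integrable[OF h(1)])
  show "square_integrable M (koop k (block_cexp f j))" for j k by (rule koop_square_integrable[OF h(1)])
  show "summable (\<lambda>j. (1 / sqrt 2) ^ j * L2_norm M (block_cexp f j))" using mw by (simp add: MW_summable_def)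
  have "L2_norm M (mart_sum 1 1 f n) \<le> sqrt (real n) * L2_norm M f" by (rule L2_norm_mart_sum_le[OF f]) simp
  also have "\<dots> \<le> 2 * sqrt (real n) * L2_norm M f" by (intro mult_right_mono) auto
  finally show "L2_norm M (mart_sum 1 1 f n) \<le> 2 * sqrt (real n) * L2_norm M f" .
  show "L2_norm M (mart_sum (2 ^ Suc j) (2 ^ j) (block_cexp f j) (m div 2)) \<le> sqrt (real m) * L2_norm M (block_cexp f j)" for j m
  proof -
    have "L2_norm M (mart_sum (2 ^ Suc j) (2 ^ j) (block_cexp f j) (m div 2)) \<le> sqrt (real (m div 2)) * L2_norm M (block_cexp f j)"
      by (rule L2_norm_mart_sum_le[OF h]) simp
    also have "\<dots> \<le> sqrt (real m) * L2_norm M (block_cexp f j)" by (intro mult_right_mono) auto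
    finally show ?thesis .
  qed
  show "L2_norm M (koop ((m - 1) * 2 ^ j) (block_cexp f j)) \<le> sqrt (real m) * L2_norm M (block_cexp f j)" if "0 < m" for j m
  proof -
    have "1 * L2_norm M (block_cexp f j) \<le> sqrt (real m) * L2_norm M (block_cexp f j)"
      using that by (intro mult_right_mono) auto
    then show ?thesis using koop_square_integrable(2)[OF h(1)] by simp
  qed
qed simp

end

section \<open>Dyadic series from the summability condition\<close>

text \<open>Subadditivity bounds \<open>a (4 * N)\<close> by \<open>a k + a (4 * N - k)\<close>. For \<open>N \<le> k < 3 * N\<close> both indices lie in the window
  from \<open>N\<close> to \<open>4 * N\<close>, so averaging over \<open>k\<close> bounds the dyadic term by the part of the given series in that
  window. For dyadic \<open>N\<close> each index lies in at most two windows.\<close>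

lemma dyadic_condensation_subadditive:
  fixes a :: "nat \<Rightarrow> real"
  assumes nn: "\<And>n. 0 \<le> a n" and sub: "\<And>m n. a (m + n) \<le> a m + a n"
    and sm: "summable (\<lambda>j. a (Suc j) / real (Suc j) powr (3 / 2))"
  shows "summable (\<lambda>j. (1 / sqrt 2) ^ j * a (2 ^ j))"
proof -
  define c where "c k = (if k = 0 then 0 else a k / real k powr (3 / 2))" for k
  have c0: "0 \<le> c k" for k using nn by (simp add: c_def)
  have csum: "summable c"
    using sm summable_Suc_iff[of c] by (simp add: c_def)
  define C where "C = (\<Sum>k. c k)"
  have Cle: "(\<Sum>k<n. c k) \<le> C" for n unfolding C_def by (rule sum_le_suminf[OF csum]) (auto simp: c0)
  define s where "s j = (\<Sum>k<2 ^ j. c k)" for j :: nat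
  have step: "(1 / sqrt 2) ^ Suc (Suc i) * a (2 ^ Suc (Suc i)) \<le> 4 * (s (Suc (Suc i)) - s i)" for i
  proof -
    let ?N = "2 ^ i :: nat"
    \<comment> \<open>For \<open>k\<close> in this range both \<open>k\<close> and \<open>4 * ?N - k\<close> lie between \<open>?N\<close> and \<open>3 * ?N\<close>.\<close>
    define K where "K = {?N..<3 * ?N}"
    have fK: "finite K" by (simp add: K_def)
    have "real (card K) * a (4 * ?N) = (\<Sum>k\<in>K. a (4 * ?N))" by simp
    also have "\<dots> \<le> (\<Sum>k\<in>K. a k + a (4 * ?N - k))"
    proof (rule sum_mono)
      fix k assume "k \<in> K"
      then have "k + (4 * ?N - k) = 4 * ?N" by (auto simp: K_def)
      then show "a (4 * ?N) \<le> a k + a (4 * ?N - k)" using sub[of k "4 * ?N - k"] by simp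
    qed
    also have "\<dots> = (\<Sum>k\<in>K. a k) + (\<Sum>k\<in>K. a (4 * ?N - k))" by (rule sum.distrib)
    also have "(\<Sum>k\<in>K. a (4 * ?N - k)) = (\<Sum>k\<in>{Suc ?N..3 * ?N}. a k)"
      by (rule sum.reindex_bij_witness[of _ "\<lambda>k. 4 * ?N - k" "\<lambda>k. 4 * ?N - k"]) (auto simp: K_def)
    also have "\<dots> \<le> (\<Sum>k\<in>{?N..<4 * ?N}. a k)" by (rule sum_mono2) (auto simp: nn)
    also have "(\<Sum>k\<in>K. a k) \<le> (\<Sum>k\<in>{?N..<4 * ?N}. a k)" by (rule sum_mono2) (auto simp: nn K_def)
    finally have 1: "real (2 * ?N) * a (4 * ?N) \<le> 2 * (\<Sum>k\<in>{?N..<4 * ?N}. a k)" by (simp add: K_def)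
    have "(\<Sum>k\<in>{?N..<4 * ?N}. a k) \<le> (\<Sum>k\<in>{?N..<4 * ?N}. real (4 * ?N) powr (3 / 2) * c k)"
    proof (rule sum_mono)
      fix k assume k: "k \<in> {?N..<4 * ?N}"
      then have k0: "0 < k" using zero_less_power[of "2::nat" i] by simp
      have "a k = real k powr (3 / 2) * c k" using k0 by (simp add: c_def)
      also have "\<dots> \<le> real (4 * ?N) powr (3 / 2) * c k"
      proof (intro mult_right_mono powr_mono2 c0)
        have "k \<le> 4 * ?N" using k by simp
        then show "real k \<le> real (4 * ?N)" by (simp only: of_nat_le_iff)
      qed auto
      finally show "a k \<le> real (4 * ?N) powr (3 / 2) * c k" .
    qed
    also have "\<dots> = real (4 * ?N) powr (3 / 2) * (s (Suc (Suc i)) - s i)"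
    proof -
      have "(\<Sum>k<4 * ?N. c k) = (\<Sum>k<?N. c k) + (\<Sum>k\<in>{?N..<4 * ?N}. c k)"
        by (subst sum.union_disjoint[symmetric]) (auto intro!: sum.cong)
      then show ?thesis by (simp add: s_def sum_distrib_left)
    qed
    also have "real (4 * ?N) powr (3 / 2) = real (4 * ?N) * sqrt (real (4 * ?N))"
      using powr_add[of "real (4 * ?N)" 1 "1 / 2"] by (simp add: powr_half_sqrt)
    finally have 2: "(\<Sum>k\<in>{?N..<4 * ?N}. a k) \<le> real (4 * ?N) * sqrt (real (4 * ?N)) * (s (Suc (Suc i)) - s i)" .
    define w D Nr where "w = sqrt (real (4 * ?N))" and "D = s (Suc (Suc i)) - s i" and "Nr = real ?N"
    have N0: "0 < Nr" by (simp add: Nr_def)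
    have "2 * Nr * a (4 * ?N) \<le> 2 * (\<Sum>k\<in>{?N..<4 * ?N}. a k)"
      using 1 by (simp only: of_nat_mult of_nat_numeral Nr_def)
    also have "(\<Sum>k\<in>{?N..<4 * ?N}. a k) \<le> 4 * Nr * w * D"
      using 2 by (simp only: of_nat_mult of_nat_numeral Nr_def w_def D_def)
    finally have "2 * Nr * a (4 * ?N) \<le> 2 * (4 * Nr * w * D)" by simp
    also have "\<dots> = 2 * Nr * (w * (4 * D))" by (simp add: algebra_simps)
    finally have "a (4 * ?N) \<le> w * (4 * D)" using N0 by (simp add: mult_ac)
    moreover have "w = sqrt 2 ^ Suc (Suc i)"
      unfolding w_def by (simp add: real_sqrt_mult real_sqrt_power)
    ultimately have "a (2 ^ Suc (Suc i)) \<le> sqrt 2 ^ Suc (Suc i) * (4 * (s (Suc (Suc i)) - s i))"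
      by (simp only: D_def power_Suc) simp
    then have "(1 / sqrt 2) ^ Suc (Suc i) * a (2 ^ Suc (Suc i)) \<le>
        (1 / sqrt 2) ^ Suc (Suc i) * (sqrt 2 ^ Suc (Suc i) * (4 * (s (Suc (Suc i)) - s i)))"
      by (rule mult_left_mono) simp
    also have "\<dots> = 4 * (s (Suc (Suc i)) - s i)"
      by (simp only: mult.assoc[symmetric] power_mult_distrib[symmetric]) simp
    finally show ?thesis .
  qed
  have "summable (\<lambda>i. (1 / sqrt 2) ^ Suc (Suc i) * a (2 ^ Suc (Suc i)))"
  proof (rule summableI_nonneg_bounded)
    fix n
    have "(\<Sum>i<n. (1 / sqrt 2) ^ Suc (Suc i) * a (2 ^ Suc (Suc i))) \<le> (\<Sum>i<n. 4 * (s (Suc (Suc i)) - s i))"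
      by (rule sum_mono) (rule step)
    also have "\<dots> = 4 * (s (Suc n) + s n - s 1 - s 0)"
      by (induction n) (auto simp: algebra_simps)
    also have "\<dots> \<le> 4 * (C + C)"
    proof -
      have "s j \<le> C" "0 \<le> s j" for j unfolding s_def by (auto intro: Cle sum_nonneg c0)
      then have "s (Suc n) \<le> C" "s n \<le> C" "0 \<le> s 1" "0 \<le> s 0" by blast+
      then show ?thesis by simp
    qed
    finally show "(\<Sum>i<n. (1 / sqrt 2) ^ Suc (Suc i) * a (2 ^ Suc (Suc i))) \<le> 4 * (C + C)" .
  qed (simp add: nn)
  then show ?thesis
    using summable_iff_shift[of "\<lambda>j. (1 / sqrt 2) ^ j * a (2 ^ j)" 2] by simp
qed

text \<open>Dominated convergence for series, quantitatively: the tail is controlled by the dominating series \<open>b\<close>, and the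
  finitely many other terms by \<open>\<delta>\<close>.\<close>

lemma suminf_small_of_dominated:
  fixes b :: "nat \<Rightarrow> real" and q :: real
  assumes sm: "summable b" and b0: "\<And>j. 0 \<le> b j" and eps: "0 < \<epsilon>"
  shows "\<exists>\<delta>>0. \<forall>u. summable u \<longrightarrow> (\<forall>j. 0 \<le> u j \<and> u j \<le> b j \<and> u j \<le> 2 ^ j * \<delta>) \<longrightarrow> (\<Sum>j. u j) \<le> \<epsilon>"
proof -
  have "\<exists>N. (\<Sum>j. b (j + N)) < \<epsilon> / 2"
  proof -
    have "(\<lambda>N. \<Sum>j. b (j + N)) \<longlonglongrightarrow> 0" by (rule suminf_exist_split2[OF sm])
    then have "eventually (\<lambda>N. (\<Sum>j. b (j + N)) < \<epsilon> / 2) sequentially"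
      using eps by (intro order_tendstoD(2)) auto
    then show ?thesis by (auto simp: eventually_sequentially)
  qed
  then obtain N where N: "(\<Sum>j. b (j + N)) < \<epsilon> / 2" by blast
  define \<delta> where "\<delta> = \<epsilon> / (2 * 2 ^ N)"
  have d: "0 < \<delta>" using eps by (simp add: \<delta>_def)
  show ?thesis
  proof (intro exI[of _ \<delta>] conjI d allI impI)
    fix u assume u: "summable u" "\<forall>j. 0 \<le> u j \<and> u j \<le> b j \<and> u j \<le> 2 ^ j * \<delta>"
    have "(\<Sum>j. u j) = (\<Sum>j. u (j + N)) + (\<Sum>j<N. u j)" by (rule suminf_split_initial_segment[OF u(1)])
    also have "(\<Sum>j. u (j + N)) \<le> (\<Sum>j. b (j + N))"
      using u sm by (intro suminf_le) (auto intro: summable_ignore_initial_segment)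
    also have "(\<Sum>j<N. u j) \<le> (\<Sum>j<N. 2 ^ j * \<delta>)" using u by (intro sum_mono) auto
    also have "\<dots> \<le> 2 ^ N * \<delta>"
    proof -
      have "(\<Sum>j<N. 2 ^ j * \<delta>) = (2 ^ N - 1) * \<delta>" by (induction N) (auto simp: algebra_simps)
      then show ?thesis using d by (simp add: algebra_simps)
    qed
    also have "2 ^ N * \<delta> = \<epsilon> / 2" by (simp add: \<delta>_def)
    finally show "(\<Sum>j. u j) \<le> \<epsilon>" using N by simp
  qed
qed

context twisted_system begin

lemma koop_cong_AE:
  assumes "AE x in M. f x = g x"
  shows "AE x in M. koop k f x = koop k g x"
  using AE_T_pow[OF assms, of k] by eventually_elim (simp add: koop_def)

text \<open>The tower property. It makes the operators \<open>E (U\<^sup>k \<cdot> | F)\<close> the powers of the contraction \<open>Q h = E (U h | F)\<close>.\<close>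

lemma cexp_koop_cexp:
  assumes "square_integrable M f"
  shows "AE \<omega> in M. cexp (koop k (cexp f)) \<omega> = cexp (koop k f) \<omega>"
proof -
  have "cexp (koop k u) \<omega> = e ^ k * cexp (\<lambda>x. u ((T ^^ k) x)) \<omega>" for u \<omega>
    unfolding koop_def[abs_def] by (rule cexp_cmult)
  then show ?thesis using cexp_tower[OF square_integrable_imp_integrable(1)[OF assms], of k] by simp
qed

lemma cexp_koop_cong:
  assumes "square_integrable M f" "square_integrable M g" "AE x in M. f x = g x"
  shows "AE \<omega> in M. cexp (koop k f) \<omega> = cexp (koop k g) \<omega>"
  by (rule cexp_cong_AE[OF koop_measurable[OF square_integrableD(1)[OF assms(1)]]
      koop_measurable[OF square_integrableD(1)[OF assms(2)]] koop_cong_AE[OF assms(3)]])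

definition cexp_sum_norm :: "('a \<Rightarrow> complex) \<Rightarrow> nat \<Rightarrow> real" where
  "cexp_sum_norm f n = L2_norm M (cexp (koop_sum f n))"

lemma cexp_sum_norm_nonneg [simp]: "0 \<le> cexp_sum_norm f n"
  by (simp add: cexp_sum_norm_def)

lemma L2_norm_cong_AE:
  assumes "square_integrable M f" "square_integrable M g" "AE x in M. f x = g x"
  shows "L2_norm M f = L2_norm M g"
  using square_integrable_cong_AE(2)[OF assms(2) square_integrableD(1)[OF assms(1)] assms(3)] .

lemma koop_sum_add_index: "koop_sum f (m + n) x = koop_sum f m x + koop m (koop_sum f n) x"
proof -
  have "koop m (koop_sum f n) x = (\<Sum>k=1..n. koop (m + k) f x)"
    unfolding koop_sum_def koop_def[of m "\<lambda>x. \<Sum>k=1..n. koop k f x"] sum_distrib_left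
    by (rule sum.cong[OF refl]) (subst koop_koop[symmetric], simp add: koop_def)
  also have "\<dots> = (\<Sum>k=m+1..m+n. koop k f x)"
    by (rule sum.reindex_bij_witness[of _ "\<lambda>k. k - m" "\<lambda>k. m + k"]) auto
  finally show ?thesis
    unfolding koop_sum_def[of f "m + n"] koop_sum_def[of f m]
    using sum.ub_add_nat[of 1 m "\<lambda>k. koop k f x" n] by simp
qed

lemma L2_norm_cexp_koop_le:
  assumes "square_integrable M f"
  shows "L2_norm M (cexp (koop k f)) \<le> L2_norm M (cexp f)"
proof -
  note c = cexp_square_integrable[OF assms]
  have "L2_norm M (cexp (koop k f)) = L2_norm M (cexp (koop k (cexp f)))"
    using cexp_koop_cexp[OF assms, of k]
    by (intro L2_norm_cong_AE cexp_square_integrable koop_square_integrable c assms) auto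
  also have "\<dots> \<le> L2_norm M (koop k (cexp f))" by (rule cexp_square_integrable(2)[OF koop_square_integrable(1)[OF c(1)]])
  also have "\<dots> = L2_norm M (cexp f)" by (rule koop_square_integrable(2)[OF c(1)])
  finally show ?thesis .
qed

lemma L2_norm_cexp_add_le:
  fixes f g :: "'a \<Rightarrow> complex"
  assumes "square_integrable M f" "square_integrable M g"
  shows "L2_norm M (cexp (\<lambda>x. f x + g x)) \<le> L2_norm M (cexp f) + L2_norm M (cexp g)"
proof -
  note s = cexp_square_integrable(1)[OF assms(1)] cexp_square_integrable(1)[OF assms(2)]
  have "L2_norm M (cexp (\<lambda>x. f x + g x)) = L2_norm M (\<lambda>x. cexp f x + cexp g x)"
    using cexp_add[OF square_integrable_imp_integrable(1)[OF assms(1)] square_integrable_imp_integrable(1)[OF assms(2)]]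
    by (intro L2_norm_cong_AE cexp_square_integrable square_integrable_add assms s) auto
  also have "\<dots> \<le> L2_norm M (cexp f) + L2_norm M (cexp g)" by (rule square_integrable_add(2)[OF s])
  finally show ?thesis .
qed

lemma L2_norm_cexp_sum_le:
  fixes f :: "'i \<Rightarrow> 'a \<Rightarrow> complex"
  assumes "finite I" "\<And>i. i \<in> I \<Longrightarrow> square_integrable M (f i)"
  shows "L2_norm M (cexp (\<lambda>x. \<Sum>i\<in>I. f i x)) \<le> (\<Sum>i\<in>I. L2_norm M (cexp (f i)))"
  using assms
proof (induction I rule: finite_induct)
  case (insert j J)
  then show ?case
    using L2_norm_cexp_add_le[OF _ square_integrable_sum(1), of "f j" J f] by fastforce
qed (simp add: cexp_def[abs_def])

lemma cexp_sum_norm_subadditive: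
  assumes f: "square_integrable M f"
  shows "cexp_sum_norm f (m + n) \<le> cexp_sum_norm f m + cexp_sum_norm f n"
proof -
  have e: "koop_sum f (m + n) = (\<lambda>x. koop_sum f m x + koop m (koop_sum f n) x)" by (rule ext) (rule koop_sum_add_index)
  note t = koop_sum_square_integrable[OF f]
  show ?thesis unfolding cexp_sum_norm_def e
    using L2_norm_cexp_add_le[OF t koop_square_integrable(1)[OF t], of m m n] L2_norm_cexp_koop_le[OF t, of m n] by simp
qed

lemma block_cexp_eq_cexp_koop_sum:
  assumes f: "square_integrable M f"
  shows "AE \<omega> in M. block_cexp f j \<omega> = cexp (koop_sum f (2 ^ j)) \<omega>"
proof (induction j)
  case 0
  then show ?case by (simp add: koop_sum_def[abs_def])
next
  case (Suc j)
  let ?q = "2 ^ j :: nat"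
  note t = koop_sum_square_integrable[OF f, of ?q]
  note kt = koop_square_integrable(1)[OF t, of ?q]
  have e: "koop_sum f (2 ^ Suc j) = (\<lambda>x. koop_sum f ?q x + koop ?q (koop_sum f ?q) x)"
    using koop_sum_add_index[of f ?q ?q] by (simp add: fun_eq_iff mult_2)
  have 1: "AE \<omega> in M. cexp (koop_sum f (2 ^ Suc j)) \<omega> = cexp (koop_sum f ?q) \<omega> + cexp (koop ?q (koop_sum f ?q)) \<omega>"
    unfolding e by (intro cexp_add square_integrable_imp_integrable t kt)
  have 2: "AE \<omega> in M. cexp (koop ?q (block_cexp f j)) \<omega> = cexp (koop ?q (cexp (koop_sum f ?q))) \<omega>"
    by (rule cexp_koop_cong[OF block_cexp_square_integrable[OF f] cexp_square_integrable(1)[OF t] Suc])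
  show ?case using 1 2 Suc cexp_koop_cexp[OF t, of ?q] by eventually_elim simp
qed

lemma L2_norm_block_cexp:
  assumes f: "square_integrable M f"
  shows "L2_norm M (block_cexp f j) = cexp_sum_norm f (2 ^ j)"
  unfolding cexp_sum_norm_def
  by (rule L2_norm_cong_AE[OF block_cexp_square_integrable[OF f] cexp_square_integrable(1)[OF koop_sum_square_integrable[OF f]] block_cexp_eq_cexp_koop_sum[OF f]])

lemma MW_summableI:
  assumes f: "square_integrable M f"
    and "summable (\<lambda>j. cexp_sum_norm f (Suc j) / real (Suc j) powr (3 / 2))"
  shows "MW_summable f"
  unfolding MW_summable_def L2_norm_block_cexp[OF f]
  by (rule dyadic_condensation_subadditive[OF cexp_sum_norm_nonneg cexp_sum_norm_subadditive[OF f] assms(2)])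

end

section \<open>Approximation by bounded coboundaries\<close>

lemma truncation_L2:
  fixes G :: "'a \<Rightarrow> complex"
  assumes G: "square_integrable M G" and eta: "0 < \<eta>"
  shows "\<exists>K\<ge>0. L2_norm M (\<lambda>x. if cmod (G x) \<le> K then 0 else G x) \<le> \<eta>"
proof -
  note [measurable] = square_integrableD(1)[OF G]
  have "(\<lambda>n. \<integral>x. (cmod (if cmod (G x) \<le> real n then 0 else G x))\<^sup>2 \<partial>M) \<longlonglongrightarrow> (\<integral>x. 0 \<partial>M)"
  proof (rule integral_dominated_convergence[where w = "\<lambda>x. (cmod (G x))\<^sup>2"])
    show "integrable M (\<lambda>x. (cmod (G x))\<^sup>2)" by (rule square_integrableD(2)[OF G])
    show "AE x in M. (\<lambda>n. (cmod (if cmod (G x) \<le> real n then 0 else G x))\<^sup>2) \<longlonglongrightarrow> 0"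
    proof (rule AE_I2)
      fix x
      obtain N :: nat where N: "cmod (G x) \<le> real N" using real_arch_simple by blast
      have "\<forall>n\<ge>N. (cmod (if cmod (G x) \<le> real n then 0 else G x))\<^sup>2 = 0"
      proof (intro allI impI)
        fix n assume "N \<le> n"
        then have "cmod (G x) \<le> real n" using N by linarith
        then show "(cmod (if cmod (G x) \<le> real n then 0 else G x))\<^sup>2 = 0" by simp
      qed
      then show "(\<lambda>n. (cmod (if cmod (G x) \<le> real n then 0 else G x))\<^sup>2) \<longlonglongrightarrow> 0"
        by (intro tendsto_eventually) (unfold eventually_sequentially, blast)
    qed
  qed auto
  then have "eventually (\<lambda>n. (\<integral>x. (cmod (if cmod (G x) \<le> real n then 0 else G x))\<^sup>2 \<partial>M) < \<eta>\<^sup>2) sequentially"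
    using eta by (intro order_tendstoD(2)) auto
  then obtain n where n: "(\<integral>x. (cmod (if cmod (G x) \<le> real n then 0 else G x))\<^sup>2 \<partial>M) < \<eta>\<^sup>2"
    by (auto simp: eventually_sequentially)
  have "(L2_norm M (\<lambda>x. if cmod (G x) \<le> real n then 0 else G x))\<^sup>2 \<le> \<eta>\<^sup>2"
    unfolding L2_norm_power2 using n by simp
  then have "L2_norm M (\<lambda>x. if cmod (G x) \<le> real n then 0 else G x) \<le> \<eta>"
    by (rule power2_le_imp_le) (use eta in simp)
  then show ?thesis by (intro exI[of _ "real n"]) simp
qed

context twisted_system begin

lemma koop_sum_add: "koop_sum (\<lambda>x. f x + g x) m x = koop_sum f m x + koop_sum g m x"
  by (simp add: koop_sum_def koop_add sum.distrib)

lemma koop_sum_cmult: "koop_sum (\<lambda>x. c * f x) m x = c * koop_sum f m x"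
  by (simp add: koop_sum_def koop_def sum_distrib_left mult_ac)

lemma koop_sum_cong_AE:
  assumes "AE x in M. f x = g x"
  shows "AE x in M. koop_sum f m x = koop_sum g m x"
proof -
  have "AE x in M. \<forall>k. koop k f x = koop k g x"
    by (rule AE_all_countable[THEN iffD2]) (intro allI koop_cong_AE assms)
  then show ?thesis by eventually_elim (simp add: koop_sum_def)
qed

lemma cexp_sum_norm_cong:
  assumes "square_integrable M f" "square_integrable M g" "AE x in M. f x = g x"
  shows "cexp_sum_norm f m = cexp_sum_norm g m"
proof -
  note t = koop_sum_square_integrable[OF assms(1), of m] koop_sum_square_integrable[OF assms(2), of m]
  have "AE \<omega> in M. cexp (koop_sum f m) \<omega> = cexp (koop_sum g m) \<omega>"
    by (rule cexp_cong_AE[OF square_integrableD(1)[OF t(1)] square_integrableD(1)[OF t(2)] koop_sum_cong_AE[OF assms(3)]])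
  then show ?thesis unfolding cexp_sum_norm_def
    by (rule L2_norm_cong_AE[OF cexp_square_integrable(1)[OF t(1)] cexp_square_integrable(1)[OF t(2)]])
qed

lemma cexp_sum_norm_add_le:
  assumes "square_integrable M f" "square_integrable M g"
  shows "cexp_sum_norm (\<lambda>x. f x + g x) m \<le> cexp_sum_norm f m + cexp_sum_norm g m"
  unfolding cexp_sum_norm_def koop_sum_add[abs_def]
  by (rule L2_norm_cexp_add_le[OF koop_sum_square_integrable[OF assms(1)] koop_sum_square_integrable[OF assms(2)]])

lemma cexp_sum_norm_cmult:
  assumes "square_integrable M f"
  shows "cexp_sum_norm (\<lambda>x. c * f x) m = cmod c * cexp_sum_norm f m"
proof -
  have "cexp (koop_sum (\<lambda>x. c * f x) m) = (\<lambda>\<omega>. c * cexp (koop_sum f m) \<omega>)"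
    unfolding koop_sum_cmult[abs_def] by (rule ext) (rule cexp_cmult)
  then show ?thesis unfolding cexp_sum_norm_def
    using square_integrable_cmult(2)[OF cexp_square_integrable(1)[OF koop_sum_square_integrable[OF assms]]] by simp
qed

lemma cexp_sum_norm_le_norm:
  assumes "square_integrable M f"
  shows "cexp_sum_norm f m \<le> real m * L2_norm M f"
proof -
  have "cexp_sum_norm f m \<le> L2_norm M (koop_sum f m)"
    unfolding cexp_sum_norm_def by (rule cexp_square_integrable(2)[OF koop_sum_square_integrable[OF assms]])
  also have "\<dots> \<le> (\<Sum>k=1..m. L2_norm M (koop k f))"
    unfolding koop_sum_def[abs_def] by (rule square_integrable_sum(2)) (rule koop_square_integrable[OF assms])
  also have "\<dots> = real m * L2_norm M f" by (simp add: koop_square_integrable(2)[OF assms])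
  finally show ?thesis .
qed

lemma cexp_koop_sum_tower:
  assumes u: "square_integrable M u"
  shows "AE \<omega> in M. cexp (koop_sum (cexp u) m) \<omega> = cexp (koop_sum u m) \<omega>"
proof -
  note c = cexp_square_integrable(1)[OF u]
  have "AE \<omega> in M. cexp (koop_sum (cexp u) m) \<omega> = (\<Sum>k=1..m. cexp (koop k (cexp u)) \<omega>)"
    unfolding koop_sum_def[abs_def]
    by (rule cexp_sum) (auto intro!: square_integrable_imp_integrable koop_square_integrable c)
  moreover have "AE \<omega> in M. cexp (koop_sum u m) \<omega> = (\<Sum>k=1..m. cexp (koop k u) \<omega>)"
    unfolding koop_sum_def[abs_def]
    by (rule cexp_sum) (auto intro!: square_integrable_imp_integrable koop_square_integrable u)
  moreover have "AE \<omega> in M. \<forall>k. cexp (koop k (cexp u)) \<omega> = cexp (koop k u) \<omega>"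
    by (rule AE_all_countable[THEN iffD2]) (intro allI cexp_koop_cexp u)
  ultimately show ?thesis by eventually_elim simp
qed

lemma koop_sum_commute: "koop_sum (koop_sum f n) m x = koop_sum (koop_sum f m) n x"
proof -
  have *: "koop_sum (koop_sum f n) m x = (\<Sum>k=1..m. \<Sum>i=1..n. koop (k + i) f x)" for m n
    unfolding koop_sum_def[of "koop_sum f n"] koop_koop[symmetric]
    by (rule sum.cong[OF refl]) (simp add: koop_def koop_sum_def sum_distrib_left)
  show ?thesis unfolding * by (subst sum.swap) (simp add: add.commute)
qed

lemma cexp_sum_norm_cexp_koop_sum_le:
  assumes f: "square_integrable M f"
  shows "cexp_sum_norm (cexp (koop_sum f n)) m \<le> real n * cexp_sum_norm f m"
proof -
  note t = koop_sum_square_integrable[OF f]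
  have "cexp_sum_norm (cexp (koop_sum f n)) m = L2_norm M (cexp (koop_sum (koop_sum f n) m))"
    unfolding cexp_sum_norm_def
    by (rule L2_norm_cong_AE[OF _ _ cexp_koop_sum_tower[OF t]])
       (intro cexp_square_integrable koop_sum_square_integrable f)+
  also have "koop_sum (koop_sum f n) m = koop_sum (koop_sum f m) n" by (rule ext) (rule koop_sum_commute)
  also have "L2_norm M (cexp (koop_sum (koop_sum f m) n)) \<le> (\<Sum>k=1..n. L2_norm M (cexp (koop k (koop_sum f m))))"
    unfolding koop_sum_def[of "koop_sum f m", abs_def]
    by (rule L2_norm_cexp_sum_le) (auto intro: koop_square_integrable t)
  also have "\<dots> \<le> (\<Sum>k=1..n. cexp_sum_norm f m)"
    unfolding cexp_sum_norm_def by (intro sum_mono L2_norm_cexp_koop_le t)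
  finally show ?thesis by simp
qed

lemma cexp_koop_sum_coboundary:
  assumes y: "square_integrable M y"
  shows "AE \<omega> in M. cexp (koop_sum (\<lambda>x. y x - cexp (koop 1 y) x) m) \<omega> = cexp (koop 1 y) \<omega> - cexp (koop (Suc m) y) \<omega>"
proof (induction m)
  case 0
  then show ?case by (simp add: koop_sum_def[abs_def])
next
  case (Suc m)
  note k = koop_square_integrable(1)[OF y]
  let ?L = "cexp (koop 1 y)"
  note c = cexp_square_integrable(1)[OF k[of 1]]
  let ?d = "\<lambda>x. y x - ?L x"
  note d = square_integrable_minus(1)[OF y c]
  have "koop_sum ?d (Suc m) = (\<lambda>x. koop_sum ?d m x + (koop (Suc m) y x - koop (Suc m) ?L x))"
    by (simp add: koop_sum_def[abs_def] koop_diff fun_eq_iff)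
  then have "AE \<omega> in M. cexp (koop_sum ?d (Suc m)) \<omega> = cexp (koop_sum ?d m) \<omega> + cexp (\<lambda>x. koop (Suc m) y x - koop (Suc m) ?L x) \<omega>"
    using cexp_add[of "koop_sum ?d m" "\<lambda>x. koop (Suc m) y x - koop (Suc m) ?L x"]
    by (simp add: square_integrable_imp_integrable koop_sum_square_integrable d square_integrable_minus koop_square_integrable y c
        del: One_nat_def)
  moreover have "AE \<omega> in M. cexp (\<lambda>x. koop (Suc m) y x - koop (Suc m) ?L x) \<omega> = cexp (koop (Suc m) y) \<omega> - cexp (koop (Suc m) ?L) \<omega>"
    by (intro cexp_diff square_integrable_imp_integrable koop_square_integrable y c)
  moreover have "AE \<omega> in M. cexp (koop (Suc m) ?L) \<omega> = cexp (koop (Suc (Suc m)) y) \<omega>"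
    using cexp_koop_cexp[OF k[of 1], of "Suc m"] by (simp add: koop_koop)
  ultimately show ?case using Suc by eventually_elim simp
qed

lemma cexp_sum_norm_coboundary_le:
  assumes y: "square_integrable M y"
  shows "cexp_sum_norm (\<lambda>x. y x - cexp (koop 1 y) x) m \<le> 2 * L2_norm M y"
proof -
  note k = koop_square_integrable[OF y]
  note c = cexp_square_integrable[OF k(1)]
  note d = square_integrable_minus(1)[OF y c(1)[of 1]]
  have "cexp_sum_norm (\<lambda>x. y x - cexp (koop 1 y) x) m = L2_norm M (\<lambda>\<omega>. cexp (koop 1 y) \<omega> - cexp (koop (Suc m) y) \<omega>)"
    unfolding cexp_sum_norm_def
    by (rule L2_norm_cong_AE[OF cexp_square_integrable(1)[OF koop_sum_square_integrable[OF d]]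
       square_integrable_minus(1)[OF c(1) c(1)] cexp_koop_sum_coboundary[OF y]])
  also have "\<dots> \<le> L2_norm M (cexp (koop 1 y)) + L2_norm M (cexp (koop (Suc m) y))"
    by (rule square_integrable_minus(2)[OF c(1) c(1)])
  also have "\<dots> \<le> L2_norm M y + L2_norm M y"
    using c(2)[of 1] c(2)[of "Suc m"] unfolding k(2) by simp
  finally show ?thesis by simp
qed

text \<open>The telescoping \<open>f - Q\<^sup>k f = (1 - Q) (f + \<dots> + Q\<^sup>k\<^sup>-\<^sup>1 f)\<close>, averaged over \<open>k\<close>. The average of the
  sums on the right is formed before conditioning, as \<open>S\<close> in the proof, so that one application of the tower property suffices.\<close>

lemma coboundary_plus_cesaro:
  assumes f: "square_integrable M f" "f \<in> borel_measurable F" and n: "0 < n"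
  defines "A \<equiv> \<lambda>x. complex_of_real (1 / real n) * cexp (koop_sum f n) x"
  shows "\<exists>G. square_integrable M G \<and> G \<in> borel_measurable F \<and>
     (AE x in M. f x = G x - cexp (koop 1 G) x + A x)"
proof -
  define c where "c = complex_of_real (1 / real n)"
  define S where "S x = (\<Sum>k=1..n. \<Sum>i<k. koop i f x)" for x
  define G where "G x = c * cexp S x" for x
  have S: "square_integrable M S" unfolding S_def[abs_def]
    by (intro square_integrable_sum koop_square_integrable f)
  note t = koop_sum_square_integrable[OF f(1), of n]
  have G: "square_integrable M G" unfolding G_def[abs_def]
    by (intro square_integrable_cmult cexp_square_integrable S)
  have GF: "G \<in> borel_measurable F" unfolding G_def[abs_def]
    using cexp_measurable_F[OF square_integrableD(1)[OF S]] by measurable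
  have tel: "S x - koop 1 S x = of_nat n * f x - koop_sum f n x" for x
  proof -
    have "koop 1 S x = (\<Sum>k=1..n. \<Sum>i<k. koop (Suc i) f x)"
    proof -
      have "koop 1 S x = (\<Sum>k=1..n. \<Sum>i<k. koop 1 (koop i f) x)"
        unfolding koop_def[of 1] S_def by (simp only: sum_distrib_left)
      then show ?thesis by (simp add: koop_koop)
    qed
    then have "S x - koop 1 S x = (\<Sum>k=1..n. (\<Sum>i<k. koop i f x - koop (Suc i) f x))"
      by (simp add: S_def sum_subtractf)
    also have "\<dots> = (\<Sum>k=1..n. f x - koop k f x)"
      by (rule sum.cong[OF refl], subst sum_lessThan_telescope') simp
    finally show ?thesis by (simp add: sum_subtractf koop_sum_def)
  qed
  have 1: "AE \<omega> in M. cexp (koop 1 G) \<omega> = c * cexp (koop 1 S) \<omega>"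
  proof -
    have "koop 1 G = (\<lambda>x. c * koop 1 (cexp S) x)" by (simp add: koop_def G_def fun_eq_iff)
    then have "cexp (koop 1 G) \<omega> = c * cexp (koop 1 (cexp S)) \<omega>" for \<omega> by (simp only: cexp_cmult)
    then show ?thesis using cexp_koop_cexp[OF S, of 1] by simp
  qed
  have 2: "AE \<omega> in M. cexp (\<lambda>x. S x - koop 1 S x) \<omega> = cexp S \<omega> - cexp (koop 1 S) \<omega>"
    by (intro cexp_diff square_integrable_imp_integrable koop_square_integrable S)
  have 3: "AE \<omega> in M. cexp (\<lambda>x. of_nat n * f x - koop_sum f n x) \<omega> = cexp (\<lambda>x. of_nat n * f x) \<omega> - cexp (koop_sum f n) \<omega>"
    by (intro cexp_diff square_integrable_imp_integrable square_integrable_cmult t f)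
  have 4: "AE \<omega> in M. cexp f \<omega> = f \<omega>"
    by (rule cexp_F_measurable[OF square_integrable_imp_integrable(1)[OF f(1)] f(2)])
  have cn: "c * of_nat n = 1" using n by (simp add: c_def)
  have "AE x in M. f x = G x - cexp (koop 1 G) x + A x"
    using 1 2 3 4
  proof eventually_elim
    case (elim x)
    have "cexp S x - cexp (koop 1 S) x = of_nat n * f x - cexp (koop_sum f n) x"
      using elim(2,3,4) unfolding tel by simp
    then have "c * (cexp S x - cexp (koop 1 S) x) = c * (of_nat n * f x - cexp (koop_sum f n) x)" by simp
    then have "c * cexp S x - c * cexp (koop 1 S) x = f x - c * cexp (koop_sum f n) x"
      using cn by (simp add: algebra_simps flip: mult.assoc)
    then show ?case using elim(1) by (simp add: G_def A_def c_def)
  qed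
  with G GF show ?thesis by blast
qed

text \<open>Let \<open>A\<close> be a Cesaro mean of the \<open>Q\<^sup>k f\<close> over a dyadic number of terms. Its block norms are dominated by those of
  \<open>f\<close>, and each of them is small because the norm of \<open>A\<close> is small; so the Maxwell-Woodroofe norm of \<open>A\<close> is small by
  dominated convergence. Truncating \<open>G\<close> in \<open>f = G - Q G + A\<close> adds a coboundary \<open>y - Q y\<close>, whose block norms are at most
  twice the norm of \<open>y\<close> at every scale by telescoping.\<close>

lemma bounded_coboundary_approximation:
  assumes f: "square_integrable M f" "f \<in> borel_measurable F" and mw: "MW_summable f" and eps: "0 < \<epsilon>"
  shows "\<exists>g K. g \<in> borel_measurable F \<and> (\<forall>x. cmod (g x) \<le> K) \<and>
     MW_summable (\<lambda>x. f x - (g x - cexp (koop 1 g) x)) \<and>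
     MW_norm (\<lambda>x. f x - (g x - cexp (koop 1 g) x)) \<le> \<epsilon>"
proof -
  let ?q = "1 / sqrt 2 :: real"
  have q1: "?q < 1" "0 < ?q" by (auto simp: divide_simps)
  define Q where "Q = (\<Sum>j. ?q ^ j)"
  have Qs: "summable (\<lambda>j. ?q ^ j)" using q1 by (intro summable_geometric) auto
  have Q0: "0 \<le> Q" unfolding Q_def by (intro suminf_nonneg Qs) auto
  define b where "b j = ?q ^ j * cexp_sum_norm f (2 ^ j)" for j
  have bs: "summable b" using mw by (simp add: MW_summable_def L2_norm_block_cexp[OF f(1)] b_def[abs_def])
  have b0: "0 \<le> b j" for j by (simp add: b_def)
  obtain \<delta> where d: "0 < \<delta>" and small: "\<And>u. summable u \<Longrightarrow> (\<And>j. 0 \<le> u j \<and> u j \<le> b j \<and> u j \<le> 2 ^ j * \<delta>) \<Longrightarrow> (\<Sum>j. u j) \<le> \<epsilon> / 4"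
    using suminf_small_of_dominated[OF bs b0, of "\<epsilon> / 4"] eps by auto
  have "b \<longlonglongrightarrow> 0" by (rule summable_LIMSEQ_zero[OF bs])
  then have "eventually (\<lambda>J. b J < min \<delta> (\<epsilon> / 4)) sequentially"
    using d eps by (intro order_tendstoD(2)) auto
  then obtain J where J: "b J < min \<delta> (\<epsilon> / 4)" by (auto simp: eventually_sequentially)
  define n :: nat where "n = 2 ^ J"
  have n: "0 < n" by (simp add: n_def)
  define A where "A x = complex_of_real (1 / real n) * cexp (koop_sum f n) x" for x
  note t = koop_sum_square_integrable[OF f(1)]
  have A: "square_integrable M A" unfolding A_def[abs_def] by (intro square_integrable_cmult cexp_square_integrable t)
  have An: "L2_norm M A \<le> b J"
  proof -
    have "L2_norm M A = cexp_sum_norm f n / real n"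
      unfolding A_def[abs_def] square_integrable_cmult(2)[OF cexp_square_integrable(1)[OF t]] cexp_sum_norm_def by (simp add: norm_divide)
    also have "\<dots> = (1 / 2) ^ J * cexp_sum_norm f (2 ^ J)" by (simp add: n_def power_one_over divide_simps)
    also have "\<dots> \<le> ?q ^ J * cexp_sum_norm f (2 ^ J)"
      by (intro mult_right_mono power_mono) (auto simp: divide_simps real_le_lsqrt)
    finally show ?thesis by (simp add: b_def)
  qed
  obtain G where G: "square_integrable M G" "G \<in> borel_measurable F"
    and fG: "AE x in M. f x = G x - cexp (koop 1 G) x + A x"
    using coboundary_plus_cesaro[OF f n] unfolding A_def by blast
  \<comment> \<open>The truncation error enters once with factor \<open>2\<close> and once with factor \<open>2 * Q\<close>.\<close>
  define \<eta> where "\<eta> = \<epsilon> / (8 * (1 + Q))"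
  have eta: "0 < \<eta>" using eps Q0 by (simp add: \<eta>_def)
  obtain K where K: "0 \<le> K" "L2_norm M (\<lambda>x. if cmod (G x) \<le> K then 0 else G x) \<le> \<eta>"
    using truncation_L2[OF G(1) eta] by blast
  define y where "y x = (if cmod (G x) \<le> K then 0 else G x)" for x
  define g where "g x = (if cmod (G x) \<le> K then G x else 0)" for x
  note [measurable] = G(2)
  have gF: "g \<in> borel_measurable F" unfolding g_def[abs_def] by measurable
  have yF: "y \<in> borel_measurable F" unfolding y_def[abs_def] by measurable
  have gK: "cmod (g x) \<le> K" for x using K by (simp add: g_def)
  have yL: "L2_norm M y \<le> \<eta>" using K(2) by (simp add: y_def[abs_def])
  have y: "square_integrable M y"
    by (rule square_integrable_mono[OF G(1) F_measurable[OF yF]]) (simp add: y_def)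
  have g: "square_integrable M g"
    by (rule square_integrable_mono[OF G(1) F_measurable[OF gF]]) (simp add: g_def)
  have Gyg: "koop 1 G x = koop 1 g x + koop 1 y x" for x
    by (auto simp: koop_def g_def y_def algebra_simps)
  define r where "r x = f x - (g x - cexp (koop 1 g) x)" for x
  define dy where "dy x = y x - cexp (koop 1 y) x" for x
  note cg = cexp_square_integrable(1)[OF koop_square_integrable(1)[OF g, of 1]]
  note cy = cexp_square_integrable[OF koop_square_integrable(1)[OF y, of 1]]
  have r: "square_integrable M r" unfolding r_def[abs_def] by (intro square_integrable_minus f g cg)
  have dy: "square_integrable M dy" unfolding dy_def[abs_def] by (rule square_integrable_minus(1)[OF y cy(1)])
  have "AE x in M. cexp (koop 1 G) x = cexp (koop 1 g) x + cexp (koop 1 y) x"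
    unfolding Gyg[abs_def] by (intro cexp_add square_integrable_imp_integrable koop_square_integrable g y)
  then have r_eq: "AE x in M. r x = A x + dy x"
    using fG by eventually_elim (auto simp: r_def dy_def g_def y_def)
  note Ady = square_integrable_add[OF A dy]
  have rL: "L2_norm M r \<le> L2_norm M A + 2 * L2_norm M y"
  proof -
    have "L2_norm M r = L2_norm M (\<lambda>x. A x + dy x)" by (rule L2_norm_cong_AE[OF r Ady(1) r_eq])
    also have "\<dots> \<le> L2_norm M A + L2_norm M dy" by (rule Ady(2))
    also have "L2_norm M dy \<le> L2_norm M y + L2_norm M (cexp (koop 1 y))"
      unfolding dy_def[abs_def] by (rule square_integrable_minus(2)[OF y cy(1)])
    also have "L2_norm M (cexp (koop 1 y)) \<le> L2_norm M y" using cy(2) koop_square_integrable(2)[OF y] by simp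
    finally show ?thesis by simp
  qed
  have cA: "cexp_sum_norm A m \<le> cexp_sum_norm f m" for m
  proof -
    have "cexp_sum_norm A m = 1 / real n * cexp_sum_norm (cexp (koop_sum f n)) m"
      unfolding A_def[abs_def] cexp_sum_norm_cmult[OF cexp_square_integrable(1)[OF t]] by (simp add: norm_divide)
    also have "\<dots> \<le> 1 / real n * (real n * cexp_sum_norm f m)"
      by (intro mult_left_mono cexp_sum_norm_cexp_koop_sum_le f) simp
    finally show ?thesis using n by simp
  qed
  have cr: "cexp_sum_norm r m \<le> cexp_sum_norm A m + 2 * L2_norm M y" for m
    using cexp_sum_norm_cong[OF r Ady(1) r_eq, of m] cexp_sum_norm_add_le[OF A dy, of m] cexp_sum_norm_coboundary_le[OF y, of m]
    unfolding dy_def by simp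
  define u where "u j = ?q ^ j * cexp_sum_norm A (2 ^ j)" for j
  have u: "0 \<le> u j \<and> u j \<le> b j \<and> u j \<le> 2 ^ j * \<delta>" for j
  proof (intro conjI)
    show "0 \<le> u j" by (simp add: u_def)
    show "u j \<le> b j" unfolding u_def b_def by (intro mult_left_mono cA) simp
    have "u j \<le> 1 * (real (2 ^ j) * L2_norm M A)"
      unfolding u_def using q1 by (intro mult_mono cexp_sum_norm_le_norm A power_le_one) auto
    also have "\<dots> \<le> 2 ^ j * \<delta>" using An J by simp
    finally show "u j \<le> 2 ^ j * \<delta>" .
  qed
  have us: "summable u"
    by (rule summable_comparison_test'[OF bs, of 0]) (use u in auto)
  have bound: "?q ^ j * cexp_sum_norm r (2 ^ j) \<le> u j + ?q ^ j * (2 * L2_norm M y)" for j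
    using mult_left_mono[OF cr[of "2 ^ j"], of "?q ^ j"] by (simp add: u_def distrib_left)
  have s2: "summable (\<lambda>j. u j + ?q ^ j * (2 * L2_norm M y))"
    by (intro summable_add us summable_mult2 Qs)
  have rs: "summable (\<lambda>j. ?q ^ j * cexp_sum_norm r (2 ^ j))"
    by (rule summable_comparison_test'[OF s2, of 0]) (use bound in simp)
  have "(\<Sum>j. ?q ^ j * cexp_sum_norm r (2 ^ j)) \<le> (\<Sum>j. u j + ?q ^ j * (2 * L2_norm M y))"
    by (rule suminf_le[OF bound rs s2])
  also have "\<dots> = (\<Sum>j. u j) + Q * (2 * L2_norm M y)"
    unfolding Q_def by (subst suminf_add[symmetric]) (auto intro: us summable_mult2 Qs suminf_mult2[symmetric])
  also have "(\<Sum>j. u j) \<le> \<epsilon> / 4" by (rule small[OF us u])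
  finally have "MW_norm r \<le> L2_norm M A + 2 * L2_norm M y + (\<epsilon> / 4 + Q * (2 * L2_norm M y))"
    using rL by (simp add: MW_norm_def L2_norm_block_cexp[OF r])
  also have "\<dots> = L2_norm M A + \<epsilon> / 4 + 2 * (1 + Q) * L2_norm M y" by (simp add: algebra_simps)
  also have "\<dots> \<le> \<epsilon> / 4 + \<epsilon> / 4 + 2 * (1 + Q) * \<eta>"
    using An J Q0 by (intro add_mono mult_left_mono yL) auto
  also have "2 * (1 + Q) * \<eta> = \<epsilon> / 4" using Q0 by (simp add: \<eta>_def field_simps)
  finally have "MW_norm r \<le> \<epsilon>" using eps by simp
  moreover have "MW_summable r" using rs by (simp add: MW_summable_def L2_norm_block_cexp[OF r])
  ultimately show ?thesis using gF gK unfolding r_def by blast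
qed

end

section \<open>The mean ergodic theorem for a twisted Koopman operator\<close>

lemma (in prob_space) AE_summable_of_nn_integral_le:
  fixes Y :: "nat \<Rightarrow> 'a \<Rightarrow> ennreal"
  assumes [measurable]: "\<And>i. Y i \<in> borel_measurable M" and le: "\<And>i. (\<integral>\<^sup>+x. Y i x \<partial>M) \<le> ennreal (c i)"
    and c: "\<And>i. 0 \<le> c i" "summable c"
  shows "AE x in M. (\<forall>i. Y i x \<noteq> top) \<and> summable (\<lambda>i. enn2real (Y i x))"
proof -
  have "(\<integral>\<^sup>+x. (\<Sum>i. Y i x) \<partial>M) = (\<Sum>i. \<integral>\<^sup>+x. Y i x \<partial>M)" by (rule nn_integral_suminf) measurable
  also have "\<dots> \<le> (\<Sum>i. ennreal (c i))" by (intro suminf_le le) auto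
  also have "\<dots> = ennreal (\<Sum>i. c i)" by (rule suminf_ennreal2[OF c])
  finally have "(\<integral>\<^sup>+x. (\<Sum>i. Y i x) \<partial>M) \<noteq> \<infinity>" by (auto simp: top_unique)
  then have "AE x in M. (\<Sum>i. Y i x) \<noteq> \<infinity>" by (intro nn_integral_PInf_AE) measurable
  then show ?thesis
  proof eventually_elim
    case (elim x)
    then show ?case using summable_of_suminf_ennreal[of "\<lambda>_. 1" "\<lambda>i. Y i x"] by auto
  qed
qed

lemma parallelogram_L2:
  fixes f g :: "'a \<Rightarrow> complex"
  assumes "square_integrable M f" "square_integrable M g"
  shows "(L2_norm M (\<lambda>x. f x - g x))\<^sup>2 + (L2_norm M (\<lambda>x. f x + g x))\<^sup>2 = 2 * (L2_norm M f)\<^sup>2 + 2 * (L2_norm M g)\<^sup>2"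
proof -
  note i = square_integrableD(2)[OF assms(1)] square_integrableD(2)[OF assms(2)]
    square_integrableD(2)[OF square_integrable_minus(1)[OF assms]] square_integrableD(2)[OF square_integrable_add(1)[OF assms]]
  have p: "(cmod (a - b))\<^sup>2 + (cmod (a + b))\<^sup>2 = 2 * (cmod a)\<^sup>2 + 2 * (cmod b)\<^sup>2" for a b
    unfolding cmod_power2 by (simp add: power2_eq_square algebra_simps)
  have "(L2_norm M (\<lambda>x. f x - g x))\<^sup>2 + (L2_norm M (\<lambda>x. f x + g x))\<^sup>2 =
      (\<integral>x. (cmod (f x - g x))\<^sup>2 + (cmod (f x + g x))\<^sup>2 \<partial>M)"
    unfolding L2_norm_power2 using i by simp
  also have "\<dots> = 2 * (L2_norm M f)\<^sup>2 + 2 * (L2_norm M g)\<^sup>2"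
    unfolding p L2_norm_power2 using i by simp
  finally show ?thesis .
qed

context twisted_system begin

definition koop_avg :: "('a \<Rightarrow> complex) \<Rightarrow> nat \<Rightarrow> 'a \<Rightarrow> complex" where
  "koop_avg h n x = complex_of_real (1 / real n) * koop_sum h n x"

lemma koop_sum_measurable: "h \<in> borel_measurable M \<Longrightarrow> koop_sum h n \<in> borel_measurable M"
  unfolding koop_sum_def[abs_def] by (intro borel_measurable_sum koop_measurable)

lemma koop_avg_measurable: "h \<in> borel_measurable M \<Longrightarrow> koop_avg h n \<in> borel_measurable M"
  unfolding koop_avg_def[abs_def] by (rule borel_measurable_times[OF borel_measurable_const koop_sum_measurable])

lemma koop_avg_square_integrable: "square_integrable M h \<Longrightarrow> square_integrable M (koop_avg h n)"
  unfolding koop_avg_def[abs_def] by (intro square_integrable_cmult koop_sum_square_integrable)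

lemma L2_norm_koop_avg_le:
  assumes "square_integrable M h"
  shows "L2_norm M (koop_avg h n) \<le> L2_norm M h"
proof (cases "n = 0")
  case True
  then show ?thesis by (simp add: koop_avg_def[abs_def])
next
  case False
  have "L2_norm M (koop_sum h n) \<le> (\<Sum>k=1..n. L2_norm M (koop k h))"
    unfolding koop_sum_def[abs_def] by (rule square_integrable_sum(2)) (rule koop_square_integrable[OF assms])
  also have "\<dots> = real n * L2_norm M h" by (simp add: koop_square_integrable(2)[OF assms])
  finally show ?thesis
    unfolding koop_avg_def[abs_def] square_integrable_cmult(2)[OF koop_sum_square_integrable[OF assms]]
    using False by (simp add: field_simps norm_divide)
qed

lemma cmod_koop_sum_le:
  assumes "\<And>x. cmod (h x) \<le> B"
  shows "cmod (koop_sum h n x) \<le> real n * B"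
proof -
  have "cmod (koop_sum h n x) \<le> (\<Sum>k=1..n. B)"
    unfolding koop_sum_def by (intro sum_norm_le) (simp add: assms)
  then show ?thesis by simp
qed

lemma cmod_koop_avg_le:
  assumes "\<And>x. cmod (h x) \<le> B"
  shows "cmod (koop_avg h n x) \<le> B"
proof (cases "n = 0")
  case True
  then show ?thesis using assms[of x] norm_ge_zero[of "h x"] by (simp add: koop_avg_def del: norm_ge_zero)
next
  case False
  then show ?thesis using cmod_koop_sum_le[of h B n x, OF assms] by (simp add: koop_avg_def norm_mult norm_divide field_simps)
qed

lemma koop_koop_sum_diff:
  assumes "\<And>x. cmod (h x) \<le> B"
  shows "cmod (koop i (koop_sum h n) x - koop_sum h n x) \<le> 2 * real i * B"
proof -
  have "koop i (koop_sum h n) x - koop_sum h n x = koop n (koop_sum h i) x - koop_sum h i x"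
    using koop_sum_add_index[of h i n x] koop_sum_add_index[of h n i x] by (simp add: add.commute algebra_simps)
  also have "cmod \<dots> \<le> cmod (koop n (koop_sum h i) x) + cmod (koop_sum h i x)" by (rule norm_triangle_ineq4)
  also have "\<dots> \<le> real i * B + real i * B"
    unfolding cmod_koop by (intro add_mono cmod_koop_sum_le assms)
  also have "\<dots> = 2 * real i * B" by simp
  finally show ?thesis .
qed

text \<open>Averaging once more over a fixed number of steps changes a long average by boundary terms only.\<close>

lemma koop_avg_avg_diff:
  assumes h: "\<And>x. cmod (h x) \<le> B" and m: "0 < m"
  shows "cmod (koop_avg (koop_avg h m) n x - koop_avg h n x) \<le> 2 * real m * B / real n"
proof (cases "n = 0")
  case True
  then show ?thesis by (simp add: koop_avg_def)
next
  case False
  have B: "0 \<le> B" using h[of x] norm_ge_zero[of "h x"] by linarith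
  have "koop_avg (koop_avg h m) n x - koop_avg h n x =
      complex_of_real (1 / real n) * (complex_of_real (1 / real m) * (\<Sum>i=1..m. koop i (koop_sum h n) x - koop_sum h n x))"
  proof -
    have "koop_sum (koop_avg h m) n x = complex_of_real (1 / real m) * koop_sum (koop_sum h m) n x"
      unfolding koop_avg_def[abs_def] by (rule koop_sum_cmult)
    also have "koop_sum (koop_sum h m) n x = (\<Sum>i=1..m. koop i (koop_sum h n) x)"
      by (subst koop_sum_commute) (simp add: koop_sum_def[of "koop_sum h n"])
    also have "\<dots> = (\<Sum>i=1..m. koop i (koop_sum h n) x - koop_sum h n x) + of_nat m * koop_sum h n x"
      by (simp add: sum_subtractf)
    finally have t: "koop_sum (koop_avg h m) n x = complex_of_real (1 / real m) * (\<Sum>i=1..m. koop i (koop_sum h n) x - koop_sum h n x) + koop_sum h n x"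
      using m by (simp add: distrib_left)
    show ?thesis unfolding koop_avg_def[of "koop_avg h m"] koop_avg_def[of h n] t by (simp add: algebra_simps)
  qed
  then have "cmod (koop_avg (koop_avg h m) n x - koop_avg h n x) = 1 / real n * (1 / real m * cmod (\<Sum>i=1..m. koop i (koop_sum h n) x - koop_sum h n x))"
    by (simp add: norm_mult norm_divide)
  also have "cmod (\<Sum>i=1..m. koop i (koop_sum h n) x - koop_sum h n x) \<le> (\<Sum>i=1..m. 2 * real m * B)"
  proof (rule sum_norm_le)
    fix i assume "i \<in> {1..m}"
    then have "2 * real i * B \<le> 2 * real m * B" using B by (intro mult_right_mono) auto
    then show "cmod (koop i (koop_sum h n) x - koop_sum h n x) \<le> 2 * real m * B"
      using koop_koop_sum_diff[of h B i n x, OF h] by linarith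
  qed
  finally show ?thesis using m False by (simp add: field_simps)
qed

text \<open>The minimal norm argument of F. Riesz. The norms of the averages decrease to their infimum \<open>K\<close> up to boundary
  terms, and midpoints of two averages have norm at least \<open>K\<close> as well; so the parallelogram identity makes the averages a
  Cauchy sequence. Along a fast subsequence they converge almost surely, the limit is invariant, and the
  hypothesis \<open>noinv\<close> forces it to vanish. Boundedness of \<open>h\<close> replaces the completeness of \<open>L\<^sup>2\<close> by dominated
  convergence. For \<open>e = 1\<close> the constants are invariant, hence the condition on the means.\<close>

lemma mean_ergodic:
  assumes hm: "h \<in> borel_measurable M" and hB: "\<And>x. cmod (h x) \<le> B"
    and mean: "e = 1 \<Longrightarrow> (\<integral>x. h x \<partial>M) = 0"
    and noinv: "\<And>g. square_integrable M g \<Longrightarrow> (AE x in M. e * g (T x) = g x) \<Longrightarrow>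
       (e = 1 \<Longrightarrow> (\<integral>x. g x \<partial>M) = 0) \<Longrightarrow> (AE x in M. g x = 0)"
  shows "(\<lambda>n. L2_norm M (koop_avg h n)) \<longlonglongrightarrow> 0"
proof -
  have B: "0 \<le> B" using hB[of undefined] norm_ge_zero[of "h undefined"] by linarith
  have h: "square_integrable M h" by (rule bounded_square_integrable[OF hm _ B]) (simp add: hB)
  note Am = koop_avg_measurable[OF hm] and As = koop_avg_square_integrable[OF h] and AB = cmod_koop_avg_le[of h B, OF hB]
  define a where "a n = L2_norm M (koop_avg h n)" for n
  have a0: "0 \<le> a n" for n by (simp add: a_def)
  define K where "K = Inf (a ` {1..})"
  have bdd: "bdd_below (a ` {1..})" by (rule bdd_belowI[of _ 0]) (auto simp: a0)
  have K: "K \<le> a n" if "1 \<le> n" for n unfolding K_def by (rule cInf_lower[OF _ bdd]) (use that in auto)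
  have K0: "0 \<le> K" unfolding K_def by (rule cInf_greatest) (auto simp: a0)
  have diff: "L2_norm M (\<lambda>x. koop_avg (koop_avg h m) n x - koop_avg h n x) \<le> 2 * real m * B / real n" if "0 < m" for m n
    by (rule bounded_square_integrable(2))
       (use koop_avg_avg_diff[of h B m n, OF hB that] B in \<open>auto intro!: borel_measurable_diff koop_avg_measurable Am\<close>)
  have upper: "a n \<le> a m + 2 * real m * B / real n" if "0 < m" for m n
  proof -
    have "a n \<le> L2_norm M (koop_avg (koop_avg h m) n) + L2_norm M (\<lambda>x. koop_avg (koop_avg h m) n x - koop_avg h n x)"
      using square_integrable_minus(2)[OF koop_avg_square_integrable[OF As[of m], of n] square_integrable_minus(1)[OF koop_avg_square_integrable[OF As[of m], of n] As[of n]]]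
      by (simp add: a_def)
    also have "\<dots> \<le> a m + 2 * real m * B / real n"
      using L2_norm_koop_avg_le[OF As[of m], of n] diff[OF that, of n] by (simp add: a_def)
    finally show ?thesis .
  qed
  have small: "(\<lambda>n. C / real n) \<longlonglongrightarrow> 0" for C :: real
    by (rule lim_const_over_n)
  have mid: "2 * K \<le> L2_norm M (\<lambda>x. koop_avg h m x + koop_avg h p x)" if mp: "0 < m" "0 < p" for m p
  proof -
    let ?u = "\<lambda>x. koop_avg h m x + koop_avg h p x"
    have u: "square_integrable M ?u" by (rule square_integrable_add[OF As As])
    have le: "2 * K \<le> L2_norm M ?u + 2 * real (m + p) * B / real n" if n: "1 \<le> n" for n
    proof -
      have e: "koop_avg ?u n x = koop_avg (koop_avg h m) n x + koop_avg (koop_avg h p) n x" for x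
        by (simp add: koop_avg_def[of ?u] koop_avg_def[of "koop_avg h m" n] koop_avg_def[of "koop_avg h p" n] koop_sum_add distrib_left)
      let ?d = "\<lambda>x. koop_avg ?u n x - 2 * koop_avg h n x"
      have "L2_norm M ?d \<le> 2 * real (m + p) * B / real n"
      proof (rule bounded_square_integrable(2))
        show "?d \<in> borel_measurable M"
          by (intro borel_measurable_diff borel_measurable_times borel_measurable_const koop_avg_measurable borel_measurable_add Am)
        have "cmod (?d x) \<le> 2 * real (m + p) * B / real n" for x
        proof -
          have "?d x = (koop_avg (koop_avg h m) n x - koop_avg h n x) + (koop_avg (koop_avg h p) n x - koop_avg h n x)" unfolding e by simp
          then have "cmod (?d x) \<le> 2 * real m * B / real n + 2 * real p * B / real n"
            using koop_avg_avg_diff[of h B m n x, OF hB mp(1)] koop_avg_avg_diff[of h B p n x, OF hB mp(2)]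
              norm_triangle_ineq[of "koop_avg (koop_avg h m) n x - koop_avg h n x" "koop_avg (koop_avg h p) n x - koop_avg h n x"] by simp
          then show ?thesis by (simp add: add_divide_distrib algebra_simps)
        qed
        then show "AE x in M. cmod (?d x) \<le> 2 * real (m + p) * B / real n" by simp
        show "0 \<le> 2 * real (m + p) * B / real n" using B by simp
      qed
      moreover have "L2_norm M (\<lambda>x. 2 * koop_avg h n x) = 2 * a n"
        using square_integrable_cmult(2)[OF As[of n], of 2] by (simp add: a_def)
      moreover have "L2_norm M (\<lambda>x. 2 * koop_avg h n x) \<le> L2_norm M (koop_avg ?u n) + L2_norm M ?d"
        using square_integrable_minus(2)[OF koop_avg_square_integrable[OF u, of n]
          square_integrable_minus(1)[OF koop_avg_square_integrable[OF u, of n] square_integrable_cmult(1)[OF As[of n], of 2]]] by simp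
      ultimately show ?thesis using K[OF n] L2_norm_koop_avg_le[OF u, of n] by linarith
    qed
    have "(\<lambda>n. L2_norm M ?u + 2 * real (m + p) * B / real n) \<longlonglongrightarrow> L2_norm M ?u + 0"
      by (intro tendsto_intros small)
    then have "2 * K \<le> L2_norm M ?u + 0"
      by (rule LIMSEQ_le_const) (use le in auto)
    then show ?thesis by simp
  qed
  have cauchy: "\<exists>N\<ge>1. \<forall>n\<ge>N. \<forall>p\<ge>N. L2_norm M (\<lambda>x. koop_avg h n x - koop_avg h p x) \<le> \<epsilon>" if eps: "0 < \<epsilon>" for \<epsilon>
  proof -
    \<comment> \<open>Chosen so that norms in \<open>[K, K + \<delta>]\<close> make the differences at most \<open>\<epsilon>\<close> by the parallelogram identity; see \<open>d2\<close>.\<close>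
    define \<delta> where "\<delta> = min 1 (\<epsilon>\<^sup>2 / (8 * K + 4))"
    have d: "0 < \<delta>" "\<delta> \<le> 1" using eps K0 by (auto simp: \<delta>_def)
    have d2: "4 * (K + \<delta>)\<^sup>2 - 4 * K\<^sup>2 \<le> \<epsilon>\<^sup>2"
    proof -
      have "4 * (K + \<delta>)\<^sup>2 - 4 * K\<^sup>2 = \<delta> * (8 * K + 4 * \<delta>)" by (simp add: power2_eq_square algebra_simps)
      also have "\<dots> \<le> \<delta> * (8 * K + 4)" using d by (intro mult_left_mono) auto
      also have "\<dots> \<le> \<epsilon>\<^sup>2 / (8 * K + 4) * (8 * K + 4)" using K0 by (intro mult_right_mono) (auto simp: \<delta>_def)
      also have "\<dots> = \<epsilon>\<^sup>2" using K0 by simp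
      finally show ?thesis .
    qed
    have "\<exists>y\<in>a ` {1..}. y < K + \<delta> / 2"
      using cInf_less_iff[OF _ bdd, of "K + \<delta> / 2"] d by (auto simp: K_def)
    then obtain m where m: "1 \<le> m" "a m < K + \<delta> / 2" by auto
    have "eventually (\<lambda>n. 2 * real m * B / real n < \<delta> / 2) sequentially"
      using small[of "2 * real m * B"] d by (intro order_tendstoD(2)) auto
    then obtain N where N: "\<And>n. N \<le> n \<Longrightarrow> 2 * real m * B / real n < \<delta> / 2" by (auto simp: eventually_sequentially)
    have an: "a n \<le> K + \<delta>" if "N \<le> n" for n using upper[of m n] m N[OF that] by auto
    show ?thesis
    proof (intro exI[of _ "max N 1"] conjI allI impI)
      fix n p assume np: "max N 1 \<le> n" "max N 1 \<le> p"
      have sq: "x\<^sup>2 \<le> y\<^sup>2" if "0 \<le> x" "x \<le> y" for x y :: real using that by (intro power_mono)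
      have "(L2_norm M (\<lambda>x. koop_avg h n x - koop_avg h p x))\<^sup>2 =
         2 * (a n)\<^sup>2 + 2 * (a p)\<^sup>2 - (L2_norm M (\<lambda>x. koop_avg h n x + koop_avg h p x))\<^sup>2"
        using parallelogram_L2[OF As[of n] As[of p]] by (simp add: a_def)
      also have "\<dots> \<le> 2 * (K + \<delta>)\<^sup>2 + 2 * (K + \<delta>)\<^sup>2 - (2 * K)\<^sup>2"
        using sq[OF a0 an, of n] sq[OF a0 an, of p] sq[OF _ mid, of n p] K0 np by simp
      also have "\<dots> = 4 * (K + \<delta>)\<^sup>2 - 4 * K\<^sup>2" by (simp add: power_mult_distrib)
      also have "\<dots> \<le> \<epsilon>\<^sup>2" by (rule d2)
      finally show "L2_norm M (\<lambda>x. koop_avg h n x - koop_avg h p x) \<le> \<epsilon>"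
        by (rule power2_le_imp_le) (use eps in simp)
    qed simp
  qed
  have "\<forall>j. \<exists>N\<ge>1. \<forall>n\<ge>N. \<forall>p\<ge>N. L2_norm M (\<lambda>x. koop_avg h n x - koop_avg h p x) \<le> (1 / 2) ^ j"
    using cauchy by simp
  then obtain N where N: "\<And>j. 1 \<le> N j" "\<And>j n p. N j \<le> n \<Longrightarrow> N j \<le> p \<Longrightarrow> L2_norm M (\<lambda>x. koop_avg h n x - koop_avg h p x) \<le> (1 / 2) ^ j"
    by metis
  \<comment> \<open>The sum dominates all the earlier thresholds, so consecutive terms of the subsequence are \<open>2\<^sup>-\<^sup>j\<close> close.\<close>
  define \<nu> where "\<nu> j = (\<Sum>i\<le>j. N i) + j" for j
  have nuN: "N j \<le> \<nu> j" "N j \<le> \<nu> (Suc j)" for j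
  proof -
    have "N j \<le> (\<Sum>i\<le>j. N i)" by (rule member_le_sum) auto
    then show "N j \<le> \<nu> j" "N j \<le> \<nu> (Suc j)" by (auto simp: \<nu>_def)
  qed
  have nuj: "j \<le> \<nu> j" "1 \<le> \<nu> j" for j using nuN(1)[of j] N(1)[of j] by (auto simp: \<nu>_def)
  define g where "g x = lim (\<lambda>j. koop_avg h (\<nu> j) x)" for x
  have gm: "g \<in> borel_measurable M" unfolding g_def[abs_def] by (rule borel_measurable_lim_metric) (rule Am)
  have conv: "AE x in M. (\<lambda>j. koop_avg h (\<nu> j) x) \<longlonglongrightarrow> g x"
  proof -
    let ?Y = "\<lambda>j x. ennreal (cmod (koop_avg h (\<nu> (Suc j)) x - koop_avg h (\<nu> j) x))"
    have "AE x in M. (\<forall>j. ?Y j x \<noteq> top) \<and> summable (\<lambda>j. enn2real (?Y j x))"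
    proof (rule AE_summable_of_nn_integral_le)
      show "?Y j \<in> borel_measurable M" for j using Am[of "\<nu> (Suc j)"] Am[of "\<nu> j"] by measurable
      show "(\<integral>\<^sup>+x. ?Y j x \<partial>M) \<le> ennreal ((1 / 2) ^ j)" for j
      proof -
        note d = square_integrable_minus(1)[OF As[of "\<nu> (Suc j)"] As[of "\<nu> j"]]
        note di = square_integrable_imp_integrable[OF d]
        have "(\<integral>\<^sup>+x. ?Y j x \<partial>M) = ennreal (\<integral>x. cmod (koop_avg h (\<nu> (Suc j)) x - koop_avg h (\<nu> j) x) \<partial>M)"
          using di(1) by (intro nn_integral_eq_integral) auto
        also have "\<dots> \<le> ennreal ((1 / 2) ^ j)"
          using di(2) N(2)[OF nuN(2) nuN(1), of j] by (intro ennreal_leI) linarith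
        finally show ?thesis .
      qed
      show "summable (\<lambda>j. (1 / 2 :: real) ^ j)" by (rule summable_geometric) simp
    qed simp
    then show ?thesis
    proof eventually_elim
      case (elim x)
      then have "summable (\<lambda>j. koop_avg h (\<nu> (Suc j)) x - koop_avg h (\<nu> j) x)"
        by - (rule summable_norm_cancel, simp)
      then have "convergent (\<lambda>n. \<Sum>j<n. koop_avg h (\<nu> (Suc j)) x - koop_avg h (\<nu> j) x)"
        by (simp add: summable_iff_convergent)
      then have "convergent (\<lambda>n. koop_avg h (\<nu> n) x - koop_avg h (\<nu> 0) x)"
        by (simp only: sum_lessThan_telescope[of "\<lambda>n. koop_avg h (\<nu> n) x"])
      then have "convergent (\<lambda>n. (koop_avg h (\<nu> n) x - koop_avg h (\<nu> 0) x) + koop_avg h (\<nu> 0) x)"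
        by (rule convergent_add) (rule convergent_const)
      then have "convergent (\<lambda>n. koop_avg h (\<nu> n) x)" by simp
      then show ?case by (simp add: g_def convergent_LIMSEQ_iff)
    qed
  qed
  have gB: "AE x in M. cmod (g x) \<le> B"
    using conv by eventually_elim (rule LIMSEQ_le_const2[OF tendsto_norm], use AB in auto)
  have g: "square_integrable M g" by (rule bounded_square_integrable[OF gm gB B])
  have nu_top: "filterlim \<nu> at_top sequentially"
    by (rule filterlim_at_top_mono[OF filterlim_ident]) (use nuj in auto)
  have small_nu: "(\<lambda>j. C / real (\<nu> j)) \<longlonglongrightarrow> 0" for C :: real
    using filterlim_compose[OF small nu_top] by simp
  have inv: "AE x in M. e * g (T x) = g x"
    using conv AE_T_pow[OF conv, of 1]
  proof eventually_elim
    case (elim x)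
    have "(\<lambda>j. e * koop_avg h (\<nu> j) (T x) - koop_avg h (\<nu> j) x) \<longlonglongrightarrow> e * g (T x) - g x"
      using elim by (intro tendsto_intros) auto
    moreover have "(\<lambda>j. e * koop_avg h (\<nu> j) (T x) - koop_avg h (\<nu> j) x) \<longlonglongrightarrow> 0"
    proof (rule Lim_null_comparison[OF _ small_nu[of "2 * B"]], rule always_eventually, rule allI)
      fix j
      have "e * koop_avg h (\<nu> j) (T x) - koop_avg h (\<nu> j) x =
         complex_of_real (1 / real (\<nu> j)) * (koop 1 (koop_sum h (\<nu> j)) x - koop_sum h (\<nu> j) x)"
        by (simp add: koop_avg_def koop_def algebra_simps)
      then have "cmod (e * koop_avg h (\<nu> j) (T x) - koop_avg h (\<nu> j) x) = 1 / real (\<nu> j) * cmod (koop 1 (koop_sum h (\<nu> j)) x - koop_sum h (\<nu> j) x)"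
        by (simp add: norm_mult norm_divide)
      also have "\<dots> \<le> 1 / real (\<nu> j) * (2 * real 1 * B)" by (intro mult_left_mono koop_koop_sum_diff hB) simp
      finally show "cmod (e * koop_avg h (\<nu> j) (T x) - koop_avg h (\<nu> j) x) \<le> 2 * B / real (\<nu> j)" by simp
    qed
    ultimately have "e * g (T x) - g x = 0" by (rule LIMSEQ_unique)
    then show ?case by simp
  qed
  have "(\<integral>x. g x \<partial>M) = 0" if e1: "e = 1"
  proof -
    have "(\<lambda>j. \<integral>x. koop_avg h (\<nu> j) x \<partial>M) \<longlonglongrightarrow> (\<integral>x. g x \<partial>M)"
      by (rule integral_dominated_convergence[where w = "\<lambda>_. B"]) (use gm Am conv AB in auto)
    moreover have "(\<integral>x. koop_avg h n x \<partial>M) = 0" for n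
    proof -
      have "(\<integral>x. koop k h x \<partial>M) = 0" for k
        using integral_T_pow[OF hm, of k] mean[OF e1] by (simp add: koop_def)
      then show ?thesis
        unfolding koop_avg_def koop_sum_def
        using square_integrable_imp_integrable(1)[OF koop_square_integrable(1)[OF h]] by (simp add: Bochner_Integration.integral_sum)
    qed
    ultimately show ?thesis by (simp add: LIMSEQ_const_iff)
  qed
  then have g0: "AE x in M. g x = 0" by (rule noinv[OF g inv])
  have "(\<lambda>j. \<integral>x. (cmod (koop_avg h (\<nu> j) x))\<^sup>2 \<partial>M) \<longlonglongrightarrow> (\<integral>x. 0 \<partial>M)"
  proof (rule integral_dominated_convergence[where w = "\<lambda>_. B\<^sup>2"])
    show "AE x in M. (\<lambda>j. (cmod (koop_avg h (\<nu> j) x))\<^sup>2) \<longlonglongrightarrow> 0"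
      using conv g0
    proof eventually_elim
      case (elim x)
      then have "(\<lambda>j. (cmod (koop_avg h (\<nu> j) x))\<^sup>2) \<longlonglongrightarrow> (cmod 0)\<^sup>2" by (intro tendsto_intros) simp
      then show ?case by simp
    qed
    show "AE x in M. norm ((cmod (koop_avg h (\<nu> j) x))\<^sup>2) \<le> B\<^sup>2" for j
      using AB by (auto intro!: power_mono)
    show "(\<lambda>x. (cmod (koop_avg h (\<nu> j) x))\<^sup>2) \<in> borel_measurable M" for j by (rule cmod_power2_measurable[OF Am])
  qed auto
  then have "(\<lambda>j. (a (\<nu> j))\<^sup>2) \<longlonglongrightarrow> 0" by (simp add: a_def L2_norm_power2)
  then have anu: "(\<lambda>j. a (\<nu> j)) \<longlonglongrightarrow> 0" using tendsto_real_sqrt[of "\<lambda>j. (a (\<nu> j))\<^sup>2" 0] a0 by simp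
  show ?thesis
  proof (rule LIMSEQ_I)
    fix r :: real assume r: "0 < r"
    have "eventually (\<lambda>j. a (\<nu> j) < r / 2) sequentially" using anu r by (intro order_tendstoD(2)) auto
    then obtain j where j: "a (\<nu> j) < r / 2" by (auto simp: eventually_sequentially)
    have "eventually (\<lambda>n. 2 * real (\<nu> j) * B / real n < r / 2) sequentially"
      using small r by (intro order_tendstoD(2)) auto
    then obtain N where N: "\<And>n. N \<le> n \<Longrightarrow> 2 * real (\<nu> j) * B / real n < r / 2" by (auto simp: eventually_sequentially)
    have "norm (L2_norm M (koop_avg h n) - 0) < r" if "N \<le> n" for n
      using upper[of "\<nu> j" n] N[OF that] j nuj(2)[of j] a0[of n] by (simp add: a_def)
    then show "\<exists>no. \<forall>n\<ge>no. norm (L2_norm M (koop_avg h n) - 0) < r" by blast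
  qed
qed

end

section \<open>Ergodicity and orbit averages under the conditional laws\<close>

text \<open>The set where \<open>g\<close> is positive is invariant up to a null set. The points that visit it infinitely often form a
  strictly invariant set \<open>B\<close> that agrees with it almost surely, so \<open>g\<close> has almost surely one sign.\<close>

lemma (in prob_space) ergodic_invariant_zero:
  fixes g :: "'a \<Rightarrow> real"
  assumes inv: "invertible_mpt M T" and erg: "ergodic M T"
    and g: "integrable M g" and gT: "AE x in M. g (T x) = g x" and mean: "(\<integral>x. g x \<partial>M) = 0"
  shows "AE x in M. g x = 0"
proof -
  have T [measurable]: "T \<in> measurable M M" and bij: "bij_betw T (space M) (space M)" and pres: "distr M M T = M"
    using inv by (auto simp: invertible_mpt_def)
  have Tk [measurable]: "T ^^ k \<in> measurable M M" for k
  proof (induction k)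
    case (Suc k)
    have "T ^^ Suc k = (\<lambda>x. T ((T ^^ k) x))" by (simp add: fun_eq_iff)
    with Suc show ?case by simp
  qed (simp add: id_def)
  have gm [measurable]: "g \<in> borel_measurable M" using g by auto
  define B where "B = {x \<in> space M. \<forall>n. \<exists>k\<ge>n. 0 < g ((T ^^ k) x)}"
  have [measurable]: "(\<lambda>x. g ((T ^^ k) x)) \<in> borel_measurable M" for k
    by (rule measurable_compose[OF Tk gm])
  have Bm: "B \<in> sets M" unfolding B_def by measurable
  have shift: "T x \<in> B \<longleftrightarrow> x \<in> B" if x: "x \<in> space M" for x
  proof -
    have Tx: "T x \<in> space M" using measurable_space[OF T x] .
    have sw: "(T ^^ k) (T x) = (T ^^ Suc k) x" for k by (simp add: funpow_swap1)
    have "(\<forall>n. \<exists>k\<ge>n. 0 < g ((T ^^ Suc k) x)) \<longleftrightarrow> (\<forall>n. \<exists>k\<ge>n. 0 < g ((T ^^ k) x))"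
    proof
      assume a: "\<forall>n. \<exists>k\<ge>n. 0 < g ((T ^^ Suc k) x)"
      show "\<forall>n. \<exists>k\<ge>n. 0 < g ((T ^^ k) x)"
      proof
        fix n
        obtain k where "n \<le> k" "0 < g ((T ^^ Suc k) x)" using a by blast
        then show "\<exists>k\<ge>n. 0 < g ((T ^^ k) x)" by (intro exI[of _ "Suc k"]) auto
      qed
    next
      assume a: "\<forall>n. \<exists>k\<ge>n. 0 < g ((T ^^ k) x)"
      show "\<forall>n. \<exists>k\<ge>n. 0 < g ((T ^^ Suc k) x)"
      proof
        fix n
        obtain k where k: "Suc n \<le> k" "0 < g ((T ^^ k) x)" using a by blast
        then obtain k' where "k = Suc k'" by (cases k) auto
        with k show "\<exists>k\<ge>n. 0 < g ((T ^^ Suc k) x)" by (intro exI[of _ k']) auto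
      qed
    qed
    then show ?thesis using x Tx unfolding B_def mem_Collect_eq sw by blast
  qed
  have "T ` B = B"
  proof
    show "T ` B \<subseteq> B" using shift by (auto simp: B_def)
    show "B \<subseteq> T ` B"
    proof
      fix y assume y: "y \<in> B"
      then have "y \<in> T ` space M" using bij by (auto simp: B_def bij_betw_def)
      then obtain x where "x \<in> space M" "y = T x" by blast
      then show "y \<in> T ` B" using y shift by blast
    qed
  qed
  then have m01: "measure M B = 0 \<or> measure M B = 1" using erg Bm by (auto simp: ergodic_def)
  have "AE x in M. \<forall>k. g ((T ^^ k) x) = g x"
  proof (rule AE_all_countable[THEN iffD2], rule allI)
    fix k show "AE x in M. g ((T ^^ k) x) = g x"
    proof (induction k)
      case (Suc k)
      have "AE x in distr M M T. g ((T ^^ k) x) = g x" unfolding pres by (rule Suc)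
      from AE_distrD[OF T this] have "AE x in M. g ((T ^^ k) (T x)) = g (T x)" .
      with gT show ?case by eventually_elim (simp add: funpow_swap1)
    qed simp
  qed
  then have AEB: "AE x in M. x \<in> B \<longleftrightarrow> 0 < g x"
    by (rule AE_mp) (auto intro!: AE_I2 simp: B_def)
  from m01 show ?thesis
  proof
    assume "measure M B = 1"
    then have "AE x in M. x \<in> B" using prob_eq_1[OF Bm] by simp
    with AEB have "AE x in M. 0 \<le> g x" by eventually_elim auto
    then show ?thesis using integral_nonneg_eq_0_iff_AE[OF g] mean by simp
  next
    assume "measure M B = 0"
    then have "AE x in M. x \<notin> B" using prob_eq_0[OF Bm] by simp
    with AEB have "AE x in M. 0 \<le> - g x" by eventually_elim auto
    then have "AE x in M. - g x = 0"
      using integral_nonneg_eq_0_iff_AE[of M "\<lambda>x. - g x"] g mean by simp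
    then show ?thesis by simp
  qed
qed

lemma (in prob_space) ergodic_invariant_zero_complex:
  fixes g :: "'a \<Rightarrow> complex"
  assumes inv: "invertible_mpt M T" and erg: "ergodic M T"
    and g: "integrable M g" and gT: "AE x in M. g (T x) = g x" and mean: "(\<integral>x. g x \<partial>M) = 0"
  shows "AE x in M. g x = 0"
proof -
  have "AE x in M. Re (g x) = 0"
    using g gT mean integral_Re[OF g] by (intro ergodic_invariant_zero[OF inv erg integrable_Re[OF g]]) auto
  moreover have "AE x in M. Im (g x) = 0"
    using g gT mean integral_Im[OF g] by (intro ergodic_invariant_zero[OF inv erg integrable_Im[OF g]]) auto
  ultimately show ?thesis by eventually_elim (simp add: complex_eq_iff)
qed

context kernel_system begin

lemma bounded_kernel_integrable:
  fixes f :: "'a \<Rightarrow> 'b::{banach, second_countable_topology}"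
  assumes "f \<in> borel_measurable M" "\<And>x. x \<in> space M \<Longrightarrow> norm (f x) \<le> B" "\<omega> \<in> space M"
  shows "integrable (\<kappa> \<omega>) f" "norm (cexp f \<omega>) \<le> B"
proof -
  interpret K: prob_space "\<kappa> \<omega>" by (rule kernel_prob[OF assms(3)])
  have ae: "AE x in \<kappa> \<omega>. norm (f x) \<le> B" by (rule AE_I2) (use assms kernel_space in auto)
  show i: "integrable (\<kappa> \<omega>) f"
    by (rule K.integrable_const_bound[OF ae kernel_meas[OF assms(3,1)]])
  have "norm (cexp f \<omega>) \<le> (\<integral>x. norm (f x) \<partial>\<kappa> \<omega>)" unfolding cexp_def by (rule integral_norm_bound)
  also have "\<dots> \<le> (\<integral>x. B \<partial>\<kappa> \<omega>)" using i ae by (intro integral_mono_AE) auto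
  finally show "norm (cexp f \<omega>) \<le> B" by (simp add: K.prob_space)
qed

lemma bounded_integrable:
  fixes f :: "'a \<Rightarrow> 'b::{banach, second_countable_topology}"
  assumes "f \<in> borel_measurable M" "\<And>x. x \<in> space M \<Longrightarrow> norm (f x) \<le> B"
  shows "integrable M f"
  by (rule integrable_const_bound[OF _ assms(1)]) (use assms(2) in auto)

end

context twisted_system begin

text \<open>Mean convergence becomes convergence under almost every conditional law: a long average of \<open>h\<close> is nearly a long
  average of \<open>u = koop_avg h m\<close>, which is small in mean for large \<open>m\<close>, so the maximal inequality bounds its
  conditional means uniformly in \<open>n\<close>.\<close>

lemma quenched_average:
  assumes hm: "h \<in> borel_measurable M" and hB: "\<And>x. cmod (h x) \<le> B"
    and lim: "(\<lambda>n. L2_norm M (koop_avg h n)) \<longlonglongrightarrow> 0"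
  shows "AE \<omega> in M. (\<lambda>n. cexp (\<lambda>x. cmod (koop_avg h n x)) \<omega>) \<longlonglongrightarrow> 0"
proof -
  have B: "0 \<le> B" using hB[of undefined] norm_ge_zero[of "h undefined"] by linarith
  have h: "square_integrable M h" by (rule bounded_square_integrable[OF hm _ B]) (simp add: hB)
  note Am = koop_avg_measurable[OF hm] and As = koop_avg_square_integrable[OF h] and AB = cmod_koop_avg_le[of h B, OF hB]
  have "\<exists>m\<ge>1. L2_norm M (koop_avg h m) \<le> (1 / 4) ^ i" for i :: nat
  proof -
    have "eventually (\<lambda>n. L2_norm M (koop_avg h n) < (1 / 4) ^ i) sequentially"
      using lim by (intro order_tendstoD(2)) auto
    then obtain N where "\<And>n. N \<le> n \<Longrightarrow> L2_norm M (koop_avg h n) < (1 / 4) ^ i" by (auto simp: eventually_sequentially)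
    then show ?thesis by (intro exI[of _ "max N 1"]) (auto intro: less_imp_le)
  qed
  then obtain m where m: "\<And>i. 1 \<le> m i" "\<And>i. L2_norm M (koop_avg h (m i)) \<le> (1 / 4) ^ i" by metis
  define u where "u i x = cmod (koop_avg h (m i) x)" for i x
  have um: "u i \<in> borel_measurable M" for i unfolding u_def[abs_def] by (rule measurable_compose[OF Am borel_measurable_norm])
  have ui: "integrable M (u i)" for i unfolding u_def[abs_def] by (intro integrable_norm square_integrable_imp_integrable(1) As)
  define v where "v i = cexp (u i)" for i
  have vi: "integrable M (v i)" "(\<integral>x. v i x \<partial>M) = (\<integral>x. u i x \<partial>M)" for i
    unfolding v_def using cexp_integral[OF ui] by auto
  have vF: "v i \<in> borel_measurable F" for i unfolding v_def by (rule cexp_measurable_F[OF um])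
  have v0: "0 \<le> v i x" for i x unfolding v_def cexp_def u_def by (rule Bochner_Integration.integral_nonneg) simp
  have ae1: "AE \<omega> in M. (\<forall>i. orbit_max (v i) 1 \<omega> \<noteq> top) \<and> summable (\<lambda>i. enn2real (orbit_max (v i) 1 \<omega>))"
  proof (rule AE_summable_of_nn_integral_le)
    show "orbit_max (v i) 1 \<in> borel_measurable M" for i by (rule orbit_max_measurable[OF F_measurable[OF vF]])
    show "(\<integral>\<^sup>+\<omega>. orbit_max (v i) 1 \<omega> \<partial>M) \<le> ennreal (3 * (1 / 2) ^ i)" for i
    proof -
      have "(\<integral>x. v i x \<partial>M) \<le> (1 / 4) ^ i"
        using square_integrable_imp_integrable(2)[OF As[of "m i"]] m(2)[of i] unfolding vi(2) u_def by linarith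
      then have "sqrt (\<integral>x. v i x \<partial>M) \<le> sqrt ((1 / 4) ^ i)" by (rule real_sqrt_le_mono)
      also have "\<dots> = (1 / 2) ^ i" by (simp add: real_sqrt_power real_sqrt_divide)
      finally show ?thesis
        by (intro order_trans[OF nn_integral_orbit_max_le[OF vi(1) vF v0]] ennreal_leI) simp
    qed
    show "summable (\<lambda>i. 3 * (1 / 2 :: real) ^ i)" by (intro summable_mult summable_geometric) simp
  qed simp
  have ae2: "AE \<omega> in M. \<forall>i k. cexp (\<lambda>x. v i ((T ^^ k) x)) \<omega> = cexp (\<lambda>x. u i ((T ^^ k) x)) \<omega>"
    unfolding v_def by (rule AE_all_countable[THEN iffD2], rule allI, rule AE_all_countable[THEN iffD2], rule allI, rule cexp_tower_real[OF ui])
  show ?thesis using ae1 ae2 AE_space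
  proof eventually_elim
    case (elim \<omega>)
    define y where "y i = enn2real (orbit_max (v i) 1 \<omega>)" for i
    have y: "y \<longlonglongrightarrow> 0" using elim(1) unfolding y_def by (intro summable_LIMSEQ_zero) auto
    have nn: "0 \<le> cexp (\<lambda>x. cmod (koop_avg h n x)) \<omega>" for n
      unfolding cexp_def by (rule Bochner_Integration.integral_nonneg) simp
    have bound: "cexp (\<lambda>x. cmod (koop_avg h n x)) \<omega> \<le> 2 * (y i)\<^sup>2 + 2 * real (m i) * B / real n" if n: "1 \<le> n" for i n
    proof -
      let ?S = "\<lambda>x. (\<Sum>l<n. u i ((T ^^ (l * 1 + 1)) x))"
      have uB: "\<bar>u i x\<bar> \<le> B" for x using AB[of "m i" x] by (simp add: u_def)
      have umk: "(\<lambda>x. u i ((T ^^ k) x)) \<in> borel_measurable M" for k by (rule T_pow_measurable_comp[OF um])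
      have uki: "integrable (\<kappa> \<omega>) (\<lambda>x. u i ((T ^^ k) x))" for k
        by (rule bounded_kernel_integrable(1)[OF umk _ elim(3), of k B]) (simp add: uB)
      have le: "cmod (koop_avg h n x) \<le> 1 / real n * ?S x + 2 * real (m i) * B / real n" for x
      proof -
        have "cmod (koop_avg h n x) \<le> cmod (koop_avg (koop_avg h (m i)) n x) + cmod (koop_avg (koop_avg h (m i)) n x - koop_avg h n x)"
          using norm_triangle_sub[of "koop_avg h n x" "koop_avg (koop_avg h (m i)) n x"] by (simp add: norm_minus_commute)
        also have "cmod (koop_avg (koop_avg h (m i)) n x - koop_avg h n x) \<le> 2 * real (m i) * B / real n"
          by (rule koop_avg_avg_diff[of h B "m i" n x, OF hB]) (use m(1)[of i] in auto)
        also have "cmod (koop_avg (koop_avg h (m i)) n x) \<le> 1 / real n * ?S x"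
        proof -
          have "cmod (koop_sum (koop_avg h (m i)) n x) \<le> (\<Sum>k=1..n. cmod (koop k (koop_avg h (m i)) x))"
            unfolding koop_sum_def by (rule norm_sum)
          also have "\<dots> = (\<Sum>k=1..n. u i ((T ^^ k) x))" by (simp add: u_def)
          also have "\<dots> = ?S x"
            by (rule sum.reindex_bij_witness[of _ "\<lambda>l. l * 1 + 1" "\<lambda>k. k - 1"]) auto
          finally show ?thesis unfolding koop_avg_def[of "koop_avg h (m i)"]
            by (simp add: norm_mult norm_divide divide_right_mono)
        qed
        finally show ?thesis by simp
      qed
      have mi: "integrable (\<kappa> \<omega>) (\<lambda>x. 1 / real n * ?S x)"
        by (intro integrable_mult_right Bochner_Integration.integrable_sum uki)
      interpret K: prob_space "\<kappa> \<omega>" by (rule kernel_prob[OF elim(3)])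
      have "cexp (\<lambda>x. cmod (koop_avg h n x)) \<omega> \<le> (\<integral>x. 1 / real n * ?S x + 2 * real (m i) * B / real n \<partial>\<kappa> \<omega>)"
        unfolding cexp_def
      proof (rule integral_mono)
        show "integrable (\<kappa> \<omega>) (\<lambda>x. cmod (koop_avg h n x))"
          by (rule bounded_kernel_integrable(1)[OF measurable_compose[OF Am borel_measurable_norm] _ elim(3), of n B]) (simp add: AB)
        show "integrable (\<kappa> \<omega>) (\<lambda>x. 1 / real n * ?S x + 2 * real (m i) * B / real n)"
          using mi by (intro Bochner_Integration.integrable_add) auto
      qed (rule le)
      also have "\<dots> = 1 / real n * (\<integral>x. ?S x \<partial>\<kappa> \<omega>) + 2 * real (m i) * B / real n"
        using mi by (subst Bochner_Integration.integral_add) (simp_all add: K.prob_space)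
      also have "(\<integral>x. ?S x \<partial>\<kappa> \<omega>) = (\<Sum>l<n. cexp (\<lambda>x. v i ((T ^^ (l * 1 + 1)) x)) \<omega>)"
      proof -
        have e: "cexp (\<lambda>x. v i ((T ^^ k) x)) \<omega> = (\<integral>x. u i ((T ^^ k) x) \<partial>\<kappa> \<omega>)" for k
          using elim(2) by (simp add: cexp_def[of "\<lambda>x. u i ((T ^^ k) x)"])
        show ?thesis unfolding e by (rule Bochner_Integration.integral_sum) (rule uki)
      qed
      also have "\<dots> \<le> orbit_cexp (v i) 1 (Suc n) \<omega>" by (rule orbit_cexp_shift[OF v0])
      also have "\<dots> \<le> real (Suc n) * (y i)\<^sup>2"
      proof -
        have o0: "0 \<le> orbit_cexp (v i) 1 (Suc n) \<omega>"
          unfolding orbit_cexp_def cexp_def by (intro sum_nonneg Bochner_Integration.integral_nonneg v0)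
        have "sqrt (orbit_cexp (v i) 1 (Suc n) \<omega>) \<le> sqrt (real (Suc n)) * y i"
          unfolding y_def by (rule sqrt_orbit_cexp_le) (use elim(1) in auto)
        then have "(sqrt (orbit_cexp (v i) 1 (Suc n) \<omega>))\<^sup>2 \<le> (sqrt (real (Suc n)) * y i)\<^sup>2"
          by (rule power_mono) (use o0 in simp)
        then show ?thesis using o0 by (simp add: power_mult_distrib)
      qed
      finally have "cexp (\<lambda>x. cmod (koop_avg h n x)) \<omega> \<le> 1 / real n * (real (Suc n) * (y i)\<^sup>2) + 2 * real (m i) * B / real n"
        by (simp add: divide_right_mono)
      also have "1 / real n * (real (Suc n) * (y i)\<^sup>2) \<le> 2 * (y i)\<^sup>2"
      proof -
        have "1 / real n * real (Suc n) \<le> 2" using n by (simp add: field_simps)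
        then have "(1 / real n * real (Suc n)) * (y i)\<^sup>2 \<le> 2 * (y i)\<^sup>2" by (intro mult_right_mono) auto
        then show ?thesis by (simp add: mult.assoc)
      qed
      finally show ?thesis by simp
    qed
    show ?case
    proof (rule LIMSEQ_I)
      fix r :: real assume r: "0 < r"
      have "(\<lambda>i. 2 * (y i)\<^sup>2) \<longlonglongrightarrow> 2 * 0\<^sup>2" by (intro tendsto_intros y)
      then have "eventually (\<lambda>i. 2 * (y i)\<^sup>2 < r / 2) sequentially" by (rule order_tendstoD(2)) (use r in simp)
      then obtain i where i: "2 * (y i)\<^sup>2 < r / 2" by (auto simp: eventually_sequentially)
      have "eventually (\<lambda>n. 2 * real (m i) * B / real n < r / 2) sequentially"
        using lim_const_over_n[of "2 * real (m i) * B"] r by (intro order_tendstoD(2)) auto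
      then obtain N where N: "\<And>n. N \<le> n \<Longrightarrow> 2 * real (m i) * B / real n < r / 2" by (auto simp: eventually_sequentially)
      have "norm (cexp (\<lambda>x. cmod (koop_avg h n x)) \<omega> - 0) < r" if "max N 1 \<le> n" for n
        using bound[of n i] N[of n] i nn[of n] that by simp
      then show "\<exists>no. \<forall>n\<ge>no. norm (cexp (\<lambda>x. cmod (koop_avg h n x)) \<omega> - 0) < r" by blast
    qed
  qed
qed

end

section \<open>The quenched central limit theorem for bounded martingale differences\<close>

lemma exp_diff_le:
  fixes a b C :: real
  assumes "a \<le> C" "b \<le> C"
  shows "\<bar>exp a - exp b\<bar> \<le> exp C * \<bar>a - b\<bar>"
proof -
  have *: "exp a - exp b \<le> exp C * (a - b)" if "b \<le> a" "a \<le> C" for a b :: real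
  proof -
    have "1 - exp (b - a) \<le> a - b" using exp_ge_add_one_self[of "b - a"] by linarith
    then have "exp a * (1 - exp (b - a)) \<le> exp a * (a - b)" by (intro mult_left_mono) auto
    also have "exp a * (1 - exp (b - a)) = exp a - exp b" by (simp add: right_diff_distrib flip: exp_add)
    also have "exp a * (a - b) \<le> exp C * (a - b)" using that by (intro mult_right_mono) auto
    finally show ?thesis .
  qed
  show ?thesis
  proof (cases "b \<le> a")
    case True
    then show ?thesis using *[of b a] assms by simp
  next
    case False
    then show ?thesis using *[of a b] assms by (simp add: abs_minus_commute)
  qed
qed

lemma exp_mult_compl_le:
  fixes v :: real
  assumes "0 \<le> v" "v \<le> 1"
  shows "\<bar>exp v * (1 - v) - 1\<bar> \<le> v\<^sup>2"
proof -
  have "1 - v \<le> exp (- v)" using exp_ge_add_one_self[of "- v"] by simp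
  then have "exp v * (1 - v) \<le> exp v * exp (- v)" by (intro mult_left_mono) auto
  then have 1: "exp v * (1 - v) \<le> 1" by (simp flip: exp_add)
  have "(1 + v) * (1 - v) \<le> exp v * (1 - v)"
    using assms exp_ge_add_one_self[of v] by (intro mult_right_mono) auto
  then have "1 - v\<^sup>2 \<le> exp v * (1 - v)" by (simp add: power2_eq_square algebra_simps)
  with 1 show ?thesis by simp
qed

lemma iexp_quadratic:
  fixes y :: real
  shows "cmod (exp (\<i> * complex_of_real y) - (complex_of_real (1 - y\<^sup>2 / 2) + \<i> * complex_of_real y)) \<le> \<bar>y\<bar> ^ 3"
proof -
  have S: "(\<Sum>k\<le>2. (\<i> * complex_of_real y) ^ k / fact k) = complex_of_real (1 - y\<^sup>2 / 2) + \<i> * complex_of_real y"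
    by (simp add: numeral_2_eq_2 power_mult_distrib)
  have "cmod (exp (\<i> * complex_of_real y) - (\<Sum>k\<le>2. (\<i> * complex_of_real y) ^ k / fact k)) \<le> \<bar>y\<bar> ^ Suc 2 / fact (Suc 2)"
    by (rule iexp_approx1)
  also have "\<dots> \<le> \<bar>y\<bar> ^ Suc 2 / 1" by (intro divide_left_mono) (auto simp: fact_ge_1)
  finally show ?thesis unfolding S by (simp add: numeral_3_eq_3 numeral_2_eq_2)
qed

lemma Re_power2: "(Re z)\<^sup>2 = ((cmod z)\<^sup>2 + Re (z\<^sup>2)) / 2"
  unfolding cmod_power2 by (simp add: power2_eq_square)

context twisted_system begin

context
  fixes g :: "'a \<Rightarrow> complex" and K :: real and c :: complex
  assumes gF: "g \<in> borel_measurable F" and gK: "\<And>x. cmod (g x) \<le> K"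
begin

abbreviation d where "d \<equiv> mart_diff 1 g"

lemma K_nonneg: "0 \<le> K"
  using gK[of undefined] norm_ge_zero[of "g undefined"] by linarith

lemma g_square_integrable: "square_integrable M g"
  by (rule bounded_square_integrable[OF F_measurable[OF gF] _ K_nonneg]) (simp add: gK)

lemma d_measurable: "d \<in> borel_measurable M"
  using square_integrableD(1)[OF mart_diff_square_integrable[OF g_square_integrable, of 1]] .

lemma d_bound: "x \<in> space M \<Longrightarrow> cmod (d x) \<le> 2 * K"
proof -
  assume x: "x \<in> space M"
  have "cmod (cexp (koop 1 g) x) \<le> K"
    by (rule bounded_kernel_integrable(2)[OF koop_measurable[OF F_measurable[OF gF]] _ x]) (simp add: gK)
  then show ?thesis
    using norm_triangle_ineq4[of "koop 1 g x" "cexp (koop 1 g) x"] gK[of "(T ^^ 1) x"]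
    unfolding mart_diff_def by (simp only: cmod_koop)
qed

lemma d_F_at:
  assumes "Suc j \<le> k"
  shows "(\<lambda>x. d ((T ^^ j) x)) \<in> borel_measurable (F_at k)"
proof -
  have e: "d ((T ^^ j) x) = e * g ((T ^^ Suc j) x) - cexp (koop 1 g) ((T ^^ j) x)" for x
    by (simp add: mart_diff_def koop_def)
  have "(\<lambda>x. g ((T ^^ Suc j) x)) \<in> borel_measurable (F_at k)"
    by (rule F_at_measurable[OF gF assms])
  moreover have "(\<lambda>x. cexp (koop 1 g) ((T ^^ j) x)) \<in> borel_measurable (F_at k)"
    by (rule F_at_measurable[OF cexp_measurable_F[OF koop_measurable[OF F_measurable[OF gF]]]]) (use assms in simp)
  ultimately show ?thesis unfolding e by measurable
qed

text \<open>Outside \<open>space M\<close> the kernel is arbitrary; the indicator makes the bounds hold everywhere.\<close>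

definition cmoment_abs :: "'a \<Rightarrow> real" where
  "cmoment_abs x = indicator (space M) x * cexp (\<lambda>x. (cmod (d x))\<^sup>2) x"

definition cmoment_sq :: "'a \<Rightarrow> complex" where
  "cmoment_sq x = indicator (space M) x * cexp (\<lambda>x. (d x)\<^sup>2) x"

text \<open>The conditional variance of \<open>Re (c * U\<^sup>k d)\<close> at time \<open>k\<close>, pulled back to time \<open>0\<close>; see \<open>cond_var_eq\<close>.\<close>

definition cond_var :: "nat \<Rightarrow> 'a \<Rightarrow> real" where
  "cond_var k x = ((cmod c)\<^sup>2 * cmoment_abs x + Re (c\<^sup>2 * (e\<^sup>2) ^ k * cmoment_sq x)) / 2"

lemma d2_measurable: "(\<lambda>x. (cmod (d x))\<^sup>2) \<in> borel_measurable M" "(\<lambda>x. (d x)\<^sup>2) \<in> borel_measurable M"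
  using d_measurable by measurable

lemma cmoment_measurable [measurable]: "cmoment_abs \<in> borel_measurable F" "cmoment_sq \<in> borel_measurable F"
proof -
  have [measurable]: "space M \<in> sets F" using sets.top[of F] by simp
  note [measurable] = cexp_measurable_F[OF d2_measurable(1)] cexp_measurable_F[OF d2_measurable(2)]
  show "cmoment_abs \<in> borel_measurable F" "cmoment_sq \<in> borel_measurable F"
    unfolding cmoment_abs_def[abs_def] cmoment_sq_def[abs_def] by measurable
qed

lemma cond_var_measurable: "cond_var k \<in> borel_measurable F"
  unfolding cond_var_def[abs_def] by measurable

lemma cmoment_bounds: "0 \<le> cmoment_abs x" "cmoment_abs x \<le> (2 * K)\<^sup>2" "cmod (cmoment_sq x) \<le> (2 * K)\<^sup>2"
proof -
  show "0 \<le> cmoment_abs x" unfolding cmoment_abs_def cexp_def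
    by (intro mult_nonneg_nonneg Bochner_Integration.integral_nonneg) auto
  have b: "(cmod (d y))\<^sup>2 \<le> (2 * K)\<^sup>2" if "y \<in> space M" for y
    using d_bound[OF that] by (intro power_mono) auto
  show "cmoment_abs x \<le> (2 * K)\<^sup>2"
  proof (cases "x \<in> space M")
    case True
    have "norm (cexp (\<lambda>x. (cmod (d x))\<^sup>2) x) \<le> (2 * K)\<^sup>2"
      by (rule bounded_kernel_integrable(2)[OF d2_measurable(1) _ True]) (use b in simp)
    then show ?thesis using True by (simp add: cmoment_abs_def)
  qed (simp add: cmoment_abs_def)
  show "cmod (cmoment_sq x) \<le> (2 * K)\<^sup>2"
  proof (cases "x \<in> space M")
    case True
    have "norm (cexp (\<lambda>x. (d x)\<^sup>2) x) \<le> (2 * K)\<^sup>2"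
      by (rule bounded_kernel_integrable(2)[OF d2_measurable(2) _ True]) (use b in \<open>simp add: norm_power\<close>)
    then show ?thesis using True by (simp add: cmoment_sq_def)
  qed (simp add: cmoment_sq_def)
qed

lemma cond_var_eq:
  assumes "x \<in> space M"
  shows "cond_var k x = cexp (\<lambda>y. (Re (c * e ^ k * d y))\<^sup>2) x"
proof -
  have b: "norm ((cmod (d y))\<^sup>2) \<le> (2 * K)\<^sup>2" if "y \<in> space M" for y
    using power_mono[OF d_bound[OF that], of 2] by simp
  have i1: "integrable (\<kappa> x) (\<lambda>y. (cmod (d y))\<^sup>2)"
    by (rule bounded_kernel_integrable(1)[OF d2_measurable(1) _ assms]) (use b in simp)
  have i2: "integrable (\<kappa> x) (\<lambda>y. (d y)\<^sup>2)"
    by (rule bounded_kernel_integrable(1)[OF d2_measurable(2) _ assms, of "(2 * K)\<^sup>2"]) (use b in \<open>simp add: norm_power\<close>)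
  let ?a = "c\<^sup>2 * (e\<^sup>2) ^ k"
  have i3: "integrable (\<kappa> x) (\<lambda>y. ?a * (d y)\<^sup>2)" by (intro integrable_mult_right i2)
  have "(Re (c * e ^ k * d y))\<^sup>2 = ((cmod c)\<^sup>2 * (cmod (d y))\<^sup>2 + Re (?a * (d y)\<^sup>2)) / 2" for y
    unfolding Re_power2 by (simp add: norm_mult norm_power power_mult_distrib power_mult mult.commute[of k])
      (simp add: power_mult[symmetric] mult.commute)
  then have "cexp (\<lambda>y. (Re (c * e ^ k * d y))\<^sup>2) x = (\<integral>y. ((cmod c)\<^sup>2 * (cmod (d y))\<^sup>2 + Re (?a * (d y)\<^sup>2)) / 2 \<partial>\<kappa> x)"
    by (simp only: cexp_def)
  also have "\<dots> = ((cmod c)\<^sup>2 * (\<integral>y. (cmod (d y))\<^sup>2 \<partial>\<kappa> x) + Re (?a * (\<integral>y. (d y)\<^sup>2 \<partial>\<kappa> x))) / 2"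
    using i1 i3 integral_Re[OF i3] integrable_Re[OF i3] by (simp del: times_complex.sel)
  finally show ?thesis using assms by (simp add: cond_var_def cmoment_abs_def cmoment_sq_def cexp_def)
qed

definition cond_var_bound :: real where "cond_var_bound = (cmod c)\<^sup>2 * (2 * K)\<^sup>2"

lemma cond_var_bounds: "x \<in> space M \<Longrightarrow> 0 \<le> cond_var k x" "\<bar>cond_var k x\<bar> \<le> cond_var_bound"
proof -
  show "0 \<le> cond_var k x" if "x \<in> space M"
    unfolding cond_var_eq[OF that] cexp_def by (rule Bochner_Integration.integral_nonneg) simp
  have "\<bar>Re (c\<^sup>2 * (e\<^sup>2) ^ k * cmoment_sq x)\<bar> \<le> cmod (c\<^sup>2 * (e\<^sup>2) ^ k * cmoment_sq x)" by (rule abs_Re_le_cmod)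
  also have "\<dots> = (cmod c)\<^sup>2 * cmod (cmoment_sq x)" by (simp add: norm_mult norm_power)
  also have "\<dots> \<le> cond_var_bound" unfolding cond_var_bound_def by (intro mult_left_mono cmoment_bounds) simp
  finally have 1: "\<bar>Re (c\<^sup>2 * (e\<^sup>2) ^ k * cmoment_sq x)\<bar> \<le> cond_var_bound" .
  have "(cmod c)\<^sup>2 * cmoment_abs x \<le> cond_var_bound" "0 \<le> (cmod c)\<^sup>2 * cmoment_abs x"
    unfolding cond_var_bound_def using cmoment_bounds[of x] by (auto intro!: mult_left_mono)
  moreover have "\<bar>(a + r) / 2\<bar> \<le> b" if "\<bar>r\<bar> \<le> b" "a \<le> b" "0 \<le> a" for a b r :: real
    using that by (simp add: abs_le_iff)
  ultimately show "\<bar>cond_var k x\<bar> \<le> cond_var_bound" unfolding cond_var_def using 1 by blast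
qed

lemma cond_var_bound_nonneg: "0 \<le> cond_var_bound"
  by (simp add: cond_var_bound_def)

text \<open>One factor of the characteristic function of the normalised martingale, compensated by the exponential of half
  its conditional variance and pulled back to time \<open>0\<close>.\<close>

definition comp_factor :: "nat \<Rightarrow> nat \<Rightarrow> 'a \<Rightarrow> complex" where
  "comp_factor n k x = exp (\<i> * complex_of_real (Re (c * e ^ k * d x) / sqrt (real n))) * complex_of_real (exp (cond_var k x / (2 * real n)))"

lemma comp_factor_measurable: "comp_factor n k \<in> borel_measurable M"
proof -
  note [measurable] = d_measurable F_measurable[OF cond_var_measurable]
  show ?thesis unfolding comp_factor_def[abs_def] by measurable
qed

lemma comp_factor_bound: "cmod (comp_factor n k x) \<le> exp (cond_var_bound / (2 * real n))"
proof -
  have "cond_var k x / (2 * real n) \<le> cond_var_bound / (2 * real n)" using cond_var_bounds(2)[of k x] by (intro divide_right_mono) auto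
  then show ?thesis by (simp add: comp_factor_def norm_mult)
qed

definition factor_error :: "nat \<Rightarrow> real" where
  "factor_error n = (cond_var_bound / (2 * real n))\<^sup>2 + exp 1 * (cmod c * (2 * K) / sqrt (real n)) ^ 3"

text \<open>To second order the conditional characteristic function of a centered variable with variance \<open>2 * v\<close> is \<open>1 - v\<close>, and
  \<open>exp v * (1 - v)\<close> is \<open>1\<close> up to \<open>v\<^sup>2\<close>. The differences are bounded, so the error terms are deterministic.\<close>

lemma cexp_comp_factor:
  assumes n: "1 \<le> n" "cond_var_bound \<le> 2 * real n"
  shows "AE \<omega> in M. cmod (cexp (comp_factor n k) \<omega> - 1) \<le> factor_error n"
proof -
  let ?xi = "\<lambda>x. Re (c * e ^ k * d x) / sqrt (real n)"
  let ?E = "\<lambda>x. exp (\<i> * complex_of_real (?xi x))"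
  let ?z = "\<lambda>x. complex_of_real (exp (cond_var k x / (2 * real n)))"
  let ?b = "cmod c * (2 * K) / sqrt (real n)"
  note [measurable] = d_measurable
  have Em: "?E \<in> borel_measurable M" by measurable
  have xm: "?xi \<in> borel_measurable M" "(\<lambda>x. (?xi x)\<^sup>2) \<in> borel_measurable M" by measurable
  have Ei: "integrable M ?E" by (rule bounded_integrable[OF Em, of 1]) simp
  have zF: "?z \<in> borel_measurable (F_at 0)"
    using F_at_measurable[OF cond_var_measurable[of k], of 0 0] by simp measurable
  have fe: "comp_factor n k x = ?z x * ?E ((T ^^ 0) x)" for x by (simp add: comp_factor_def)
  have zEi: "integrable M (\<lambda>x. ?z x * ?E ((T ^^ 0) x))"
    unfolding fe[symmetric] by (rule bounded_integrable[OF comp_factor_measurable comp_factor_bound])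
  note pull = cexp_pull[OF Ei zF zEi]
  have zFF: "?z \<in> borel_measurable F" using cond_var_measurable[of k] by measurable
  have mF: "AE \<omega> in M. cexp (\<lambda>x. ?z x * cexp ?E ((T ^^ 0) x)) \<omega> = ?z \<omega> * cexp ?E ((T ^^ 0) \<omega>)"
    by (rule cexp_F_measurable[OF pull(1)]) (use zFF cexp_measurable_F[OF Em] in simp)
  have b: "\<bar>?xi x\<bar> \<le> ?b" if "x \<in> space M" for x
  proof -
    have "\<bar>Re (c * e ^ k * d x)\<bar> \<le> cmod (c * e ^ k * d x)" by (rule abs_Re_le_cmod)
    also have "\<dots> = cmod c * cmod (d x)" by (simp add: norm_mult norm_power)
    also have "\<dots> \<le> cmod c * (2 * K)" by (intro mult_left_mono d_bound that) simp
    finally show ?thesis by (simp add: abs_divide divide_right_mono)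
  qed
  have b0: "0 \<le> ?b" using K_nonneg by simp
  show ?thesis using pull(2) mF cexp_mart_diff[OF g_square_integrable, of 1] AE_space
  proof eventually_elim
    case (elim \<omega>)
    interpret P: prob_space "\<kappa> \<omega>" by (rule kernel_prob[OF elim(4)])
    define v where "v = cond_var k \<omega> / (2 * real n)"
    have v: "0 \<le> v" "v \<le> cond_var_bound / (2 * real n)"
      using cond_var_bounds(1)[OF elim(4), of k] cond_var_bounds(2)[of k \<omega>] by (auto simp: v_def divide_right_mono)
    have "cond_var_bound / (2 * real n) \<le> 1" using n by simp
    then have v1: "v \<le> 1" using v by simp
    have kx: "integrable (\<kappa> \<omega>) ?xi"
      by (rule bounded_kernel_integrable(1)[OF xm(1) _ elim(4), of ?b]) (unfold real_norm_def, rule b)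
    have kx2: "integrable (\<kappa> \<omega>) (\<lambda>x. (?xi x)\<^sup>2)"
    proof (rule bounded_kernel_integrable(1)[OF xm(2) _ elim(4), of "?b\<^sup>2"])
      fix x assume "x \<in> space M"
      from power_mono[OF b[OF this] abs_ge_zero, of 2] show "norm ((?xi x)\<^sup>2) \<le> ?b\<^sup>2" by (simp only: power2_abs abs_power2 real_norm_def)
    qed
    have kE: "integrable (\<kappa> \<omega>) ?E"
      by (rule bounded_kernel_integrable(1)[OF Em _ elim(4), of 1]) simp
    have kd: "integrable (\<kappa> \<omega>) d"
      by (rule bounded_kernel_integrable(1)[OF d_measurable _ elim(4)]) (rule d_bound)
    have m1: "(\<integral>x. ?xi x \<partial>\<kappa> \<omega>) = 0"
    proof -
      have kcd: "integrable (\<kappa> \<omega>) (\<lambda>x. c * e ^ k * d x)" using kd by simp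
      have "(\<integral>x. ?xi x \<partial>\<kappa> \<omega>) = (\<integral>x. Re (c * e ^ k * d x) \<partial>\<kappa> \<omega>) / sqrt (real n)" by (rule integral_divide_zero)
      also have "(\<integral>x. Re (c * e ^ k * d x) \<partial>\<kappa> \<omega>) = Re (\<integral>x. c * e ^ k * d x \<partial>\<kappa> \<omega>)" by (rule integral_Re[OF kcd])
      also have "(\<integral>x. c * e ^ k * d x \<partial>\<kappa> \<omega>) = 0" using elim(3) by (simp add: cexp_def)
      finally show ?thesis by simp
    qed
    have m2: "(\<integral>x. (?xi x)\<^sup>2 \<partial>\<kappa> \<omega>) = 2 * v"
      using cond_var_eq[OF elim(4), of k] n by (simp add: v_def cexp_def power_divide)
    have key: "cmod (cexp ?E \<omega> - complex_of_real (1 - v)) \<le> ?b ^ 3"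
    proof -
      let ?P = "\<lambda>x. complex_of_real (1 - (?xi x)\<^sup>2 / 2) + \<i> * complex_of_real (?xi x)"
      have iP: "integrable (\<kappa> \<omega>) ?P"
        using kx kx2 by (intro Bochner_Integration.integrable_add integrable_of_real integrable_mult_right Bochner_Integration.integrable_diff) auto
      have "(\<integral>x. ?P x \<partial>\<kappa> \<omega>) = complex_of_real (\<integral>x. 1 - (?xi x)\<^sup>2 / 2 \<partial>\<kappa> \<omega>) + \<i> * complex_of_real (\<integral>x. ?xi x \<partial>\<kappa> \<omega>)"
        using kx kx2 by (subst Bochner_Integration.integral_add) (auto simp del: of_real_diff of_real_divide of_real_power)
      also have "(\<integral>x. 1 - (?xi x)\<^sup>2 / 2 \<partial>\<kappa> \<omega>) = 1 - v"
        using kx2 m2 by (simp add: P.prob_space del: power_divide)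
      finally have IP: "(\<integral>x. ?P x \<partial>\<kappa> \<omega>) = complex_of_real (1 - v)" using m1 by simp
      have pt: "cmod (?E x - ?P x) \<le> ?b ^ 3" if x: "x \<in> space M" for x
      proof -
        have "cmod (?E x - ?P x) \<le> \<bar>?xi x\<bar> ^ 3" by (rule iexp_quadratic)
        also have "\<dots> \<le> ?b ^ 3" by (intro power_mono b x) simp
        finally show ?thesis .
      qed
      have "cmod (cexp ?E \<omega> - complex_of_real (1 - v)) = cmod (\<integral>x. ?E x - ?P x \<partial>\<kappa> \<omega>)"
        using kE iP IP by (simp add: cexp_def)
      also have "\<dots> \<le> (\<integral>x. cmod (?E x - ?P x) \<partial>\<kappa> \<omega>)" by (rule integral_norm_bound)
      also have "\<dots> \<le> (\<integral>x. ?b ^ 3 \<partial>\<kappa> \<omega>)"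
        using pt kernel_space[OF elim(4)] by (intro integral_mono integrable_norm Bochner_Integration.integrable_diff kE iP) auto
      finally show ?thesis by (simp add: P.prob_space)
    qed
    have "cexp (comp_factor n k) \<omega> = complex_of_real (exp v) * cexp ?E \<omega>"
      unfolding fe[abs_def] elim(1) elim(2) by (simp add: v_def)
    then have "cexp (comp_factor n k) \<omega> - 1 = complex_of_real (exp v) * (cexp ?E \<omega> - complex_of_real (1 - v))
        + complex_of_real (exp v * (1 - v) - 1)" by (simp add: algebra_simps)
    then have "cmod (cexp (comp_factor n k) \<omega> - 1) \<le> cmod (complex_of_real (exp v) * (cexp ?E \<omega> - complex_of_real (1 - v)))
        + cmod (complex_of_real (exp v * (1 - v) - 1))" by (simp only: norm_triangle_ineq)
    also have "\<dots> = exp v * cmod (cexp ?E \<omega> - complex_of_real (1 - v)) + \<bar>exp v * (1 - v) - 1\<bar>"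
      by (simp only: norm_mult norm_of_real abs_exp_cancel)
    also have "\<dots> \<le> exp 1 * ?b ^ 3 + v\<^sup>2"
      using v1 b0 by (intro add_mono mult_mono key exp_mult_compl_le v) auto
    also have "v\<^sup>2 \<le> (cond_var_bound / (2 * real n))\<^sup>2" using v by (intro power_mono) auto
    finally show ?case by (simp add: factor_error_def)
  qed
qed

definition comp_prod :: "nat \<Rightarrow> nat \<Rightarrow> 'a \<Rightarrow> complex" where
  "comp_prod n k x = (\<Prod>j=1..k. comp_factor n j ((T ^^ j) x))"

lemma comp_prod_F_at: "comp_prod n k \<in> borel_measurable (F_at (Suc k))"
  unfolding comp_prod_def[abs_def]
proof (rule borel_measurable_prod)
  fix j assume j: "j \<in> {1..k}"
  have [measurable]: "(\<lambda>x. d ((T ^^ j) x)) \<in> borel_measurable (F_at (Suc k))" by (rule d_F_at) (use j in simp)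
  have [measurable]: "(\<lambda>x. cond_var j ((T ^^ j) x)) \<in> borel_measurable (F_at (Suc k))"
    by (rule F_at_measurable[OF cond_var_measurable]) (use j in simp)
  show "(\<lambda>x. comp_factor n j ((T ^^ j) x)) \<in> borel_measurable (F_at (Suc k))"
    unfolding comp_factor_def by measurable
qed

lemma comp_prod_bound:
  assumes "k \<le> n"
  shows "cmod (comp_prod n k x) \<le> exp (cond_var_bound / 2)"
proof (cases "n = 0")
  case False
  have "cmod (comp_prod n k x) \<le> (\<Prod>j=1..k. exp (cond_var_bound / (2 * real n)))"
    unfolding comp_prod_def prod_norm[symmetric] by (intro prod_mono) (auto intro: comp_factor_bound)
  also have "\<dots> = exp (real k * (cond_var_bound / (2 * real n)))" by (simp only: prod_constant card_atLeastAtMost exp_of_nat_mult) simp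
  also have "\<dots> \<le> exp (cond_var_bound / 2)"
  proof -
    have "real k * cond_var_bound \<le> real n * cond_var_bound" using assms cond_var_bound_nonneg by (intro mult_right_mono) auto
    then show ?thesis using False by (simp add: field_simps)
  qed
  finally show ?thesis .
qed (use assms cond_var_bound_nonneg in \<open>simp add: comp_prod_def\<close>)

lemma comp_prod_measurable: "comp_prod n k \<in> borel_measurable M"
  by (rule measurable_from_subalg[OF subalgebra_F_at comp_prod_F_at])

text \<open>Conditioning on the past of the last factor changes the mean of the product by at most the error of one factor
  times the bound of the product.\<close>

lemma cexp_comp_prod:
  assumes n: "1 \<le> n" "cond_var_bound \<le> 2 * real n"
  shows "AE \<omega> in M. cmod (cexp (comp_prod n n) \<omega> - 1) \<le> real n * (exp (cond_var_bound / 2) * factor_error n)"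
proof -
  have error0: "0 \<le> factor_error n" using K_nonneg by (simp add: factor_error_def)
  have "AE \<omega> in M. cmod (cexp (comp_prod n k) \<omega> - 1) \<le> real k * (exp (cond_var_bound / 2) * factor_error n)" if "k \<le> n" for k
    using that
  proof (induction k)
    case 0
    have "AE \<omega> in M. cexp (\<lambda>x. 1 :: complex) \<omega> = 1" by (rule cexp_F_measurable) auto
    then show ?case by (simp add: comp_prod_def[abs_def])
  next
    case (Suc k)
    have e: "comp_prod n (Suc k) x = comp_prod n k x * comp_factor n (Suc k) ((T ^^ Suc k) x)" for x by (simp add: comp_prod_def)
    have fi: "integrable M (comp_factor n (Suc k))" by (rule bounded_integrable[OF comp_factor_measurable comp_factor_bound])
    have Zi: "integrable M (comp_prod n j)" if "j \<le> n" for j by (rule bounded_integrable[OF comp_prod_measurable comp_prod_bound[OF that]])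
    have pi: "integrable M (\<lambda>x. comp_prod n k x * comp_factor n (Suc k) ((T ^^ Suc k) x))" using Zi[OF Suc.prems] by (simp only: e[abs_def])
    note pull = cexp_pull[OF fi comp_prod_F_at pi]
    let ?R = "\<lambda>x. comp_prod n k x * cexp (comp_factor n (Suc k)) ((T ^^ Suc k) x)"
    have Rm: "?R \<in> borel_measurable M" using pull(1) by auto
    have small: "AE x in M. cmod (cexp (comp_factor n (Suc k)) ((T ^^ Suc k) x) - 1) \<le> factor_error n"
      by (rule AE_T_pow[OF cexp_comp_factor[OF n]])
    have di: "integrable M (\<lambda>x. ?R x - comp_prod n k x)"
      by (intro Bochner_Integration.integrable_diff pull(1) Zi) (use Suc.prems in simp)
    have "AE \<omega> in M. cexp (\<lambda>x. cmod (?R x - comp_prod n k x)) \<omega> \<le> cexp (\<lambda>x. exp (cond_var_bound / 2) * factor_error n) \<omega>"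
    proof (rule cexp_mono_AE)
      show "AE x in M. cmod (?R x - comp_prod n k x) \<le> exp (cond_var_bound / 2) * factor_error n"
        using small
      proof eventually_elim
        case (elim x)
        have "?R x - comp_prod n k x = comp_prod n k x * (cexp (comp_factor n (Suc k)) ((T ^^ Suc k) x) - 1)" by (simp add: algebra_simps)
        then have "cmod (?R x - comp_prod n k x) = cmod (comp_prod n k x) * cmod (cexp (comp_factor n (Suc k)) ((T ^^ Suc k) x) - 1)"
          by (simp only: norm_mult)
        also have "\<dots> \<le> exp (cond_var_bound / 2) * factor_error n" using Suc.prems by (intro mult_mono comp_prod_bound elim) auto
        finally show ?case .
      qed
    qed (use di in auto)
    moreover have "AE \<omega> in M. cexp (\<lambda>x. exp (cond_var_bound / 2) * factor_error n) \<omega> = exp (cond_var_bound / 2) * factor_error n"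
      by (rule cexp_F_measurable_real) auto
    moreover have "AE \<omega> in M. cexp (\<lambda>x. ?R x - comp_prod n k x) \<omega> = cexp ?R \<omega> - cexp (comp_prod n k) \<omega>"
      by (rule cexp_diff[OF pull(1) Zi]) (use Suc.prems in simp)
    moreover have "AE \<omega> in M. cmod (cexp (comp_prod n k) \<omega> - 1) \<le> real k * (exp (cond_var_bound / 2) * factor_error n)"
      by (rule Suc.IH) (use Suc.prems in simp)
    moreover note pull(2)
    ultimately show ?case
    proof eventually_elim
      case (elim \<omega>)
      have "cmod (cexp (\<lambda>x. ?R x - comp_prod n k x) \<omega>) \<le> cexp (\<lambda>x. cmod (?R x - comp_prod n k x)) \<omega>"
        unfolding cexp_def[of "\<lambda>x. ?R x - comp_prod n k x"] cexp_def[of "\<lambda>x. cmod (?R x - comp_prod n k x)"] by (rule integral_norm_bound)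
      then have 1: "cmod (cexp ?R \<omega> - cexp (comp_prod n k) \<omega>) \<le> exp (cond_var_bound / 2) * factor_error n" using elim by simp
      have "cexp (comp_prod n (Suc k)) \<omega> = cexp ?R \<omega>" unfolding e[abs_def] by (rule elim(5))
      then have "cmod (cexp (comp_prod n (Suc k)) \<omega> - 1) \<le> cmod (cexp ?R \<omega> - cexp (comp_prod n k) \<omega>) + cmod (cexp (comp_prod n k) \<omega> - 1)"
        using norm_triangle_ineq[of "cexp ?R \<omega> - cexp (comp_prod n k) \<omega>" "cexp (comp_prod n k) \<omega> - 1"] by simp
      with 1 elim(4) show ?case by (simp add: distrib_right)
    qed
  qed
  then show ?thesis by simp
qed

end
end

lemma lim_const_over_sqrt: "(\<lambda>n. C / sqrt (real n)) \<longlonglongrightarrow> 0"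
  by (rule tendsto_divide_0[OF tendsto_const filterlim_at_top_imp_at_infinity])
     (rule filterlim_compose[OF sqrt_at_top filterlim_real_sequentially])

lemma cmod_iexp_diff_le: "cmod (exp (\<i> * complex_of_real a) - exp (\<i> * complex_of_real b)) \<le> \<bar>a - b\<bar>"
proof -
  have "exp (\<i> * complex_of_real a) - exp (\<i> * complex_of_real b) = exp (\<i> * complex_of_real b) * (exp (\<i> * complex_of_real (a - b)) - 1)"
    by (simp add: right_diff_distrib flip: exp_add)
  then have "cmod (exp (\<i> * complex_of_real a) - exp (\<i> * complex_of_real b)) = cmod (exp (\<i> * complex_of_real (a - b)) - 1)"
    by (simp only: norm_mult norm_exp_i_times mult_1)
  also have "\<dots> \<le> \<bar>a - b\<bar>" using iexp_approx1[of "a - b" 0] by simp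
  finally show ?thesis .
qed

text \<open>The approximations \<open>\<psi> i\<close> are uniform in \<open>n\<close> up to \<open>y i\<close>, after a boundary effect of order \<open>1 / sqrt n\<close>.\<close>

lemma tendsto_approximation:
  fixes \<phi> :: "nat \<Rightarrow> 'b::real_normed_vector"
  assumes le: "\<And>i n. 1 \<le> n \<Longrightarrow> norm (\<phi> n - \<psi> i n) \<le> y i + B i / sqrt (real n)"
    and \<psi>: "\<And>i. \<psi> i \<longlonglongrightarrow> L i" and y: "y \<longlonglongrightarrow> (0::real)" and L: "L \<longlonglongrightarrow> l"
  shows "\<phi> \<longlonglongrightarrow> l"
proof (rule LIMSEQ_I)
  fix r :: real assume r: "0 < r"
  have "eventually (\<lambda>i. norm (L i - l) < r / 4) sequentially"
    using tendstoD[OF L, of "r / 4"] r by (simp add: dist_norm)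
  moreover have "eventually (\<lambda>i. y i < r / 4) sequentially" using y r by (intro order_tendstoD(2)) auto
  ultimately have "eventually (\<lambda>i. norm (L i - l) < r / 4 \<and> y i < r / 4) sequentially" by (rule eventually_conj)
  then obtain i where i: "norm (L i - l) < r / 4" "y i < r / 4" by (auto simp: eventually_sequentially)
  have "eventually (\<lambda>n. B i / sqrt (real n) < r / 4) sequentially"
    using lim_const_over_sqrt[of "B i"] r by (intro order_tendstoD(2)) auto
  moreover have "eventually (\<lambda>n. norm (\<psi> i n - L i) < r / 4) sequentially"
    using tendstoD[OF \<psi>[of i], of "r / 4"] r by (simp add: dist_norm)
  ultimately have "eventually (\<lambda>n. B i / sqrt (real n) < r / 4 \<and> norm (\<psi> i n - L i) < r / 4) sequentially"
    by (rule eventually_conj)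
  then obtain N where N: "\<And>n. N \<le> n \<Longrightarrow> B i / sqrt (real n) < r / 4 \<and> norm (\<psi> i n - L i) < r / 4"
    by (auto simp: eventually_sequentially)
  have "norm (\<phi> n - l) < r" if n: "max N 1 \<le> n" for n
  proof -
    have "\<phi> n - l = (\<phi> n - \<psi> i n) + (\<psi> i n - L i) + (L i - l)" by simp
    then have "norm (\<phi> n - l) \<le> norm (\<phi> n - \<psi> i n) + norm (\<psi> i n - L i) + norm (L i - l)"
      by (metis norm_triangle_ineq add_right_mono order_trans)
    moreover have "N \<le> n" "1 \<le> n" using n by auto
    ultimately show ?thesis using le[of n i] N[of n] i by linarith
  qed
  then show "\<exists>no. \<forall>n\<ge>no. norm (\<phi> n - l) < r" by blast
qed

text \<open>As above, with constant approximations and an unknown limit, which has to be constructed from the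
  Cauchy property.\<close>

lemma convergent_approximation:
  fixes a \<rho> y B :: "nat \<Rightarrow> real"
  assumes le: "\<And>i n. 1 \<le> n \<Longrightarrow> \<bar>a n - \<rho> i\<bar> \<le> y i + B i / sqrt (real n)" and y: "y \<longlonglongrightarrow> 0"
  shows "\<exists>l. a \<longlonglongrightarrow> l \<and> \<rho> \<longlonglongrightarrow> l"
proof -
  have "Cauchy a"
  proof (rule metric_CauchyI)
    fix r :: real assume r: "0 < r"
    have "eventually (\<lambda>i. y i < r / 4) sequentially" using y r by (intro order_tendstoD(2)) auto
    then obtain i where i: "y i < r / 4" by (auto simp: eventually_sequentially)
    have "eventually (\<lambda>n. B i / sqrt (real n) < r / 4) sequentially"
      using lim_const_over_sqrt[of "B i"] r by (intro order_tendstoD(2)) auto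
    then obtain N where N: "\<And>n. N \<le> n \<Longrightarrow> B i / sqrt (real n) < r / 4" by (auto simp: eventually_sequentially)
    have near: "\<bar>a n - \<rho> i\<bar> < r / 2" if "max N 1 \<le> n" for n
    proof -
      have "N \<le> n" "1 \<le> n" using that by auto
      then show ?thesis using le[of n i] N[of n] i by linarith
    qed
    have "dist (a m) (a n) < r" if "max N 1 \<le> m" "max N 1 \<le> n" for m n
      using near[OF that(1)] near[OF that(2)] unfolding dist_real_def by linarith
    then show "\<exists>M. \<forall>m\<ge>M. \<forall>n\<ge>M. dist (a m) (a n) < r" by blast
  qed
  then obtain l where l: "a \<longlonglongrightarrow> l" using Cauchy_convergent convergent_def by blast
  have bd: "\<bar>l - \<rho> i\<bar> \<le> y i" for i
  proof (rule LIMSEQ_le)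
    show "(\<lambda>n. \<bar>a n - \<rho> i\<bar>) \<longlonglongrightarrow> \<bar>l - \<rho> i\<bar>" by (intro tendsto_intros l)
    have "(\<lambda>n. y i + B i / sqrt (real n)) \<longlonglongrightarrow> y i + 0" by (intro tendsto_intros lim_const_over_sqrt)
    then show "(\<lambda>n. y i + B i / sqrt (real n)) \<longlonglongrightarrow> y i" by simp
    show "\<exists>N. \<forall>n\<ge>N. \<bar>a n - \<rho> i\<bar> \<le> y i + B i / sqrt (real n)" using le by blast
  qed
  have "(\<lambda>i. \<rho> i - l) \<longlonglongrightarrow> 0"
    by (rule Lim_null_comparison[OF _ y]) (use bd in \<open>simp add: abs_minus_commute\<close>)
  then have "\<rho> \<longlonglongrightarrow> l" by (simp add: LIM_zero_iff)
  with l show ?thesis by blast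
qed

context twisted_system begin

lemma factor_error_limit:
  assumes gF: "g \<in> borel_measurable F" and gK: "\<And>x. cmod (g x) \<le> K"
  shows "(\<lambda>n. real n * (C * factor_error K c n)) \<longlonglongrightarrow> 0"
proof -
  let ?b = "cmod c * (2 * K)"
  have L: "(\<lambda>n. C * (((cond_var_bound K c)\<^sup>2 / 4) / real n + (exp 1 * ?b ^ 3) / sqrt (real n))) \<longlonglongrightarrow> C * (0 + 0)"
    by (intro tendsto_intros lim_const_over_n lim_const_over_sqrt)
  have E: "real n * (C * factor_error K c n) = C * (((cond_var_bound K c)\<^sup>2 / 4) / real n + (exp 1 * ?b ^ 3) / sqrt (real n))" for n
  proof (cases "n = 0")
    case False
    have s: "sqrt (real n) ^ 3 = real n * sqrt (real n)" by (simp add: power3_eq_cube)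
    have 1: "real n * (cond_var_bound K c / (2 * real n))\<^sup>2 = ((cond_var_bound K c)\<^sup>2 / 4) / real n"
      using False by (simp add: power2_eq_square field_simps)
    have 2: "real n * (?b / sqrt (real n)) ^ 3 = ?b ^ 3 / sqrt (real n)"
      using False unfolding power_divide s by simp
    have 3: "real n * (C * (a + exp 1 * b)) = C * (real n * a + exp 1 * (real n * b))" for a b :: real
      by (simp add: algebra_simps)
    have "real n * (C * factor_error K c n) = C * (real n * (cond_var_bound K c / (2 * real n))\<^sup>2 + exp 1 * (real n * (?b / sqrt (real n)) ^ 3))"
      unfolding factor_error_def[OF gF gK] by (rule 3)
    then show ?thesis unfolding 1 2 by simp
  qed simp
  show ?thesis unfolding E using L by simp
qed

text \<open>The compensated product has conditional mean tending to \<open>1\<close>. Since the conditional variance \<open>V\<close> is bounded and tends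
  to the constant \<open>s'\<close>, the compensator may be replaced by \<open>exp (s' / 2)\<close>.\<close>

lemma martingale_clt:
  fixes g :: "'a \<Rightarrow> complex" and K :: real and c :: complex
  assumes gF: "g \<in> borel_measurable F" and gK: "\<And>x. cmod (g x) \<le> K"
  defines "s \<equiv> (L2_norm M (mart_diff 1 g))\<^sup>2"
  assumes A1: "AE \<omega> in M. (\<lambda>n. cexp (\<lambda>x. cmod (complex_of_real (1 / real n) * (\<Sum>k=1..n. complex_of_real (cmoment_abs g ((T ^^ k) x) - s)))) \<omega>) \<longlonglongrightarrow> 0"
    and A2: "AE \<omega> in M. (\<lambda>n. cexp (\<lambda>x. cmod (complex_of_real (1 / real n) * (\<Sum>k=1..n. (e\<^sup>2) ^ k * cmoment_sq g ((T ^^ k) x)))) \<omega>) \<longlonglongrightarrow> 0"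
  shows "AE \<omega> in M. (\<lambda>n. cexp (\<lambda>x. exp (\<i> * complex_of_real (Re (c * koop_sum (mart_diff 1 g) n x) / sqrt (real n)))) \<omega>)
     \<longlonglongrightarrow> exp (complex_of_real (- (cmod c)\<^sup>2 * s / 4))"
proof -
  let ?d = "mart_diff 1 g" and ?B = "cond_var_bound K c"
  let ?a1 = "\<lambda>n x. complex_of_real (1 / real n) * (\<Sum>k=1..n. complex_of_real (cmoment_abs g ((T ^^ k) x) - s))"
  let ?a2 = "\<lambda>n x. complex_of_real (1 / real n) * (\<Sum>k=1..n. (e\<^sup>2) ^ k * cmoment_sq g ((T ^^ k) x))"
  let ?E = "\<lambda>n x. exp (\<i> * complex_of_real (Re (c * koop_sum ?d n x) / sqrt (real n)))"
  define V where "V n x = (\<Sum>k=1..n. cond_var g c k ((T ^^ k) x)) / real n" for n x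
  define s' where "s' = (cmod c)\<^sup>2 * s / 2"
  note pm = cmoment_measurable[OF gF gK, THEN F_measurable] and pb = cmoment_bounds[OF gF gK]
  note Bn = cond_var_bound_nonneg[OF gF gK, of c] and ub = cond_var_bounds(2)[OF gF gK, of c]
  have K0: "0 \<le> K" by (rule K_nonneg[OF gF gK])
  have s0: "0 \<le> s" by (simp add: s_def)
  have d: "square_integrable M ?d" by (rule mart_diff_square_integrable[OF g_square_integrable[OF gF gK]])
  have sK: "s \<le> (2 * K)\<^sup>2"
  proof -
    have "L2_norm M ?d \<le> 2 * K"
      by (rule bounded_square_integrable(2)[OF d_measurable[OF gF gK] AE_I2[OF d_bound[OF gF gK]]]) (use K0 in auto)
    then show ?thesis unfolding s_def by (intro power_mono) auto
  qed
  have s'B: "s' \<le> ?B" "0 \<le> s'"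
  proof -
    have "(cmod c)\<^sup>2 * s \<le> ?B" unfolding cond_var_bound_def[OF gF gK] by (rule mult_left_mono[OF sK]) simp
    moreover have "0 \<le> (cmod c)\<^sup>2 * s" using s0 by simp
    ultimately show "s' \<le> ?B" "0 \<le> s'" unfolding s'_def by linarith+
  qed
  have Vm: "V n \<in> borel_measurable M" for n
    unfolding V_def[abs_def]
    by (intro borel_measurable_divide borel_measurable_sum borel_measurable_const T_pow_measurable_comp F_measurable[OF cond_var_measurable[OF gF gK]])
  have VB: "\<bar>V n x\<bar> \<le> ?B" for n x
  proof (cases "n = 0")
    case False
    have "\<bar>\<Sum>k=1..n. cond_var g c k ((T ^^ k) x)\<bar> \<le> (\<Sum>k=1..n. ?B)"
      by (rule order_trans[OF sum_abs sum_mono]) (rule ub)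
    then have "\<bar>\<Sum>k=1..n. cond_var g c k ((T ^^ k) x)\<bar> \<le> real n * ?B" by simp
    then show ?thesis using False by (simp add: V_def abs_divide field_simps)
  qed (use Bn in \<open>simp add: V_def\<close>)
  have Em: "?E n \<in> borel_measurable M" for n
    using koop_sum_measurable[OF d_measurable[OF gF gK], of n] by measurable
  have ZE: "comp_prod g c n n x = ?E n x * complex_of_real (exp (V n x / 2))" for n x
  proof -
    have "comp_prod g c n n x = (\<Prod>j=1..n. exp (\<i> * complex_of_real (Re (c * e ^ j * ?d ((T ^^ j) x)) / sqrt (real n)))) *
        (\<Prod>j=1..n. complex_of_real (exp (cond_var g c j ((T ^^ j) x) / (2 * real n))))"
      unfolding comp_prod_def[OF gF gK] comp_factor_def[OF gF gK] by (rule prod.distrib)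
    also have "(\<Prod>j=1..n. exp (\<i> * complex_of_real (Re (c * e ^ j * ?d ((T ^^ j) x)) / sqrt (real n)))) =
       exp (\<Sum>j=1..n. \<i> * complex_of_real (Re (c * e ^ j * ?d ((T ^^ j) x)) / sqrt (real n)))"
      by (simp only: exp_sum finite_atLeastAtMost)
    also have "(\<Sum>j=1..n. \<i> * complex_of_real (Re (c * e ^ j * ?d ((T ^^ j) x)) / sqrt (real n))) =
       \<i> * complex_of_real (Re (c * koop_sum ?d n x) / sqrt (real n))"
    proof -
      have "Re (c * koop_sum ?d n x) / sqrt (real n) = (\<Sum>j=1..n. Re (c * e ^ j * ?d ((T ^^ j) x)) / sqrt (real n))"
        unfolding koop_sum_def koop_def sum_distrib_left Re_sum sum_divide_distrib by (simp only: mult.assoc)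
      then show ?thesis by (simp only: of_real_sum sum_distrib_left)
    qed
    also have "(\<Prod>j=1..n. complex_of_real (exp (cond_var g c j ((T ^^ j) x) / (2 * real n)))) =
       complex_of_real (exp (\<Sum>j=1..n. cond_var g c j ((T ^^ j) x) / (2 * real n)))"
      by (simp only: exp_sum finite_atLeastAtMost of_real_prod)
    also have "(\<Sum>j=1..n. cond_var g c j ((T ^^ j) x) / (2 * real n)) = V n x / 2"
      by (simp add: V_def sum_divide_distrib mult.commute)
    finally show ?thesis .
  qed
  have Vs: "\<bar>V n x - s'\<bar> \<le> (cmod c)\<^sup>2 / 2 * (cmod (?a1 n x) + cmod (?a2 n x))" if n: "1 \<le> n" for n x
  proof -
    define S1 where "S1 = (\<Sum>k=1..n. cmoment_abs g ((T ^^ k) x) - s)"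
    define S2 where "S2 = (\<Sum>k=1..n. (e\<^sup>2) ^ k * cmoment_sq g ((T ^^ k) x))"
    have "(\<Sum>k=1..n. cond_var g c k ((T ^^ k) x)) = ((cmod c)\<^sup>2 * (\<Sum>k=1..n. cmoment_abs g ((T ^^ k) x)) + Re (c\<^sup>2 * S2)) / 2"
      unfolding cond_var_def[OF gF gK] S2_def sum_distrib_left Re_sum sum.distrib[symmetric] sum_divide_distrib by (simp only: mult.assoc)
    also have "(\<Sum>k=1..n. cmoment_abs g ((T ^^ k) x)) = S1 + real n * s" by (simp add: S1_def sum_subtractf)
    finally have "V n x - s' = ((cmod c)\<^sup>2 * S1 + Re (c\<^sup>2 * S2)) / (2 * real n)"
      using n by (simp add: V_def s'_def field_simps)
    then have "\<bar>V n x - s'\<bar> = \<bar>(cmod c)\<^sup>2 * S1 + Re (c\<^sup>2 * S2)\<bar> / (2 * real n)" by (simp add: abs_divide)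
    also have "\<bar>(cmod c)\<^sup>2 * S1 + Re (c\<^sup>2 * S2)\<bar> \<le> (cmod c)\<^sup>2 * \<bar>S1\<bar> + (cmod c)\<^sup>2 * cmod S2"
      using abs_Re_le_cmod[of "c\<^sup>2 * S2"] abs_triangle_ineq[of "(cmod c)\<^sup>2 * S1" "Re (c\<^sup>2 * S2)"]
      by (simp add: norm_mult norm_power abs_mult del: times_complex.sel)
    finally have "\<bar>V n x - s'\<bar> \<le> ((cmod c)\<^sup>2 * \<bar>S1\<bar> + (cmod c)\<^sup>2 * cmod S2) / (2 * real n)"
      by (simp add: divide_right_mono)
    also have "\<dots> = (cmod c)\<^sup>2 / 2 * (1 / real n * \<bar>S1\<bar> + 1 / real n * cmod S2)" using n by (simp add: field_simps)
    also have "1 / real n * \<bar>S1\<bar> = cmod (?a1 n x)"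
      unfolding S1_def of_real_sum[symmetric] norm_mult norm_of_real by simp
    also have "1 / real n * cmod S2 = cmod (?a2 n x)"
      unfolding S2_def norm_mult norm_of_real by simp
    finally show ?thesis .
  qed
  have a1m: "?a1 n \<in> borel_measurable M" and a2m: "?a2 n \<in> borel_measurable M" for n
    by (intro borel_measurable_times borel_measurable_const borel_measurable_sum measurable_compose[OF _ borel_measurable_of_real]
       borel_measurable_diff T_pow_measurable_comp[OF pm(1)] T_pow_measurable_comp[OF pm(2)])+
  have a1b: "cmod (?a1 n x) \<le> (2 * K)\<^sup>2 + s" for n x
  proof (cases "n = 0")
    case False
    have "\<bar>cmoment_abs g y - s\<bar> \<le> (2 * K)\<^sup>2 + s" for y using pb(1,2)[of y] s0 by linarith
    then have "cmod (\<Sum>k=1..n. complex_of_real (cmoment_abs g ((T ^^ k) x) - s)) \<le> (\<Sum>k=1..n. (2 * K)\<^sup>2 + s)"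
      by (intro sum_norm_le) (simp only: norm_of_real)
    then show ?thesis using False by (simp add: norm_mult norm_divide field_simps)
  qed (use s0 in simp)
  have a2b: "cmod (?a2 n x) \<le> (2 * K)\<^sup>2" for n x
  proof (cases "n = 0")
    case False
    have "cmod (\<Sum>k=1..n. (e\<^sup>2) ^ k * cmoment_sq g ((T ^^ k) x)) \<le> (\<Sum>k=1..n. (2 * K)\<^sup>2)"
      by (intro sum_norm_le) (simp add: norm_mult norm_power pb(3)[simplified])
    then show ?thesis using False by (simp add: norm_mult norm_divide field_simps)
  qed simp
  have Zae: "AE \<omega> in M. \<forall>n. 1 \<le> n \<longrightarrow> ?B \<le> 2 * real n \<longrightarrow>
     cmod (cexp (comp_prod g c n n) \<omega> - 1) \<le> real n * (exp (?B / 2) * factor_error K c n)"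
  proof (rule AE_all_countable[THEN iffD2], rule allI)
    fix n
    show "AE \<omega> in M. 1 \<le> n \<longrightarrow> ?B \<le> 2 * real n \<longrightarrow>
     cmod (cexp (comp_prod g c n n) \<omega> - 1) \<le> real n * (exp (?B / 2) * factor_error K c n)"
      using cexp_comp_prod[OF gF gK, of n c] by (cases "1 \<le> n \<and> ?B \<le> 2 * real n") auto
  qed
  show ?thesis using A1 A2 Zae AE_space
  proof eventually_elim
    case (elim \<omega>)
    define z where "z n = exp (complex_of_real (s' / 2)) * cexp (?E n) \<omega>" for n
    define b where "b n = real n * (exp (?B / 2) * factor_error K c n) +
       exp (?B / 2) * ((cmod c)\<^sup>2 / 2 * (cexp (\<lambda>x. cmod (?a1 n x)) \<omega> + cexp (\<lambda>x. cmod (?a2 n x)) \<omega>))" for n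
    have b: "b \<longlonglongrightarrow> 0"
    proof -
      have "b \<longlonglongrightarrow> 0 + exp (?B / 2) * ((cmod c)\<^sup>2 / 2 * (0 + 0))"
        unfolding b_def[abs_def] by (intro tendsto_intros factor_error_limit[OF gF gK] elim(1) elim(2))
      then show ?thesis by simp
    qed
    have zb: "cmod (z n - 1) \<le> b n" if n: "1 \<le> n" "?B \<le> 2 * real n" for n
    proof -
      interpret P: prob_space "\<kappa> \<omega>" by (rule kernel_prob[OF elim(4)])
      let ?D = "\<lambda>x. ?E n x * complex_of_real (exp (V n x / 2) - exp (s' / 2))"
      have iE: "integrable (\<kappa> \<omega>) (?E n)" by (rule bounded_kernel_integrable(1)[OF Em _ elim(4), of n 1]) simp
      have iZ: "integrable (\<kappa> \<omega>) (comp_prod g c n n)"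
        by (rule bounded_kernel_integrable(1)[OF comp_prod_measurable[OF gF gK] comp_prod_bound[OF gF gK order_refl] elim(4)])
      have De: "?D x = comp_prod g c n n x - exp (complex_of_real (s' / 2)) * ?E n x" for x
        unfolding ZE exp_of_real by (simp add: algebra_simps)
      have iD: "integrable (\<kappa> \<omega>) ?D" unfolding De
        by (intro Bochner_Integration.integrable_diff iZ integrable_mult_right iE)
      have ia1: "integrable (\<kappa> \<omega>) (\<lambda>x. cmod (?a1 n x))"
        by (rule bounded_kernel_integrable(1)[OF measurable_compose[OF a1m borel_measurable_norm] _ elim(4), of n "(2 * K)\<^sup>2 + s"])
           (use a1b in simp)
      have ia2: "integrable (\<kappa> \<omega>) (\<lambda>x. cmod (?a2 n x))"
        by (rule bounded_kernel_integrable(1)[OF measurable_compose[OF a2m borel_measurable_norm] _ elim(4), of n "(2 * K)\<^sup>2"])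
           (use a2b in simp)
      let ?U = "\<lambda>x. exp (?B / 2) * ((cmod c)\<^sup>2 / 2 * (cmod (?a1 n x) + cmod (?a2 n x)))"
      have ptw: "cmod (?D x) \<le> ?U x" for x
      proof -
        have "cmod (?D x) = \<bar>exp (V n x / 2) - exp (s' / 2)\<bar>" by (simp only: norm_mult norm_exp_i_times norm_of_real mult_1)
        also have "\<dots> \<le> exp (?B / 2) * \<bar>V n x / 2 - s' / 2\<bar>"
          using VB[of n x] s'B by (intro exp_diff_le) auto
        also have "\<dots> \<le> exp (?B / 2) * \<bar>V n x - s'\<bar>" by (intro mult_left_mono) auto
        also have "\<dots> \<le> ?U x" by (intro mult_left_mono Vs n) simp
        finally show ?thesis .
      qed
      have "cexp ?D \<omega> = cexp (comp_prod g c n n) \<omega> - z n"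
        unfolding De z_def cexp_def using iZ iE by simp
      moreover have "cmod (cexp ?D \<omega>) \<le> exp (?B / 2) * ((cmod c)\<^sup>2 / 2 * (cexp (\<lambda>x. cmod (?a1 n x)) \<omega> + cexp (\<lambda>x. cmod (?a2 n x)) \<omega>))"
      proof -
        have "cmod (cexp ?D \<omega>) \<le> (\<integral>x. cmod (?D x) \<partial>\<kappa> \<omega>)" unfolding cexp_def by (rule integral_norm_bound)
        also have "\<dots> \<le> (\<integral>x. ?U x \<partial>\<kappa> \<omega>)"
          by (rule integral_mono[OF integrable_norm[OF iD] _ ptw])
             (intro integrable_mult_right Bochner_Integration.integrable_add ia1 ia2)
        also have "\<dots> = exp (?B / 2) * ((cmod c)\<^sup>2 / 2 * (cexp (\<lambda>x. cmod (?a1 n x)) \<omega> + cexp (\<lambda>x. cmod (?a2 n x)) \<omega>))"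
          unfolding cexp_def by (simp only: integral_mult_right_zero Bochner_Integration.integral_add[OF ia1 ia2])
        finally show ?thesis .
      qed
      moreover have "cmod (cexp (comp_prod g c n n) \<omega> - 1) \<le> real n * (exp (?B / 2) * factor_error K c n)" using elim(3) n by blast
      moreover have "z n - 1 = (cexp (comp_prod g c n n) \<omega> - 1) - (cexp (comp_prod g c n n) \<omega> - z n)" by simp
      ultimately show ?thesis unfolding b_def
        using norm_triangle_ineq4[of "cexp (comp_prod g c n n) \<omega> - 1" "cexp (comp_prod g c n n) \<omega> - z n"] by simp
    qed
    obtain N :: nat where N: "?B \<le> real N" using real_arch_simple by blast
    have "(\<lambda>n. z n - 1) \<longlonglongrightarrow> 0"
    proof (rule Lim_null_comparison[OF _ b])
      have "cmod (z n - 1) \<le> b n" if "max N 1 \<le> n" for n using zb[of n] that N by simp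
      then show "eventually (\<lambda>n. cmod (z n - 1) \<le> b n) sequentially" unfolding eventually_sequentially by blast
    qed
    then have "z \<longlonglongrightarrow> 1" by (simp add: LIM_zero_iff)
    then have "(\<lambda>n. exp (complex_of_real (- s' / 2)) * z n) \<longlonglongrightarrow> exp (complex_of_real (- s' / 2)) * 1" by (intro tendsto_intros)
    moreover have "exp (complex_of_real (- s' / 2)) * z n = cexp (?E n) \<omega>" for n
      unfolding z_def by (simp add: mult.assoc[symmetric] exp_minus)
    moreover have "- s' / 2 = - (cmod c)\<^sup>2 * s / 4" by (simp add: s'_def)
    ultimately show ?case by (simp only: mult_1_right)
  qed
qed

end

section \<open>The quenched limit theorem for twisted sums\<close>

context twisted_system begin

lemma quenched_average_cmoment_abs:
  assumes inv: "invertible_mpt M T" and erg: "ergodic M T"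
    and gF: "g \<in> borel_measurable F" and gK: "\<And>x. cmod (g x) \<le> K"
  shows "AE \<omega> in M. (\<lambda>n. cexp (\<lambda>x. cmod (complex_of_real (1 / real n) *
     (\<Sum>k=1..n. complex_of_real (cmoment_abs g ((T ^^ k) x) - (L2_norm M (mart_diff 1 g))\<^sup>2)))) \<omega>) \<longlonglongrightarrow> 0"
proof -
  interpret W: twisted_system M F T \<kappa> 1 by unfold_locales simp
  let ?s = "(L2_norm M (mart_diff 1 g))\<^sup>2"
  define h where "h x = complex_of_real (cmoment_abs g x - ?s)" for x
  have pm: "cmoment_abs g \<in> borel_measurable M" by (rule F_measurable[OF cmoment_measurable(1)[OF gF gK]])
  have hm: "h \<in> borel_measurable M" unfolding h_def[abs_def] using pm by measurable
  have hB: "cmod (h x) \<le> (2 * K)\<^sup>2 + ?s" for x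
  proof -
    have "0 \<le> ?s" by simp
    then have "\<bar>cmoment_abs g x - ?s\<bar> \<le> (2 * K)\<^sup>2 + ?s"
      using cmoment_bounds(1,2)[OF gF gK, of x] by linarith
    then show ?thesis unfolding h_def norm_of_real .
  qed
  have d: "square_integrable M (mart_diff 1 g)" by (rule mart_diff_square_integrable[OF g_square_integrable[OF gF gK]])
  have pi: "integrable M (cmoment_abs g)"
    by (rule bounded_integrable[OF pm, of "(2 * K)\<^sup>2"]) (use cmoment_bounds(1,2)[OF gF gK] in simp)
  have "(\<integral>x. cmoment_abs g x \<partial>M) = (\<integral>x. cexp (\<lambda>x. (cmod (mart_diff 1 g x))\<^sup>2) x \<partial>M)"
    by (rule Bochner_Integration.integral_cong) (simp_all add: cmoment_abs_def[OF gF gK])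
  also have "\<dots> = ?s" unfolding L2_norm_power2 by (rule cexp_integral(2)[OF square_integrableD(2)[OF d]])
  finally have "(\<integral>x. cmoment_abs g x - ?s \<partial>M) = 0" using pi by (simp add: prob_space)
  then have mean: "(\<integral>x. h x \<partial>M) = 0" unfolding h_def by (simp only: integral_complex_of_real of_real_0)
  have "(\<lambda>n. L2_norm M (W.koop_avg h n)) \<longlonglongrightarrow> 0"
  proof (rule W.mean_ergodic[OF hm hB mean])
    fix u :: "'a \<Rightarrow> complex" assume u: "square_integrable M u" "AE x in M. 1 * u (T x) = u x"
      and mean: "1 = (1 :: complex) \<Longrightarrow> (\<integral>x. u x \<partial>M) = 0"
    show "AE x in M. u x = 0"
      by (rule ergodic_invariant_zero_complex[OF inv erg square_integrable_imp_integrable(1)[OF u(1)]])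
         (use u(2) mean in auto)
  qed
  from W.quenched_average[OF hm hB this]
  show ?thesis by (simp add: W.koop_avg_def W.koop_sum_def W.koop_def h_def)
qed

lemma quenched_average_cmoment_sq:
  assumes eig: "\<not> is_eigenvalue M T (cnj (e\<^sup>2))"
    and gF: "g \<in> borel_measurable F" and gK: "\<And>x. cmod (g x) \<le> K"
  shows "AE \<omega> in M. (\<lambda>n. cexp (\<lambda>x. cmod (complex_of_real (1 / real n) *
     (\<Sum>k=1..n. (e\<^sup>2) ^ k * cmoment_sq g ((T ^^ k) x)))) \<omega>) \<longlonglongrightarrow> 0"
proof -
  interpret W: twisted_system M F T \<kappa> "e\<^sup>2" by unfold_locales (simp add: norm_power)
  have pm: "cmoment_sq g \<in> borel_measurable M" by (rule F_measurable[OF cmoment_measurable(2)[OF gF gK]])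
  note pb = cmoment_bounds(3)[OF gF gK]
  have ee: "cnj (e\<^sup>2) * e\<^sup>2 = 1"
    using complex_norm_square[of "e\<^sup>2"] by (simp add: norm_power mult.commute)
  have ne1: "e\<^sup>2 \<noteq> 1"
  proof
    assume "e\<^sup>2 = 1"
    moreover have "square_integrable M (\<lambda>_. 1 :: complex)" by (simp add: square_integrable_def)
    ultimately have "is_eigenvalue M T (cnj (e\<^sup>2))"
      unfolding is_eigenvalue_def by (intro exI[of _ "\<lambda>_. 1"]) simp
    with eig show False by simp
  qed
  have "(\<lambda>n. L2_norm M (W.koop_avg (cmoment_sq g) n)) \<longlonglongrightarrow> 0"
  proof (rule W.mean_ergodic[OF pm pb])
    fix u assume u: "square_integrable M u" and inv: "AE x in M. e\<^sup>2 * u (T x) = u x"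
    have "AE x in M. u (T x) = cnj (e\<^sup>2) * u x"
      using inv
    proof eventually_elim
      case (elim x)
      have "cnj (e\<^sup>2) * u x = cnj (e\<^sup>2) * e\<^sup>2 * u (T x)" unfolding elim[symmetric] by (simp only: mult.assoc)
      then show ?case unfolding ee by simp
    qed
    with u eig show "AE x in M. u x = 0" unfolding is_eigenvalue_def by blast
  qed (use ne1 in simp)
  from W.quenched_average[OF pm pb this]
  show ?thesis by (simp add: W.koop_avg_def W.koop_sum_def W.koop_def)
qed

text \<open>The martingale approximation of the twisted sum of a coboundary, with explicit boundary terms.\<close>

lemma koop_sum_coboundary:
  "koop_sum (\<lambda>x. g x - cexp (koop 1 g) x) n x = koop 1 g x - koop (Suc n) g x + koop_sum (mart_diff 1 g) n x"
proof (induction n)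
  case (Suc n)
  have "koop (Suc n) (mart_diff 1 g) x = koop (Suc (Suc n)) g x - koop (Suc n) (cexp (koop 1 g)) x"
    unfolding mart_diff_def[abs_def] koop_diff koop_koop by simp
  moreover have "koop (Suc n) (\<lambda>x. g x - cexp (koop 1 g) x) x = koop (Suc n) g x - koop (Suc n) (cexp (koop 1 g)) x"
    by (rule koop_diff)
  moreover have "koop_sum u (Suc n) x = koop_sum u n x + koop (Suc n) u x" for u by (simp add: koop_sum_def)
  ultimately show ?case using Suc by simp
qed (simp add: koop_sum_def)

lemma koop_sum_eq_koop_mart_sum: "koop_sum (mart_diff 1 g) n = koop 1 (mart_sum 1 1 g n)"
proof (rule ext)
  fix x
  have "koop_sum (mart_diff 1 g) n x = (\<Sum>l<n. koop (1 + l) (mart_diff 1 g) x)"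
    unfolding koop_sum_def by (rule sum.reindex_bij_witness[of _ Suc "\<lambda>k. k - 1"]) auto
  also have "\<dots> = (\<Sum>l<n. koop 1 (koop (l * 1) (mart_diff 1 g)) x)" by (simp add: koop_koop)
  also have "\<dots> = koop 1 (mart_sum 1 1 g n) x" by (simp only: mart_sum_def koop_def[of 1] sum_distrib_left)
  finally show "koop_sum (mart_diff 1 g) n x = koop 1 (mart_sum 1 1 g n) x" .
qed

lemma L2_norm_koop_sum_mart_diff:
  assumes "square_integrable M g" "g \<in> borel_measurable F"
  shows "L2_norm M (koop_sum (mart_diff 1 g) n) = sqrt (real n) * L2_norm M (mart_diff 1 g)"
proof -
  have "L2_norm M (koop_sum (mart_diff 1 g) n) = L2_norm M (mart_sum 1 1 g n)"
    unfolding koop_sum_eq_koop_mart_sum by (rule koop_square_integrable(2)[OF mart_sum_square_integrable[OF assms(1)]])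
  moreover have "(L2_norm M (mart_sum 1 1 g n))\<^sup>2 = (sqrt (real n) * L2_norm M (mart_diff 1 g))\<^sup>2"
    using L2_norm_mart_sum_eq[OF assms, of 1 1 n] by (simp add: power_mult_distrib)
  then have "L2_norm M (mart_sum 1 1 g n) = sqrt (real n) * L2_norm M (mart_diff 1 g)"
    by (rule power2_eq_imp_eq) auto
  ultimately show ?thesis by simp
qed

text \<open>Approximating coboundaries are chosen with Maxwell-Woodroofe norm of the error at most \<open>2\<^sup>-\<^sup>i\<close>. These errors are summable, so the
  maximal inequality makes the error of the \<open>i\<close>-th approximation, uniformly in \<open>n\<close>, tend to \<open>0\<close> almost surely. In \<open>L\<^sup>2 (M)\<close> the
  same approximation identifies the limit of the variances as the limit of the variances of the approximating martingale
  differences.\<close>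

lemma quenched_fourier_limit:
  fixes C :: "complex set"
  assumes f: "square_integrable M f" "f \<in> borel_measurable F" and mw: "MW_summable f"
    and inv: "invertible_mpt M T" and erg: "ergodic M T"
    and eig: "\<not> is_eigenvalue M T (cnj (e\<^sup>2))" and C: "countable C"
  shows "\<exists>\<sigma>2. (\<lambda>n. (L2_norm M (koop_sum f n))\<^sup>2 / real n) \<longlonglongrightarrow> \<sigma>2 \<and>
    (AE \<omega> in M. (\<forall>c\<in>C. (\<lambda>n. cexp (\<lambda>x. exp (\<i> * complex_of_real (Re (c * koop_sum f n x) / sqrt (real n)))) \<omega>)
         \<longlonglongrightarrow> exp (complex_of_real (- (cmod c)\<^sup>2 * \<sigma>2 / 4))) \<and>
       (\<forall>n. square_integrable (\<kappa> \<omega>) (koop_sum f n)) \<and>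
       (\<exists>b. \<forall>n. L2_norm (\<kappa> \<omega>) (koop_sum f n) \<le> sqrt (real n) * b))"
proof -
  define r where "r g x = f x - (g x - cexp (koop 1 g) x)" for g x
  have "\<forall>i. \<exists>g K. g \<in> borel_measurable F \<and> (\<forall>x. cmod (g x) \<le> K) \<and> MW_summable (r g) \<and> MW_norm (r g) \<le> (1 / 2) ^ i"
  proof
    fix i :: nat
    show "\<exists>g K. g \<in> borel_measurable F \<and> (\<forall>x. cmod (g x) \<le> K) \<and> MW_summable (r g) \<and> MW_norm (r g) \<le> (1 / 2) ^ i"
      using bounded_coboundary_approximation[OF f mw, of "(1 / 2) ^ i"] unfolding r_def[abs_def] by simp
  qed
  then obtain g K where gF: "\<And>i. g i \<in> borel_measurable F" and gK: "\<And>i x. cmod (g i x) \<le> K i"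
    and rs: "\<And>i. MW_summable (r (g i))" and rn: "\<And>i. MW_norm (r (g i)) \<le> (1 / 2) ^ i" by metis
  define R where "R i = r (g i)" for i
  define d where "d i = mart_diff 1 (g i)" for i
  define \<rho> where "\<rho> i = L2_norm M (d i)" for i
  have gs: "square_integrable M (g i)" for i by (rule g_square_integrable[OF gF gK])
  have K0: "0 \<le> K i" for i by (rule K_nonneg[OF gF gK])
  have R: "square_integrable M (R i)" for i unfolding R_def r_def[abs_def]
    by (intro square_integrable_minus f gs cexp_square_integrable koop_square_integrable)
  have RF: "R i \<in> borel_measurable F" for i
  proof -
    have "cexp (koop 1 (g i)) \<in> borel_measurable F"
      by (rule cexp_measurable_F[OF koop_measurable[OF F_measurable[OF gF]]])
    with f(2) gF[of i] show ?thesis unfolding R_def r_def[abs_def] by measurable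
  qed
  have ds: "square_integrable M (d i)" for i unfolding d_def by (rule mart_diff_square_integrable[OF gs])
  note ts = koop_sum_square_integrable[OF f(1)] and td = koop_sum_square_integrable[OF ds] and tR = koop_sum_square_integrable[OF R]
  have diff: "cmod (koop_sum f n x - koop_sum (d i) n x - koop_sum (R i) n x) \<le> 2 * K i" for i n x
  proof -
    have "f = (\<lambda>x. R i x + (g i x - cexp (koop 1 (g i)) x))" by (simp add: R_def r_def fun_eq_iff)
    then have "koop_sum f n x = koop_sum (\<lambda>x. R i x + (g i x - cexp (koop 1 (g i)) x)) n x" by (rule arg_cong)
    also have "\<dots> = koop_sum (R i) n x + koop_sum (\<lambda>x. g i x - cexp (koop 1 (g i)) x) n x" by (rule koop_sum_add)
    finally have "koop_sum f n x - koop_sum (d i) n x - koop_sum (R i) n x = koop 1 (g i) x - koop (Suc n) (g i) x"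
      by (simp add: koop_sum_coboundary d_def del: One_nat_def)
    then show ?thesis
      using norm_triangle_ineq4[of "koop 1 (g i) x" "koop (Suc n) (g i) x"] gK[of i "(T ^^ 1) x"] gK[of i "(T ^^ Suc n) x"]
      by (simp only: cmod_koop)
  qed
  define a where "a n = L2_norm M (koop_sum f n) / sqrt (real n)" for n
  have half: "(\<lambda>i. C * (1 / 2 :: real) ^ i) \<longlonglongrightarrow> 0" for C
    by (rule tendsto_mult_right_zero) (rule LIMSEQ_realpow_zero, auto)
  have "\<bar>a n - \<rho> i\<bar> \<le> 2 * (1 / 2) ^ i + 2 * K i / sqrt (real n)" if n: "1 \<le> n" for i n
  proof -
    let ?D = "\<lambda>x. koop_sum f n x - koop_sum (d i) n x"
    have D: "square_integrable M ?D" by (rule square_integrable_minus(1)[OF ts td])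
    have "\<bar>L2_norm M (koop_sum f n) - L2_norm M (koop_sum (d i) n)\<bar> \<le> L2_norm M ?D" by (rule L2_norm_diff_ge[OF ts td])
    also have "\<dots> \<le> L2_norm M (koop_sum (R i) n) + L2_norm M (\<lambda>x. ?D x - koop_sum (R i) n x)"
      using square_integrable_add(2)[OF tR[of i n] square_integrable_minus(1)[OF D tR[of i n]]] by simp
    also have "L2_norm M (\<lambda>x. ?D x - koop_sum (R i) n x) \<le> 2 * K i"
      by (rule bounded_square_integrable(2)[OF square_integrableD(1)[OF square_integrable_minus(1)[OF D tR]]])
         (use diff K0 in auto)
    also have "L2_norm M (koop_sum (R i) n) \<le> 2 * sqrt (real n) * MW_norm (R i)"
      by (rule L2_norm_koop_sum_le[OF R RF]) (simp add: R_def rs)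
    also have "2 * sqrt (real n) * MW_norm (R i) \<le> 2 * sqrt (real n) * (1 / 2) ^ i"
      by (intro mult_left_mono) (auto simp: R_def rn)
    finally have 1: "\<bar>L2_norm M (koop_sum f n) - sqrt (real n) * \<rho> i\<bar> \<le> 2 * sqrt (real n) * (1 / 2) ^ i + 2 * K i"
      unfolding \<rho>_def d_def L2_norm_koop_sum_mart_diff[OF gs gF] by simp
    have sn: "0 < sqrt (real n)" using n by simp
    have "a n - \<rho> i = (L2_norm M (koop_sum f n) - sqrt (real n) * \<rho> i) / sqrt (real n)"
      using sn by (simp add: a_def diff_divide_distrib)
    then have "\<bar>a n - \<rho> i\<bar> = \<bar>L2_norm M (koop_sum f n) - sqrt (real n) * \<rho> i\<bar> / sqrt (real n)"
      using sn by (simp only: abs_divide abs_of_pos)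
    also have "\<dots> \<le> (2 * sqrt (real n) * (1 / 2) ^ i + 2 * K i) / sqrt (real n)" using 1 sn by (intro divide_right_mono) auto
    also have "\<dots> = 2 * (1 / 2) ^ i + 2 * K i / sqrt (real n)" using sn by (simp add: add_divide_distrib)
    finally show ?thesis .
  qed
  from convergent_approximation[OF this half] obtain l where l: "a \<longlonglongrightarrow> l" "\<rho> \<longlonglongrightarrow> l" by blast
  define \<sigma>2 where "\<sigma>2 = l\<^sup>2"
  have s2: "(\<lambda>n. (L2_norm M (koop_sum f n))\<^sup>2 / real n) \<longlonglongrightarrow> \<sigma>2"
  proof -
    have "(\<lambda>n. (a n)\<^sup>2) \<longlonglongrightarrow> \<sigma>2" unfolding \<sigma>2_def by (intro tendsto_intros l)
    then show ?thesis by (simp add: a_def power_divide)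
  qed
  have aeR: "AE \<omega> in M. (\<forall>i. MW_max (R i) \<omega> \<noteq> top) \<and> summable (\<lambda>i. enn2real (MW_max (R i) \<omega>))"
  proof (rule AE_summable_of_nn_integral_le)
    show "MW_max (R i) \<in> borel_measurable M" for i by (rule MW_max_measurable[OF RF])
    show "(\<integral>\<^sup>+\<omega>. MW_max (R i) \<omega> \<partial>M) \<le> ennreal (6 * (1 / 2) ^ i)" for i
    proof -
      have "(\<integral>\<^sup>+\<omega>. MW_max (R i) \<omega> \<partial>M) \<le> ennreal (6 * MW_norm (R i))"
        by (rule nn_integral_MW_max[OF R RF]) (simp add: R_def rs)
      also have "\<dots> \<le> ennreal (6 * (1 / 2) ^ i)" by (intro ennreal_leI) (simp add: R_def rn)
      finally show ?thesis .
    qed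
    show "summable (\<lambda>i. 6 * (1 / 2 :: real) ^ i)" by (intro summable_mult summable_geometric) simp
  qed simp
  have aeRn: "AE \<omega> in M. \<forall>i. MW_max (R i) \<omega> \<noteq> top \<longrightarrow>
     (\<forall>n. L2_norm (\<kappa> \<omega>) (koop_sum (R i) n) \<le> sqrt (real n) * enn2real (MW_max (R i) \<omega>))"
    by (rule AE_all_countable[THEN iffD2], rule allI, rule kernel_koop_sum_le[OF R RF])
  have aeRs: "AE \<omega> in M. \<forall>i n. square_integrable (\<kappa> \<omega>) (koop_sum (R i) n)"
    by (rule AE_all_countable[THEN iffD2], rule allI, rule AE_all_countable[THEN iffD2], rule allI, rule kernel_square_integrable[OF tR])
  have aeds: "AE \<omega> in M. \<forall>i n. square_integrable (\<kappa> \<omega>) (koop_sum (d i) n)"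
    by (rule AE_all_countable[THEN iffD2], rule allI, rule AE_all_countable[THEN iffD2], rule allI, rule kernel_square_integrable[OF td])
  have aef: "AE \<omega> in M. \<forall>n. square_integrable (\<kappa> \<omega>) (koop_sum f n)"
    by (rule AE_all_countable[THEN iffD2], rule allI, rule kernel_square_integrable[OF ts])
  have fm: "AE \<omega> in M. MW_max f \<omega> \<noteq> \<infinity>"
  proof (rule nn_integral_PInf_AE[OF MW_max_measurable[OF f(2)]])
    have "(\<integral>\<^sup>+\<omega>. MW_max f \<omega> \<partial>M) < top" by (rule le_less_trans[OF nn_integral_MW_max[OF f mw]]) simp
    then show "(\<integral>\<^sup>+\<omega>. MW_max f \<omega> \<partial>M) \<noteq> \<infinity>" by simp
  qed
  \<comment> \<open>The conditional characteristic functions of the approximating martingales and of the twisted sums.\<close>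
  let ?psi = "\<lambda>c i n \<omega>. cexp (\<lambda>x. exp (\<i> * complex_of_real (Re (c * koop_sum (d i) n x) / sqrt (real n)))) \<omega>"
  let ?phi = "\<lambda>c n \<omega>. cexp (\<lambda>x. exp (\<i> * complex_of_real (Re (c * koop_sum f n x) / sqrt (real n)))) \<omega>"
  have clt: "AE \<omega> in M. \<forall>c\<in>C. \<forall>i. (\<lambda>n. ?psi c i n \<omega>) \<longlonglongrightarrow> exp (complex_of_real (- (cmod c)\<^sup>2 * (\<rho> i)\<^sup>2 / 4))"
  proof (rule AE_ball_countable[OF C, THEN iffD2], rule ballI, rule AE_all_countable[THEN iffD2], rule allI)
    fix c i
    show "AE \<omega> in M. (\<lambda>n. ?psi c i n \<omega>) \<longlonglongrightarrow> exp (complex_of_real (- (cmod c)\<^sup>2 * (\<rho> i)\<^sup>2 / 4))"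
      unfolding \<rho>_def d_def
      by (rule martingale_clt[OF gF gK quenched_average_cmoment_abs[OF inv erg gF gK] quenched_average_cmoment_sq[OF eig gF gK]])
  qed
  have "AE \<omega> in M. (\<forall>c\<in>C. (\<lambda>n. ?phi c n \<omega>) \<longlonglongrightarrow> exp (complex_of_real (- (cmod c)\<^sup>2 * \<sigma>2 / 4))) \<and>
       (\<forall>n. square_integrable (\<kappa> \<omega>) (koop_sum f n)) \<and>
       (\<exists>b. \<forall>n. L2_norm (\<kappa> \<omega>) (koop_sum f n) \<le> sqrt (real n) * b)"
    using aeR aeRn aeRs aeds aef fm kernel_koop_sum_le[OF f] clt AE_space
  proof eventually_elim
    case (elim \<omega>)
    interpret P: prob_space "\<kappa> \<omega>" by (rule kernel_prob[OF elim(9)])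
    define y where "y i = enn2real (MW_max (R i) \<omega>)" for i
    have y: "y \<longlonglongrightarrow> 0" using elim(1) unfolding y_def by (intro summable_LIMSEQ_zero) auto
    have yb: "L2_norm (\<kappa> \<omega>) (koop_sum (R i) n) \<le> sqrt (real n) * y i" for i n using elim(1,2) by (auto simp: y_def)
    have "(\<lambda>n. ?phi c n \<omega>) \<longlonglongrightarrow> exp (complex_of_real (- (cmod c)\<^sup>2 * \<sigma>2 / 4))" if c: "c \<in> C" for c
    proof (rule tendsto_approximation)
      show "(\<lambda>n. ?psi c i n \<omega>) \<longlonglongrightarrow> exp (complex_of_real (- (cmod c)\<^sup>2 * (\<rho> i)\<^sup>2 / 4))" for i
        using elim(8) c by blast
      show "(\<lambda>i. cmod c * y i) \<longlonglongrightarrow> 0" by (rule tendsto_mult_right_zero[OF y])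
      show "(\<lambda>i. exp (complex_of_real (- (cmod c)\<^sup>2 * (\<rho> i)\<^sup>2 / 4))) \<longlonglongrightarrow> exp (complex_of_real (- (cmod c)\<^sup>2 * \<sigma>2 / 4))"
        unfolding \<sigma>2_def by (intro tendsto_intros l) simp
      show "cmod (?phi c n \<omega> - ?psi c i n \<omega>) \<le> cmod c * y i + cmod c * (2 * K i) / sqrt (real n)" if n: "1 \<le> n" for i n
      proof -
        have sn: "0 < sqrt (real n)" using n by simp
        let ?e = "\<lambda>h x. exp (\<i> * complex_of_real (Re (c * h x) / sqrt (real n)))"
        have em: "?e h \<in> borel_measurable M" if "h \<in> borel_measurable M" for h using that by measurable
        have ei: "integrable (\<kappa> \<omega>) (?e h)" if "h \<in> borel_measurable M" for h
          by (rule bounded_kernel_integrable(1)[OF em[OF that] _ elim(9), of 1]) simp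
        note i1 = ei[OF square_integrableD(1)[OF ts[of n]]] and i2 = ei[OF square_integrableD(1)[OF td[of i n]]]
        have Rs: "square_integrable (\<kappa> \<omega>) (koop_sum (R i) n)" using elim(3) by blast
        let ?U = "\<lambda>x. cmod c / sqrt (real n) * (cmod (koop_sum (R i) n x) + 2 * K i)"
        have iU: "integrable (\<kappa> \<omega>) ?U"
          using P.square_integrable_imp_integrable(1)[OF Rs] by (intro integrable_mult_right Bochner_Integration.integrable_add) auto
        have ptw: "cmod (?e (koop_sum f n) x - ?e (koop_sum (d i) n) x) \<le> ?U x" for x
        proof -
          let ?z = "koop_sum f n x - koop_sum (d i) n x"
          have "cmod (?e (koop_sum f n) x - ?e (koop_sum (d i) n) x) \<le> \<bar>Re (c * koop_sum f n x) / sqrt (real n) - Re (c * koop_sum (d i) n x) / sqrt (real n)\<bar>"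
            by (rule cmod_iexp_diff_le)
          also have "Re (c * koop_sum f n x) / sqrt (real n) - Re (c * koop_sum (d i) n x) / sqrt (real n) = Re (c * ?z) / sqrt (real n)"
            by (simp only: diff_divide_distrib[symmetric] minus_complex.sel[symmetric] right_diff_distrib[symmetric])
          also have "\<bar>Re (c * ?z) / sqrt (real n)\<bar> \<le> cmod (c * ?z) / sqrt (real n)"
            unfolding abs_divide using abs_Re_le_cmod[of "c * ?z"] sn by (simp add: divide_right_mono del: times_complex.sel)
          also have "\<dots> = cmod c / sqrt (real n) * cmod ?z" by (simp add: norm_mult)
          also have "\<dots> \<le> ?U x"
          proof (rule mult_left_mono)
            have "?z = koop_sum (R i) n x + (?z - koop_sum (R i) n x)" by simp
            then show "cmod ?z \<le> cmod (koop_sum (R i) n x) + 2 * K i"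
              using norm_triangle_ineq[of "koop_sum (R i) n x" "?z - koop_sum (R i) n x"] diff[of n x i] by simp
          qed simp
          finally show ?thesis .
        qed
        have "cmod (?phi c n \<omega> - ?psi c i n \<omega>) = cmod (\<integral>x. ?e (koop_sum f n) x - ?e (koop_sum (d i) n) x \<partial>\<kappa> \<omega>)"
          unfolding cexp_def by (simp only: Bochner_Integration.integral_diff[OF i1 i2])
        also have "\<dots> \<le> (\<integral>x. cmod (?e (koop_sum f n) x - ?e (koop_sum (d i) n) x) \<partial>\<kappa> \<omega>)" by (rule integral_norm_bound)
        also have "\<dots> \<le> (\<integral>x. ?U x \<partial>\<kappa> \<omega>)"
          by (rule integral_mono[OF integrable_norm[OF Bochner_Integration.integrable_diff[OF i1 i2]] iU ptw])
        also have "\<dots> = cmod c / sqrt (real n) * ((\<integral>x. cmod (koop_sum (R i) n x) \<partial>\<kappa> \<omega>) + 2 * K i)"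
          using P.square_integrable_imp_integrable(1)[OF Rs] by (simp add: P.prob_space)
        also have "\<dots> \<le> cmod c / sqrt (real n) * (sqrt (real n) * y i + 2 * K i)"
          using P.square_integrable_imp_integrable(2)[OF Rs] yb[of i n] by (intro mult_left_mono add_right_mono) auto
        also have "\<dots> = cmod c * y i + cmod c * (2 * K i) / sqrt (real n)" using sn by (simp add: field_simps)
        finally show ?thesis .
      qed
    qed
    moreover have "\<exists>b. \<forall>n. L2_norm (\<kappa> \<omega>) (koop_sum f n) \<le> sqrt (real n) * b" using elim(6,7) by auto
    ultimately show ?case using elim(5) by blast
  qed
  with s2 show ?thesis by blast
qed

end

section \<open>Fourier sums of a stationary process\<close>

theorem theorem6:
  fixes M F :: "'a measure"
    and T :: "'a \<Rightarrow> 'a"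
    and \<kappa> :: "'a \<Rightarrow> 'a measure"
    and X :: "int \<Rightarrow> 'a \<Rightarrow> real"
    and t :: real
  assumes "prob_space M"
    and "countably_generated M"
    and "invertible_mpt M T"
    and "ergodic M T"
    and "subalgebra M F"
    and "sets F \<subseteq> (\<lambda>B. T -` B \<inter> space M) ` sets F"
    and "regular_cond_prob M F \<kappa>"
    and "\<And>k \<omega>. \<omega> \<in> space M \<Longrightarrow> X k \<omega> = X 0 (iterate M T k \<omega>)"
    and "X 0 \<in> borel_measurable F"
    and "square_integrable M (X 0)"
    and "(\<integral>\<omega>. X 0 \<omega> \<partial>M) = 0"
    and "0 < t" and "t < 2 * pi"
    and "\<not> is_eigenvalue M T (exp (- 2 * \<i> * of_real t))"
    and "summable (\<lambda>j. let k = Suc j in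
           L2_norm M (complex_cond_exp M F (fourier_sum X t k)) / real k powr (3 / 2))"
  shows "\<exists>\<sigma>2 :: real.
           (\<lambda>n. (\<integral>\<omega>. (cmod (fourier_sum X t n \<omega>))\<^sup>2 \<partial>M) / real n) \<longlonglongrightarrow> \<sigma>2 \<and>
           (\<exists>\<Omega>'\<in>sets M. measure M \<Omega>' = 1 \<and>
             (\<forall>\<omega>\<in>\<Omega>'. \<forall>g :: real \<times> real \<Rightarrow> real. continuous_on UNIV g \<longrightarrow> bounded (range g) \<longrightarrow>
               (\<forall>(Q :: 'b measure) N\<^sub>1 N\<^sub>2. iid_normal_pair Q N\<^sub>1 N\<^sub>2 0 (\<sigma>2 / 2) \<longrightarrow>
                 (\<lambda>n. \<integral>\<omega>'. g (fourier_vec X t n \<omega>') \<partial>\<kappa> \<omega>)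
                   \<longlonglongrightarrow> (\<integral>q. g (N\<^sub>1 q, N\<^sub>2 q) \<partial>Q))))"
proof -
  let ?e = "exp (\<i> * complex_of_real t)"
  define f where "f x = complex_of_real (X 0 x)" for x
  have T: "bij_betw T (space M) (space M)" "T \<in> measurable M M" "distr M M T = M"
    using assms(3) by (auto simp: invertible_mpt_def)
  interpret twisted_system M F T \<kappa> ?e
    by (intro twisted_system.intro kernel_system.intro kernel_system_axioms.intro twisted_system_axioms.intro
        assms(1) assms(5-7) T) (rule norm_exp_i_times)
  have X: "X (int k) \<omega> = X 0 ((T ^^ k) \<omega>)" if "\<omega> \<in> space M" for k \<omega>
    using assms(8)[OF that, of "int k"] by (simp add: iterate_def)
  have fsum: "fourier_sum X t n \<omega> = koop_sum f n \<omega>" if "\<omega> \<in> space M" for n \<omega>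
    unfolding fourier_sum_def koop_sum_def koop_def f_def
  proof (rule sum.cong[OF refl])
    fix k
    have "exp (\<i> * of_nat k * complex_of_real t) = ?e ^ k"
      by (simp add: exp_of_nat_mult[symmetric] mult_ac)
    then show "exp (\<i> * of_nat k * complex_of_real t) * complex_of_real (X (int k) \<omega>) = ?e ^ k * complex_of_real (X 0 ((T ^^ k) \<omega>))"
      using X[OF that] by simp
  qed
  have fF: "f \<in> borel_measurable F" unfolding f_def[abs_def] using assms(9) by measurable
  have f: "square_integrable M f"
    using assms(10) fF[THEN F_measurable] by (simp add: square_integrable_def f_def)
  note ts = koop_sum_square_integrable[OF f]
  have fm: "fourier_sum X t n \<in> borel_measurable M" for n
    using square_integrableD(1)[OF ts[of n]] measurable_cong[of M "fourier_sum X t n" "koop_sum f n"] fsum by blast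
  have fs: "square_integrable M (fourier_sum X t n)" for n
    by (rule square_integrable_cong_AE(1)[OF ts[of n] fm]) (auto simp: fsum)
  have L: "(\<integral>\<omega>. (cmod (fourier_sum X t n \<omega>))\<^sup>2 \<partial>M) = (L2_norm M (koop_sum f n))\<^sup>2" for n
    unfolding L2_norm_power2 by (rule Bochner_Integration.integral_cong) (auto simp: fsum)
  have cn: "L2_norm M (complex_cond_exp M F (fourier_sum X t n)) = cexp_sum_norm f n" for n
    unfolding cexp_sum_norm_def
  proof (rule square_integrable_cong_AE(2)[OF cexp_square_integrable(1)[OF ts]])
    have "complex_cond_exp M F (fourier_sum X t n) =
      (\<lambda>x. complex_of_real (real_cond_exp M F (\<lambda>y. Re (fourier_sum X t n y)) x) + \<i> * complex_of_real (real_cond_exp M F (\<lambda>y. Im (fourier_sum X t n y)) x))"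
      by (simp add: fun_eq_iff complex_cond_exp_def complex_eq_iff)
    moreover have "\<dots> \<in> borel_measurable M"
      by (intro borel_measurable_add borel_measurable_times borel_measurable_const measurable_compose[OF borel_measurable_cond_exp2 borel_measurable_of_real])
    ultimately show "complex_cond_exp M F (fourier_sum X t n) \<in> borel_measurable M" by simp
    have c: "cexp (fourier_sum X t n) \<omega> = cexp (koop_sum f n) \<omega>" if "\<omega> \<in> space M" for \<omega>
      unfolding cexp_def using kernel_space[OF that] by (intro Bochner_Integration.integral_cong) (auto simp: fsum)
    show "AE \<omega> in M. complex_cond_exp M F (fourier_sum X t n) \<omega> = cexp (koop_sum f n) \<omega>"
      using cexp_eq_complex_cond_exp[OF square_integrable_imp_integrable(1)[OF fs[of n]]] AE_space
      by eventually_elim (simp add: c)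
  qed
  have mw: "MW_summable f"
    by (rule MW_summableI[OF f]) (use assms(15) in \<open>simp only: Let_def cn\<close>)
  have eig: "\<not> is_eigenvalue M T (cnj (?e\<^sup>2))"
  proof -
    have "cnj (?e\<^sup>2) = exp (- 2 * \<i> * complex_of_real t)"
      by (simp add: exp_cnj exp_double[symmetric] mult.assoc)
    then show ?thesis using assms(14) by simp
  qed
  \<comment> \<open>\<open>Re (c * z) = a * Re z + b * Im z\<close> for \<open>c = Complex a (- b)\<close>, so these are the rational plane waves.\<close>
  define C where "C = (\<lambda>(a, b). Complex a (- b)) ` (\<rat> \<times> \<rat> :: (real \<times> real) set)"
  have C: "countable C" unfolding C_def by (intro countable_image countable_SIGMA countable_rat)
  obtain \<sigma>2 where s2: "(\<lambda>n. (L2_norm M (koop_sum f n))\<^sup>2 / real n) \<longlonglongrightarrow> \<sigma>2"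
    and ae: "AE \<omega> in M. (\<forall>c\<in>C. (\<lambda>n. cexp (\<lambda>x. exp (\<i> * complex_of_real (Re (c * koop_sum f n x) / sqrt (real n)))) \<omega>)
         \<longlonglongrightarrow> exp (complex_of_real (- (cmod c)\<^sup>2 * \<sigma>2 / 4))) \<and>
       (\<forall>n. square_integrable (\<kappa> \<omega>) (koop_sum f n)) \<and>
       (\<exists>b. \<forall>n. L2_norm (\<kappa> \<omega>) (koop_sum f n) \<le> sqrt (real n) * b)"
    using quenched_fourier_limit[OF f fF mw assms(3,4) eig C] by blast
  have s20: "0 \<le> \<sigma>2" by (rule LIMSEQ_le_const[OF s2]) auto
  define Good where "Good \<omega> \<longleftrightarrow> (\<forall>c\<in>C. (\<lambda>n. cexp (\<lambda>x. exp (\<i> * complex_of_real (Re (c * koop_sum f n x) / sqrt (real n)))) \<omega>)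
         \<longlonglongrightarrow> exp (complex_of_real (- (cmod c)\<^sup>2 * \<sigma>2 / 4))) \<and>
       (\<forall>n. square_integrable (\<kappa> \<omega>) (koop_sum f n)) \<and>
       (\<exists>b. \<forall>n. L2_norm (\<kappa> \<omega>) (koop_sum f n) \<le> sqrt (real n) * b)" for \<omega>
  obtain S where sub: "S \<subseteq> {\<omega> \<in> space M. Good \<omega>}" and S: "S \<in> sets M" "measure M S = 1"
    by (rule AE_E_prob[OF ae[folded Good_def]])
  have Sspace: "\<omega> \<in> space M" if "\<omega> \<in> S" for \<omega> using subsetD[OF sub that] by simp
  have good: "\<And>c. c \<in> C \<Longrightarrow> (\<lambda>n. cexp (\<lambda>x. exp (\<i> * complex_of_real (Re (c * koop_sum f n x) / sqrt (real n)))) \<omega>)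
         \<longlonglongrightarrow> exp (complex_of_real (- (cmod c)\<^sup>2 * \<sigma>2 / 4))"
       "\<And>n. square_integrable (\<kappa> \<omega>) (koop_sum f n)"
       "\<exists>b. \<forall>n. L2_norm (\<kappa> \<omega>) (koop_sum f n) \<le> sqrt (real n) * b" if "\<omega> \<in> S" for \<omega>
    using subsetD[OF sub that] unfolding Good_def mem_Collect_eq by blast+
  have main: "(\<lambda>n. \<integral>\<omega>'. g (fourier_vec X t n \<omega>') \<partial>\<kappa> \<omega>) \<longlonglongrightarrow> (\<integral>q. g (N\<^sub>1 q, N\<^sub>2 q) \<partial>Q)"
    if w: "\<omega> \<in> S" and g: "continuous_on UNIV g" "bounded (range g)" and N: "iid_normal_pair Q N\<^sub>1 N\<^sub>2 0 (\<sigma>2 / 2)"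
    for \<omega> and g :: "real \<times> real \<Rightarrow> real" and Q :: "'b measure" and N\<^sub>1 N\<^sub>2
  proof (rule wave_weak_convergence[OF _ _ _ _ _ _ g])
    have ws: "\<omega> \<in> space M" by (rule Sspace[OF w])
    show P: "prob_space (\<kappa> \<omega>)" by (rule kernel_prob[OF ws])
    interpret P: prob_space "\<kappa> \<omega>" by (rule P)
    show Q: "prob_space Q" using N by (simp add: iid_normal_pair_def)
    interpret Q: prob_space Q by (rule Q)
    have vm: "fourier_vec X t n \<in> borel_measurable M" for n
      unfolding fourier_vec_def[abs_def] using fm[of n] by measurable
    show vk: "fourier_vec X t n \<in> borel_measurable (\<kappa> \<omega>)" for n by (rule kernel_meas[OF ws vm])
    have "Q.indep_var borel N\<^sub>1 borel N\<^sub>2" using N by (simp add: iid_normal_pair_def)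
    then have [measurable]: "N\<^sub>1 \<in> borel_measurable Q" "N\<^sub>2 \<in> borel_measurable Q"
      by (auto dest: Q.indep_var_rv1 Q.indep_var_rv2)
    show "(\<lambda>q. (N\<^sub>1 q, N\<^sub>2 q)) \<in> borel_measurable Q" by measurable
    show "(\<lambda>n. \<integral>x. wave a b (fourier_vec X t n x) \<partial>\<kappa> \<omega>) \<longlonglongrightarrow> (\<integral>q. wave a b (N\<^sub>1 q, N\<^sub>2 q) \<partial>Q)"
      if "a \<in> \<rat>" "b \<in> \<rat>" for a b
    proof -
      let ?c = "Complex a (- b)"
      have c: "?c \<in> C" unfolding C_def using that by force
      have "(\<integral>x. wave a b (fourier_vec X t n x) \<partial>\<kappa> \<omega>) =
         cexp (\<lambda>x. exp (\<i> * complex_of_real (Re (?c * koop_sum f n x) / sqrt (real n)))) \<omega>" for n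
        unfolding cexp_def
      proof (rule Bochner_Integration.integral_cong[OF refl])
        fix x assume "x \<in> space (\<kappa> \<omega>)"
        then have "fourier_sum X t n x = koop_sum f n x" using kernel_space[OF ws] fsum by simp
        then have "a * fst (fourier_vec X t n x) + b * snd (fourier_vec X t n x) = Re (?c * koop_sum f n x) / sqrt (real n)"
          by (simp add: fourier_vec_def add_divide_distrib)
        then show "wave a b (fourier_vec X t n x) = exp (\<i> * complex_of_real (Re (?c * koop_sum f n x) / sqrt (real n)))"
          unfolding wave_def by (simp only:)
      qed
      moreover have "(\<integral>q. wave a b (N\<^sub>1 q, N\<^sub>2 q) \<partial>Q) = exp (complex_of_real (- (cmod ?c)\<^sup>2 * \<sigma>2 / 4))"
      proof -
        have m: "(cmod ?c)\<^sup>2 = a\<^sup>2 + b\<^sup>2" by (simp add: cmod_power2)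
        have "- (\<sigma>2 / 2) * (a\<^sup>2 + b\<^sup>2) / 2 = - (cmod ?c)\<^sup>2 * \<sigma>2 / 4"
          unfolding m by (simp add: field_simps)
        then show ?thesis using iid_normal_pair_wave[OF N, of a b] s20 by (simp only: exp_of_real[symmetric])
      qed
      ultimately show ?thesis using good(1)[OF w c] by simp
    qed
    show "\<exists>r. \<forall>n. measure (\<kappa> \<omega>) {x \<in> space (\<kappa> \<omega>). r < norm (fourier_vec X t n x)} < \<epsilon>" if eps: "0 < \<epsilon>" for \<epsilon>
    proof -
      obtain b where b: "\<And>n. L2_norm (\<kappa> \<omega>) (koop_sum f n) \<le> sqrt (real n) * b" using good(3)[OF w] by blast
      \<comment> \<open>The radius for which Chebyshev's inequality bounds the tail by \<open>\<epsilon>\<close>.\<close>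
      define r where "r = sqrt (b\<^sup>2 / \<epsilon>) + 1"
      have r: "0 < r" "b\<^sup>2 < r\<^sup>2 * \<epsilon>"
      proof -
        have s: "0 \<le> sqrt (b\<^sup>2 / \<epsilon>)" using eps by simp
        then show "0 < r" unfolding r_def by (rule add_nonneg_pos) simp
        have "b\<^sup>2 / \<epsilon> = (sqrt (b\<^sup>2 / \<epsilon>))\<^sup>2" using eps by simp
        also have "\<dots> < r\<^sup>2" using s by (intro power_strict_mono) (auto simp: r_def)
        finally show "b\<^sup>2 < r\<^sup>2 * \<epsilon>" using eps by (simp add: field_simps)
      qed
      have "measure (\<kappa> \<omega>) {x \<in> space (\<kappa> \<omega>). r < norm (fourier_vec X t n x)} < \<epsilon>" for n
      proof -
        let ?A = "{x \<in> space (\<kappa> \<omega>). r < norm (fourier_vec X t n x)}"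
        note [measurable] = vk
        have A: "?A \<in> sets (\<kappa> \<omega>)" by measurable
        have nv: "(norm (fourier_vec X t n x))\<^sup>2 = (cmod (koop_sum f n x))\<^sup>2 / real n" if "x \<in> space (\<kappa> \<omega>)" for x
        proof -
          have "fourier_sum X t n x = koop_sum f n x" using that kernel_space[OF ws] fsum by simp
          then show ?thesis by (simp add: fourier_vec_def norm_Pair power_mult_distrib power_divide cmod_power2 add_divide_distrib)
        qed
        have sq: "integrable (\<kappa> \<omega>) (\<lambda>x. (cmod (koop_sum f n x))\<^sup>2 / real n)"
          by (rule integrable_divide_zero) (rule square_integrableD(2)[OF good(2)[OF w]])
        have "r\<^sup>2 * measure (\<kappa> \<omega>) ?A = (\<integral>x. r\<^sup>2 * indicator ?A x \<partial>\<kappa> \<omega>)" using A by simp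
        also have "\<dots> \<le> (\<integral>x. (cmod (koop_sum f n x))\<^sup>2 / real n \<partial>\<kappa> \<omega>)"
        proof (rule integral_mono[OF _ sq])
          show "integrable (\<kappa> \<omega>) (\<lambda>x. r\<^sup>2 * indicator ?A x)" using A by (simp add: P.emeasure_eq_measure)
          fix x assume x: "x \<in> space (\<kappa> \<omega>)"
          show "r\<^sup>2 * indicator ?A x \<le> (cmod (koop_sum f n x))\<^sup>2 / real n"
          proof (cases "x \<in> ?A")
            case True
            then have "r\<^sup>2 \<le> (norm (fourier_vec X t n x))\<^sup>2" using r by (intro power_mono) auto
            then show ?thesis using True nv[OF x] by simp
          qed simp
        qed
        also have "\<dots> = (L2_norm (\<kappa> \<omega>) (koop_sum f n))\<^sup>2 / real n" by (simp add: L2_norm_power2)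
        also have "\<dots> \<le> b\<^sup>2"
        proof (cases "n = 0")
          case False
          have "(L2_norm (\<kappa> \<omega>) (koop_sum f n))\<^sup>2 \<le> (sqrt (real n) * b)\<^sup>2" by (intro power_mono b) simp
          then show ?thesis using False by (simp add: power_mult_distrib field_simps)
        qed simp
        also have "\<dots> < r\<^sup>2 * \<epsilon>" by (rule r)
        finally show ?thesis using r(1) by simp
      qed
      then show ?thesis by blast
    qed
  qed
  show ?thesis
  proof (intro exI[of _ \<sigma>2] conjI bexI[of _ S] S ballI allI impI)
    show "(\<lambda>n. (\<integral>\<omega>. (cmod (fourier_sum X t n \<omega>))\<^sup>2 \<partial>M) / real n) \<longlonglongrightarrow> \<sigma>2" unfolding L by (rule s2)
  qed (rule main)
qed

end
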